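(* Let $\mathcal P$ be a $\tau$-category equipped with a pseudo-triangulated category structure given by a singular $\tau$-extension $$0\to\Upsilon\xrightarrow{i}\mathsf{Ptr}\xrightarrow{p}\mathcal P^{[1]}\to0$$ (and a $\tau$-transformation $\varphi:\Delta\to\Upsilon$). Then the following conditions are equivalent: (i) There is a triangulated category structure on $\mathcal P$ (with the given translation) and a domination $\mathsf{Triangles}_0(\mathcal P)\le\mathsf{Ptr}$. (ii) There is a functor $L:\mathsf{Ptr}\to\mathcal P$ which is left adjoint to the functor $\mathcal P\to\mathsf{Ptr}$, $X\mapsto{!_X}$, such that $[-1]\circ L$ is right adjoint to the functor $\mathcal P\to\mathsf{Ptr}$, $X\mapsto{}^X!$, and $\{v_f,u_f,f\}=\mathrm{id}_{A[1]}$ (i.e. the Massey product is the class of $\mathrm{id}_{A[1]}$) for all morphisms $f:A\to B$ of $\mathcal P$. Here, with $w_f:[f]\to{!_{L([f])}}$ the unit of the adjunction, $u_f:B\to L([f])$ is defined by $!_{u_f}=w_f\circ i_f$ and $v_f:L([f])\to A[1]$ by $j_f={!_{v_f}}\circ w_f$.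
   Context: Translation categories. A $\tau$-category is an additive category with a fixed autoequivalence $X\mapsto X[1]$ (with iterates $X[n]$, $n\in\mathbb Z$). A $\tau$-functor is an additive functor $F$ with $F(X[1])=F(X)[1]$. A $\tau$-bifunctor on $\mathbb A$ is a bifunctor $D:\mathbb A^{\mathrm{op}}\times\mathbb A\to\mathsf{Ab}$ with natural isomorphisms $t_{A,B}:D(A,B)\to D(A[1],B[1])$; a $\tau$-transformation is a natural transformation commuting with the $t$'s. The kernel of a $\tau$-functor is a $\tau$-bifunctor via $f\mapsto f[1]$. Singular extensions. A singular extension $0\to D\xrightarrow{i}\mathbb A\xrightarrow{F}\mathbb B\to0$ consists of an additive category $\mathbb A$, an additive functor $F:\mathbb A\to\mathbb B$ such that the ideal $\ker F$ of morphisms killed by $F$ is square zero and $\mathbb A/\ker F\to\mathbb B$ is an isomorphism of categories, and an isomorphism of bifunctors $i:D(F(-),F(-))\to\ker F$. It is a singular $\tau$-extension if $\mathbb A,\mathbb B$ are $\tau$-categories, $F$ is a $\tau$-functor, $D$ is a $\tau$-bifunctor on $\mathbb B$ and $i$ is an isomorphism of $\tau$-bifunctors. Arrow category. $\mathcal P^{[1]}$ has as objects the morphisms of $\mathcal P$ (written $\mathring f$) and as morphisms $\mathring f\to\mathring f'$, for $f:A\to B$, $f':A'\to B'$, the pairs $(a:A\to A',b:B\to B')$ with $bf=f'a$; its translation is $\tau(\mathring f)=-f[1]$, $\tau(a,b)=(a[1],b[1])$. For an object $X$, $!_X$ denotes the arrow $0\to X$ and ${}^X!$ the arrow $X\to0$.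 Toda bifunctor. $\Delta(\mathring f,\mathring f')$ is the quotient of $\mathrm{Hom}_{\mathcal P}(A[1],B')$ by $\{f'g-h\circ f[1]\mid g:A[1]\to A',h:B[1]\to B'\}$, a $\tau$-bifunctor via $x\mapsto x[1]$. Pseudo-triangulated category. A morphism $f$ is splittable if $fsf=f$ for some $s$. A pseudo-triangulated structure on a $\tau$-category $\mathcal P$ is a singular $\tau$-extension $0\to\Upsilon\xrightarrow{i}\mathsf{Ptr}\xrightarrow{p}\mathcal P^{[1]}\to0$ together with a $\tau$-transformation $\varphi:\Delta\to\Upsilon$ such that $\varphi(\mathring f,\mathring f')$ is an isomorphism whenever $f$ or $f'$ is splittable. The object of $\mathsf{Ptr}$ over $\mathring f$ is written $[f]$ (objects $!_X,{}^X!$ keep their names). Since $\Upsilon(!_X,-)=0$ and $\Upsilon(-,{}^X!)=0$, the full embeddings $X\mapsto{!_X}$ and $X\mapsto{}^X!$ of $\mathcal P$ in $\mathcal P^{[1]}$ lift uniquely to $\mathsf{Ptr}$; write $!_f:{!_A}\to{!_B}$ for the image of $f$. Canonical sequence. One has $\mathrm{Hom}_{\mathsf{Ptr}}({}^A!,!_B)=\Upsilon({}^A!,!_B)\cong\Delta({}^A!,!_B)=\mathrm{Hom}_{\mathcal P}(A[1],B)$; $j_A:{}^A!\to{!_{A[1]}}$ corresponds to $\mathrm{id}_{A[1]}$. For $f:A\to B$: $i_f:{!_B}\to[f]$ is the unique lift of $(0,\mathrm{id}_B)$, $k_f:[f]\to{}^A!$ is the unique lift of $(\mathrm{id}_A,0)$,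 and $j_f=j_A\circ k_f$. Massey product. Given $X\xrightarrow{f}Y\xrightarrow{g}Z\xrightarrow{h}W$ in $\mathcal P$ with $gf=0$, $hg=0$, choose $x:{}^X!\to[g]$ and $w:[g]\to{!_W}$ in $\mathsf{Ptr}$ with $p(x)=(f,0)$, $p(w)=(0,h)$. Then $wx\in\Upsilon({}^X!,!_W)\cong\mathrm{Hom}_{\mathcal P}(X[1],W)$, and $\{h,g,f\}$ is the class of $wx$ in $\mathrm{Hom}_{\mathcal P}(X[1],W)/(h_*\mathrm{Hom}_{\mathcal P}(X[1],Z)+(f[1])^*\mathrm{Hom}_{\mathcal P}(Y[1],W))$, which is independent of the choices. Triangulated category (Puppe). A class of distinguished triangles $X\to Y\to Z\to X[1]$ such that: (TR1) it is closed under isomorphism; (TR2) $X\xrightarrow{\mathrm{id}}X\to0\to X[1]$ is distinguished; (TR3) if $X\xrightarrow{f}Y\xrightarrow{g}Z\xrightarrow{h}X[1]$ is distinguished then so is $Y\xrightarrow{g}Z\xrightarrow{h}X[1]\xrightarrow{-f[1]}Y[1]$; (TR4) every $f:X\to Y$ is the first map of some distinguished triangle; (TR5) any commutative square between the first maps of two distinguished triangles extends to a morphism of triangles. No octahedral axiom. Associated structure and domination. If $\mathcal T$ is a triangulated category with chosen distinguished triangles $A\xrightarrow{f}B\xrightarrow{u_f}C_f\xrightarrow{v_f}A[1]$, then $\mathsf{Triangles}_0(\mathcal T)$ has objects $[f]$, and morphisms $[f]\to[f']$ the triples $(a,b,c:C_f\to C_{f'})$ giving morphisms of triangles, with translation $[f]\mapsto[-f[1]]$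 (triangle $(-f[1],-u_f[1],-v_f[1])$), $(a,b,c)\mapsto(a[1],b[1],c[1])$. With $\pi(a,b,c)=(a,b)$, $\Theta=\ker\pi$, i.e. $\Theta(\mathring f,\mathring f')=\{c:C_f\to C_{f'}\mid cu_f=0,v_{f'}c=0\}$, and $\theta:\Delta\to\Theta$ induced by $x\mapsto u_{f'}xv_f$, this is a pseudo-triangulated structure on $\mathcal T$. For two pseudo-triangulated structures $(\Upsilon,\mathsf{Ptr},\varphi)$, $(\Upsilon_1,\mathsf{Ptr}_1,\varphi_1)$ on the same $\tau$-category, $\mathsf{Ptr}_1\le\mathsf{Ptr}$ ("domination") means that the second is the pushforward of the first along some $\tau$-transformation $\xi:\Upsilon\to\Upsilon_1$ which is an isomorphism whenever one of the arguments is a split morphism (one isomorphic to some $\left(\begin{smallmatrix}1&0\\0&0\end{smallmatrix}\right):X\oplus X'\to X\oplus X''$): $\varphi_1=\xi\varphi$ and there is a $\tau$-functor $j:\mathsf{Ptr}\to\mathsf{Ptr}_1$, identity on objects, compatible with the functors to $\mathcal P^{[1]}$ and restricting to $\xi$ on kernels (so $\mathrm{Hom}_{\mathsf{Ptr}_1}$ is the pushout of $\mathrm{Hom}_{\mathsf{Ptr}}$ along $\xi$).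
   Formalization: The Massey product is taken as the class of −wx, since with wx a distinguished triangle (f,u,v) gives {v,u,f} = −id and the claim fails (f=3 on Z in D^b(Ab)); chosen triangles in Triangles_0 agree with translation only up to chosen isomorphisms, as a strictly invariant choice may not exist. *)

theory Defs
  imports "HOL-Algebra.Coset"
begin

section \<open>Additive categories with a translation\<close>

text \<open>
  A category is given by a set of objects and a set of arrows, each arrow having its own
  domain and codomain. The arrows \<open>A \<rightarrow> B\<close> form an abelian group, which is
  presented as a monoid record, so that the notions of HOL-Algebra apply; hence
  sums of arrows are products \<open>\<otimes>\<close>, and negatives are inverses, in \<open>homgrp C A B\<close>.
  The fields \<open>ShO\<close> and \<open>ShM\<close> are the translation \<open>X \<mapsto> X[1]\<close> on objects and on arrows.
\<close>

record ('o, 'm) tcat =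
  Ob  :: "'o set"
  Arr :: "'m set"
  Dom :: "'m \<Rightarrow> 'o"
  Cod :: "'m \<Rightarrow> 'o"
  Ide :: "'o \<Rightarrow> 'm"
  Comp :: "'m \<Rightarrow> 'm \<Rightarrow> 'm"  (infixr \<open>\<cdot>\<index>\<close> 75)
  Add :: "'m \<Rightarrow> 'm \<Rightarrow> 'm"
  Zero :: "'o \<Rightarrow> 'o \<Rightarrow> 'm"
  ShO :: "'o \<Rightarrow> 'o"
  ShM :: "'m \<Rightarrow> 'm"

definition Hom :: "('o, 'm) tcat \<Rightarrow> 'o \<Rightarrow> 'o \<Rightarrow> 'm set" where
  "Hom C A B = {f \<in> Arr C. Dom C f = A \<and> Cod C f = B}"

definition homgrp :: "('o, 'm) tcat \<Rightarrow> 'o \<Rightarrow> 'o \<Rightarrow> 'm monoid" where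
  "homgrp C A B = \<lparr>carrier = Hom C A B, mult = Add C, one = Zero C A B\<rparr>"

definition Neg :: "('o, 'm) tcat \<Rightarrow> 'm \<Rightarrow> 'm" where
  "Neg C f = inv\<^bsub>homgrp C (Dom C f) (Cod C f)\<^esub> f"

locale category =
  fixes C :: "('o, 'm) tcat" (structure)
  assumes dom_ob: "f \<in> Arr C \<Longrightarrow> Dom C f \<in> Ob C"
    and cod_ob: "f \<in> Arr C \<Longrightarrow> Cod C f \<in> Ob C"
    and ide_hom: "A \<in> Ob C \<Longrightarrow> Ide C A \<in> Hom C A A"
    and comp_hom: "\<lbrakk>f \<in> Hom C A B; g \<in> Hom C B D\<rbrakk> \<Longrightarrow> g \<cdot> f \<in> Hom C A D"
    and comp_ide_left: "f \<in> Hom C A B \<Longrightarrow> Ide C B \<cdot> f = f"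
    and comp_ide_right: "f \<in> Hom C A B \<Longrightarrow> f \<cdot> Ide C A = f"
    and comp_assoc: "\<lbrakk>f \<in> Hom C A B; g \<in> Hom C B D; h \<in> Hom C D E\<rbrakk>
      \<Longrightarrow> (h \<cdot> g) \<cdot> f = h \<cdot> (g \<cdot> f)"

definition zero_object :: "('o, 'm) tcat \<Rightarrow> 'o \<Rightarrow> bool" where
  "zero_object C Z \<longleftrightarrow> Z \<in> Ob C \<and>
     (\<forall>A\<in>Ob C. (\<exists>!f. f \<in> Hom C A Z) \<and> (\<exists>!f. f \<in> Hom C Z A))"

definition biproduct ::
  "('o, 'm) tcat \<Rightarrow> 'o \<Rightarrow> 'o \<Rightarrow> 'o \<Rightarrow> 'm \<Rightarrow> 'm \<Rightarrow> 'm \<Rightarrow> 'm \<Rightarrow> bool" where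
  "biproduct C A B S i\<^sub>1 i\<^sub>2 p\<^sub>1 p\<^sub>2 \<longleftrightarrow>
     A \<in> Ob C \<and> B \<in> Ob C \<and> S \<in> Ob C \<and>
     i\<^sub>1 \<in> Hom C A S \<and> i\<^sub>2 \<in> Hom C B S \<and> p\<^sub>1 \<in> Hom C S A \<and> p\<^sub>2 \<in> Hom C S B \<and>
     p\<^sub>1 \<cdot>\<^bsub>C\<^esub> i\<^sub>1 = Ide C A \<and> p\<^sub>2 \<cdot>\<^bsub>C\<^esub> i\<^sub>2 = Ide C B \<and>
     p\<^sub>1 \<cdot>\<^bsub>C\<^esub> i\<^sub>2 = Zero C B A \<and> p\<^sub>2 \<cdot>\<^bsub>C\<^esub> i\<^sub>1 = Zero C A B \<and>
     Add C (i\<^sub>1 \<cdot>\<^bsub>C\<^esub> p\<^sub>1) (i\<^sub>2 \<cdot>\<^bsub>C\<^esub> p\<^sub>2) = Ide C S"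

locale additive_category = category +
  assumes hom_comm_group: "\<lbrakk>A \<in> Ob C; B \<in> Ob C\<rbrakk> \<Longrightarrow> comm_group (homgrp C A B)"
    and comp_add_left: "\<lbrakk>f \<in> Hom C A B; g \<in> Hom C B D; g' \<in> Hom C B D\<rbrakk>
      \<Longrightarrow> Add C g g' \<cdot> f = Add C (g \<cdot> f) (g' \<cdot> f)"
    and comp_add_right: "\<lbrakk>f \<in> Hom C A B; f' \<in> Hom C A B; g \<in> Hom C B D\<rbrakk>
      \<Longrightarrow> g \<cdot> Add C f f' = Add C (g \<cdot> f) (g \<cdot> f')"
    and ex_zero_object: "\<exists>Z. zero_object C Z"
    and ex_biproduct: "\<lbrakk>A \<in> Ob C; B \<in> Ob C\<rbrakk>
      \<Longrightarrow> \<exists>S i\<^sub>1 i\<^sub>2 p\<^sub>1 p\<^sub>2. biproduct C A B S i\<^sub>1 i\<^sub>2 p\<^sub>1 p\<^sub>2"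

definition zob :: "('o, 'm) tcat \<Rightarrow> 'o" where
  "zob C = (SOME Z. zero_object C Z)"

definition inverse_arrows :: "('o, 'm) tcat \<Rightarrow> 'm \<Rightarrow> 'm \<Rightarrow> bool" where
  "inverse_arrows C f g \<longleftrightarrow> f \<in> Arr C \<and> g \<in> Hom C (Cod C f) (Dom C f) \<and>
     g \<cdot>\<^bsub>C\<^esub> f = Ide C (Dom C f) \<and> f \<cdot>\<^bsub>C\<^esub> g = Ide C (Cod C f)"

definition iso_arrow :: "('o, 'm) tcat \<Rightarrow> 'm \<Rightarrow> bool" where
  "iso_arrow C f \<longleftrightarrow> (\<exists>g. inverse_arrows C f g)"

definition Inv :: "('o, 'm) tcat \<Rightarrow> 'm \<Rightarrow> 'm" where
  "Inv C f = (THE g. inverse_arrows C f g)"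


subsection \<open>Functors and adjunctions\<close>

record ('o, 'm, 'p, 'n) ftor =
  FO :: "'o \<Rightarrow> 'p"
  FM :: "'m \<Rightarrow> 'n"

definition id_ftor :: "('o, 'm, 'o, 'm) ftor" where
  "id_ftor = \<lparr>FO = (\<lambda>X. X), FM = (\<lambda>f. f)\<rparr>"

definition comp_ftor ::
  "('p, 'n, 'q, 'r) ftor \<Rightarrow> ('o, 'm, 'p, 'n) ftor \<Rightarrow> ('o, 'm, 'q, 'r) ftor" where
  "comp_ftor G F = \<lparr>FO = FO G \<circ> FO F, FM = FM G \<circ> FM F\<rparr>"

definition shift_ftor :: "('o, 'm) tcat \<Rightarrow> ('o, 'm, 'o, 'm) ftor" where
  "shift_ftor C = \<lparr>FO = ShO C, FM = ShM C\<rparr>"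

definition is_ftor :: "('o, 'm) tcat \<Rightarrow> ('p, 'n) tcat \<Rightarrow> ('o, 'm, 'p, 'n) ftor \<Rightarrow> bool" where
  "is_ftor C D F \<longleftrightarrow>
     (\<forall>X\<in>Ob C. FO F X \<in> Ob D) \<and>
     (\<forall>X\<in>Ob C. \<forall>Y\<in>Ob C. \<forall>f\<in>Hom C X Y. FM F f \<in> Hom D (FO F X) (FO F Y)) \<and>
     (\<forall>X\<in>Ob C. FM F (Ide C X) = Ide D (FO F X)) \<and>
     (\<forall>f\<in>Arr C. \<forall>g\<in>Arr C. Dom C g = Cod C f \<longrightarrow>
        FM F (g \<cdot>\<^bsub>C\<^esub> f) = FM F g \<cdot>\<^bsub>D\<^esub> FM F f)"

definition additive_ftor ::
  "('o, 'm) tcat \<Rightarrow> ('p, 'n) tcat \<Rightarrow> ('o, 'm, 'p, 'n) ftor \<Rightarrow> bool" where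
  "additive_ftor C D F \<longleftrightarrow> is_ftor C D F \<and>
     (\<forall>X\<in>Ob C. \<forall>Y\<in>Ob C. FM F \<in> hom (homgrp C X Y) (homgrp D (FO F X) (FO F Y)))"

definition nat_trans ::
  "('o, 'm) tcat \<Rightarrow> ('p, 'n) tcat \<Rightarrow> ('o, 'm, 'p, 'n) ftor \<Rightarrow> ('o, 'm, 'p, 'n) ftor
    \<Rightarrow> ('o \<Rightarrow> 'n) \<Rightarrow> bool" where
  "nat_trans C D F G \<eta> \<longleftrightarrow>
     (\<forall>X\<in>Ob C. \<eta> X \<in> Hom D (FO F X) (FO G X)) \<and>
     (\<forall>f\<in>Arr C. \<eta> (Cod C f) \<cdot>\<^bsub>D\<^esub> FM F f = FM G f \<cdot>\<^bsub>D\<^esub> \<eta> (Dom C f))"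

definition nat_isomorphic ::
  "('o, 'm) tcat \<Rightarrow> ('p, 'n) tcat \<Rightarrow> ('o, 'm, 'p, 'n) ftor \<Rightarrow> ('o, 'm, 'p, 'n) ftor
    \<Rightarrow> bool" where
  "nat_isomorphic C D F G \<longleftrightarrow>
     (\<exists>\<eta>. nat_trans C D F G \<eta> \<and> (\<forall>X\<in>Ob C. iso_arrow D (\<eta> X)))"

text \<open>
  \<open>inverse_translation C M\<close>: the functor \<open>M\<close> is a quasi-inverse \<open>[-1]\<close> of the translation.
  The translation is an autoequivalence and not required to be bijective on objects.
\<close>

definition inverse_translation :: "('o, 'm) tcat \<Rightarrow> ('o, 'm, 'o, 'm) ftor \<Rightarrow> bool" where
  "inverse_translation C M \<longleftrightarrow> is_ftor C C M \<and>
     nat_isomorphic C C (comp_ftor M (shift_ftor C)) id_ftor \<and>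
     nat_isomorphic C C (comp_ftor (shift_ftor C) M) id_ftor"

definition tau_category :: "('o, 'm) tcat \<Rightarrow> bool" where
  "tau_category C \<longleftrightarrow> additive_category C \<and> additive_ftor C C (shift_ftor C) \<and>
     (\<exists>M. inverse_translation C M)"

definition tau_ftor :: "('o, 'm) tcat \<Rightarrow> ('p, 'n) tcat \<Rightarrow> ('o, 'm, 'p, 'n) ftor \<Rightarrow> bool" where
  "tau_ftor C D F \<longleftrightarrow> additive_ftor C D F \<and>
     (\<forall>X\<in>Ob C. FO F (ShO C X) = ShO D (FO F X)) \<and>
     (\<forall>f\<in>Arr C. FM F (ShM C f) = ShM D (FM F f))"

text \<open>\<open>adjunction C D L R \<eta>\<close>: \<open>L : C \<rightarrow> D\<close> is left adjoint to \<open>R : D \<rightarrow> C\<close> with unit \<open>\<eta>\<close>.\<close>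

definition adjunction ::
  "('o, 'm) tcat \<Rightarrow> ('p, 'n) tcat \<Rightarrow> ('o, 'm, 'p, 'n) ftor \<Rightarrow> ('p, 'n, 'o, 'm) ftor
    \<Rightarrow> ('o \<Rightarrow> 'm) \<Rightarrow> bool" where
  "adjunction C D L R \<eta> \<longleftrightarrow>
     is_ftor C D L \<and> is_ftor D C R \<and> nat_trans C C id_ftor (comp_ftor R L) \<eta> \<and>
     (\<forall>X\<in>Ob C. \<forall>Y\<in>Ob D. \<forall>g\<in>Hom C X (FO R Y).
        \<exists>!h. h \<in> Hom D (FO L X) Y \<and> FM R h \<cdot>\<^bsub>C\<^esub> \<eta> X = g)"


section \<open>Bifunctors and singular extensions\<close>

text \<open>
  For \<open>g : A' \<rightarrow> A\<close> and \<open>f : B \<rightarrow> B'\<close>, \<open>BM D g f\<close> is the map \<open>D(A,B) \<rightarrow> D(A',B')\<close>;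
  \<open>BT D A B\<close> is the isomorphism \<open>t\<^sub>A\<^sub>,\<^sub>B : D(A,B) \<rightarrow> D(A[1],B[1])\<close>.
\<close>

record ('o, 'm, 'd) bifun =
  BG :: "'o \<Rightarrow> 'o \<Rightarrow> 'd monoid"
  BM :: "'m \<Rightarrow> 'm \<Rightarrow> 'd \<Rightarrow> 'd"
  BT :: "'o \<Rightarrow> 'o \<Rightarrow> 'd \<Rightarrow> 'd"

definition bifunctor :: "('o, 'm) tcat \<Rightarrow> ('o, 'm, 'd) bifun \<Rightarrow> bool" where
  "bifunctor C D \<longleftrightarrow>
     (\<forall>A\<in>Ob C. \<forall>B\<in>Ob C. comm_group (BG D A B)) \<and>
     (\<forall>g\<in>Arr C. \<forall>f\<in>Arr C.
        BM D g f \<in> hom (BG D (Cod C g) (Dom C f)) (BG D (Dom C g) (Cod C f))) \<and>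
     (\<forall>A\<in>Ob C. \<forall>B\<in>Ob C. \<forall>x\<in>carrier (BG D A B). BM D (Ide C A) (Ide C B) x = x) \<and>
     (\<forall>g\<in>Arr C. \<forall>g'\<in>Arr C. \<forall>f\<in>Arr C. \<forall>f'\<in>Arr C.
        Cod C g' = Dom C g \<and> Dom C f' = Cod C f \<longrightarrow>
        (\<forall>x\<in>carrier (BG D (Cod C g) (Dom C f)).
           BM D (g \<cdot>\<^bsub>C\<^esub> g') (f' \<cdot>\<^bsub>C\<^esub> f) x = BM D g' f' (BM D g f x)))"

definition tau_bifunctor :: "('o, 'm) tcat \<Rightarrow> ('o, 'm, 'd) bifun \<Rightarrow> bool" where
  "tau_bifunctor C D \<longleftrightarrow> bifunctor C D \<and>
     (\<forall>A\<in>Ob C. \<forall>B\<in>Ob C. BT D A B \<in> iso (BG D A B) (BG D (ShO C A) (ShO C B))) \<and>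
     (\<forall>g\<in>Arr C. \<forall>f\<in>Arr C. \<forall>x\<in>carrier (BG D (Cod C g) (Dom C f)).
        BT D (Dom C g) (Cod C f) (BM D g f x) =
        BM D (ShM C g) (ShM C f) (BT D (Cod C g) (Dom C f) x))"

definition bifun_trans ::
  "('o, 'm) tcat \<Rightarrow> ('o, 'm, 'd) bifun \<Rightarrow> ('o, 'm, 'e) bifun \<Rightarrow> ('o \<Rightarrow> 'o \<Rightarrow> 'd \<Rightarrow> 'e)
    \<Rightarrow> bool" where
  "bifun_trans C D E \<phi> \<longleftrightarrow>
     (\<forall>A\<in>Ob C. \<forall>B\<in>Ob C. \<phi> A B \<in> hom (BG D A B) (BG E A B)) \<and>
     (\<forall>g\<in>Arr C. \<forall>f\<in>Arr C. \<forall>x\<in>carrier (BG D (Cod C g) (Dom C f)).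
        \<phi> (Dom C g) (Cod C f) (BM D g f x) = BM E g f (\<phi> (Cod C g) (Dom C f) x))"

definition tau_trans ::
  "('o, 'm) tcat \<Rightarrow> ('o, 'm, 'd) bifun \<Rightarrow> ('o, 'm, 'e) bifun \<Rightarrow> ('o \<Rightarrow> 'o \<Rightarrow> 'd \<Rightarrow> 'e)
    \<Rightarrow> bool" where
  "tau_trans C D E \<phi> \<longleftrightarrow> bifun_trans C D E \<phi> \<and>
     (\<forall>A\<in>Ob C. \<forall>B\<in>Ob C. \<forall>x\<in>carrier (BG D A B).
        \<phi> (ShO C A) (ShO C B) (BT D A B x) = BT E A B (\<phi> A B x))"

text \<open>The bifunctors \<open>D(F(-),F(-))\<close> and \<open>ker F\<close>.\<close>

definition pull_bifun ::
  "('o, 'm, 'p, 'n) ftor \<Rightarrow> ('p, 'n, 'd) bifun \<Rightarrow> ('o, 'm, 'd) bifun" where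
  "pull_bifun F D = \<lparr>
     BG = (\<lambda>X Y. BG D (FO F X) (FO F Y)),
     BM = (\<lambda>g f. BM D (FM F g) (FM F f)),
     BT = (\<lambda>X Y. BT D (FO F X) (FO F Y))\<rparr>"

definition ker_hom ::
  "('o, 'm) tcat \<Rightarrow> ('p, 'n) tcat \<Rightarrow> ('o, 'm, 'p, 'n) ftor \<Rightarrow> 'o \<Rightarrow> 'o \<Rightarrow> 'm set" where
  "ker_hom A B F X Y = kernel (homgrp A X Y) (homgrp B (FO F X) (FO F Y)) (FM F)"

definition ker_bifun ::
  "('o, 'm) tcat \<Rightarrow> ('p, 'n) tcat \<Rightarrow> ('o, 'm, 'p, 'n) ftor \<Rightarrow> ('o, 'm, 'm) bifun" where
  "ker_bifun A B F = \<lparr>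
     BG = (\<lambda>X Y. (homgrp A X Y)\<lparr>carrier := ker_hom A B F X Y\<rparr>),
     BM = (\<lambda>g f x. f \<cdot>\<^bsub>A\<^esub> x \<cdot>\<^bsub>A\<^esub> g),
     BT = (\<lambda>X Y. ShM A)\<rparr>"

text \<open>
  The last two conjuncts of \<open>quotient_iso\<close> say that the functor \<open>A/ker F \<rightarrow> B\<close> induced
  by \<open>F\<close> is bijective on objects and an isomorphism on each group of arrows
  \<open>Hom(X,Y)/ker F(X,Y) \<rightarrow> Hom(F X, F Y)\<close>, that is, an isomorphism of categories.
\<close>

definition quotient_iso ::
  "('o, 'm) tcat \<Rightarrow> ('p, 'n) tcat \<Rightarrow> ('o, 'm, 'p, 'n) ftor \<Rightarrow> bool" where
  "quotient_iso A B F \<longleftrightarrow> additive_ftor A B F \<and>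
     bij_betw (FO F) (Ob A) (Ob B) \<and>
     (\<forall>X\<in>Ob A. \<forall>Y\<in>Ob A. (\<lambda>K. the_elem (FM F ` K)) \<in>
        iso (homgrp A X Y Mod ker_hom A B F X Y) (homgrp B (FO F X) (FO F Y)))"

definition singular_extension ::
  "('p, 'n, 'd) bifun \<Rightarrow> ('o \<Rightarrow> 'o \<Rightarrow> 'd \<Rightarrow> 'm) \<Rightarrow> ('o, 'm) tcat
    \<Rightarrow> ('o, 'm, 'p, 'n) ftor \<Rightarrow> ('p, 'n) tcat \<Rightarrow> bool" where
  "singular_extension D i A F B \<longleftrightarrow>
     additive_category A \<and> additive_category B \<and> additive_ftor A B F \<and> bifunctor B D \<and>
     (\<forall>X\<in>Ob A. \<forall>Y\<in>Ob A. \<forall>Z\<in>Ob A. \<forall>f\<in>ker_hom A B F X Y. \<forall>g\<in>ker_hom A B F Y Z.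
        g \<cdot>\<^bsub>A\<^esub> f = Zero A X Z) \<and>
     quotient_iso A B F \<and>
     bifun_trans A (pull_bifun F D) (ker_bifun A B F) i \<and>
     (\<forall>X\<in>Ob A. \<forall>Y\<in>Ob A. i X Y \<in> iso (BG (pull_bifun F D) X Y) (BG (ker_bifun A B F) X Y))"

definition singular_tau_extension ::
  "('p, 'n, 'd) bifun \<Rightarrow> ('o \<Rightarrow> 'o \<Rightarrow> 'd \<Rightarrow> 'm) \<Rightarrow> ('o, 'm) tcat
    \<Rightarrow> ('o, 'm, 'p, 'n) ftor \<Rightarrow> ('p, 'n) tcat \<Rightarrow> bool" where
  "singular_tau_extension D i A F B \<longleftrightarrow> singular_extension D i A F B \<and>
     tau_category A \<and> tau_category B \<and> tau_ftor A B F \<and> tau_bifunctor B D \<and>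
     tau_trans A (pull_bifun F D) (ker_bifun A B F) i"


section \<open>The arrow category and the Toda bifunctor\<close>

text \<open>An arrow \<open>(a,b)\<close> from \<open>f\<close> to \<open>f'\<close> is represented as \<open>(f, f', a, b)\<close>.\<close>

type_synonym 'm sq = "'m \<times> 'm \<times> 'm \<times> 'm"

definition arrowcat :: "('o, 'm) tcat \<Rightarrow> ('m, 'm sq) tcat" where
  "arrowcat P = \<lparr>
     Ob = Arr P,
     Arr = {(f, f', a, b). f \<in> Arr P \<and> f' \<in> Arr P \<and>
              a \<in> Hom P (Dom P f) (Dom P f') \<and> b \<in> Hom P (Cod P f) (Cod P f') \<and>
              b \<cdot>\<^bsub>P\<^esub> f = f' \<cdot>\<^bsub>P\<^esub> a},
     Dom = (\<lambda>(f, f', a, b). f),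
     Cod = (\<lambda>(f, f', a, b). f'),
     Ide = (\<lambda>f. (f, f, Ide P (Dom P f), Ide P (Cod P f))),
     Comp = (\<lambda>(f\<^sub>1, f\<^sub>2, a', b') (f, f', a, b). (f, f\<^sub>2, a' \<cdot>\<^bsub>P\<^esub> a, b' \<cdot>\<^bsub>P\<^esub> b)),
     Add = (\<lambda>(f, f', a, b) (f\<^sub>1, f\<^sub>2, a', b'). (f, f', Add P a a', Add P b b')),
     Zero = (\<lambda>f f'. (f, f', Zero P (Dom P f) (Dom P f'), Zero P (Cod P f) (Cod P f'))),
     ShO = (\<lambda>f. Neg P (ShM P f)),
     ShM = (\<lambda>(f, f', a, b). (Neg P (ShM P f), Neg P (ShM P f'), ShM P a, ShM P b))\<rparr>"

definition splittable :: "('o, 'm) tcat \<Rightarrow> 'm \<Rightarrow> bool" where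
  "splittable P f \<longleftrightarrow> f \<in> Arr P \<and>
     (\<exists>s\<in>Hom P (Cod P f) (Dom P f). f \<cdot>\<^bsub>P\<^esub> s \<cdot>\<^bsub>P\<^esub> f = f)"

text \<open>
  The composite \<open>j\<^sub>1 \<cdot> p\<^sub>1\<close> of the projection of \<open>X \<oplus> X'\<close> and the injection into \<open>X \<oplus> X''\<close>
  is the matrix with rows \<open>(1 0)\<close> and \<open>(0 0)\<close>.
\<close>

definition split_arrow :: "('o, 'm) tcat \<Rightarrow> 'm \<Rightarrow> bool" where
  "split_arrow P f \<longleftrightarrow> (\<exists>X X' X'' S i\<^sub>1 i\<^sub>2 p\<^sub>1 p\<^sub>2 T j\<^sub>1 j\<^sub>2 q\<^sub>1 q\<^sub>2 m.
     biproduct P X X' S i\<^sub>1 i\<^sub>2 p\<^sub>1 p\<^sub>2 \<and> biproduct P X X'' T j\<^sub>1 j\<^sub>2 q\<^sub>1 q\<^sub>2 \<and>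
     m \<in> Hom (arrowcat P) f (j\<^sub>1 \<cdot>\<^bsub>P\<^esub> p\<^sub>1) \<and> iso_arrow (arrowcat P) m)"

definition toda_rel :: "('o, 'm) tcat \<Rightarrow> 'm \<Rightarrow> 'm \<Rightarrow> 'm set" where
  "toda_rel P f f' =
     {Add P (f' \<cdot>\<^bsub>P\<^esub> g) (Neg P (h \<cdot>\<^bsub>P\<^esub> ShM P f)) | g h.
        g \<in> Hom P (ShO P (Dom P f)) (Dom P f') \<and> h \<in> Hom P (ShO P (Cod P f)) (Cod P f')}"

definition toda_class :: "('o, 'm) tcat \<Rightarrow> 'm \<Rightarrow> 'm \<Rightarrow> 'm \<Rightarrow> 'm set" where
  "toda_class P f f' x =
     toda_rel P f f' #>\<^bsub>homgrp P (ShO P (Dom P f)) (Cod P f')\<^esub> x"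

text \<open>
  The maps between the quotient groups are induced by \<open>x \<mapsto> b' x a[1]\<close> and \<open>x \<mapsto> x[1]\<close>; the
  unions below are over classes that coincide, so they are again a single class.
\<close>

definition Toda :: "('o, 'm) tcat \<Rightarrow> ('m, 'm sq, 'm set) bifun" where
  "Toda P = \<lparr>
     BG = (\<lambda>f f'. homgrp P (ShO P (Dom P f)) (Cod P f') Mod toda_rel P f f'),
     BM = (\<lambda>(f\<^sub>0, f, a, b) (f', f\<^sub>1, a', b') K.
             \<Union>x\<in>K. toda_class P f\<^sub>0 f\<^sub>1 (b' \<cdot>\<^bsub>P\<^esub> x \<cdot>\<^bsub>P\<^esub> ShM P a)),
     BT = (\<lambda>f f' K.
             \<Union>x\<in>K. toda_class P (ShO (arrowcat P) f) (ShO (arrowcat P) f') (ShM P x))\<rparr>"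


section \<open>Pseudo-triangulated structures\<close>

text \<open>
  The singular extension \<open>0 \<rightarrow> Ups \<rightarrow> Ptr \<rightarrow> P\<^sup>[\<^sup>1\<^sup>] \<rightarrow> 0\<close> with maps \<open>Inc\<close> and \<open>Prj\<close>, together with
  \<open>Phi : \<Delta> \<rightarrow> Ups\<close>. Since \<open>Prj\<close> is bijective on objects, the objects of \<open>Ptr\<close> may have any
  type; the object \<open>[f]\<close> is \<open>pob S f\<close>.
\<close>

record ('m, 'p, 'n, 'u) pstruct =
  Ups :: "('m, 'm sq, 'u) bifun"
  Inc :: "'p \<Rightarrow> 'p \<Rightarrow> 'u \<Rightarrow> 'n"
  Ptr :: "('p, 'n) tcat"
  Prj :: "('p, 'n, 'm, 'm sq) ftor"
  Phi :: "'m \<Rightarrow> 'm \<Rightarrow> 'm set \<Rightarrow> 'u"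

definition pseudo_triangulated :: "('o, 'm) tcat \<Rightarrow> ('m, 'p, 'n, 'u) pstruct \<Rightarrow> bool" where
  "pseudo_triangulated P S \<longleftrightarrow>
     singular_tau_extension (Ups S) (Inc S) (Ptr S) (Prj S) (arrowcat P) \<and>
     tau_trans (arrowcat P) (Toda P) (Ups S) (Phi S) \<and>
     (\<forall>f\<in>Arr P. \<forall>f'\<in>Arr P. splittable P f \<or> splittable P f' \<longrightarrow>
        Phi S f f' \<in> iso (BG (Toda P) f f') (BG (Ups S) f f'))"

definition pob :: "('m, 'p, 'n, 'u) pstruct \<Rightarrow> 'm \<Rightarrow> 'p" where
  "pob S f = the_inv_into (Ob (Ptr S)) (FO (Prj S)) f"

definition lift ::
  "('m, 'p, 'n, 'u) pstruct \<Rightarrow> 'm \<Rightarrow> 'm \<Rightarrow> 'm \<Rightarrow> 'm \<Rightarrow> 'n" where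
  "lift S f f' a b =
     (THE m. m \<in> Hom (Ptr S) (pob S f) (pob S f') \<and> FM (Prj S) m = (f, f', a, b))"

text \<open>The arrows \<open>0 \<rightarrow> X\<close> and \<open>X \<rightarrow> 0\<close>, and the lifted embeddings of \<open>P\<close> in \<open>Ptr\<close>.\<close>

definition bang :: "('o, 'm) tcat \<Rightarrow> 'o \<Rightarrow> 'm" where
  "bang P X = Zero P (zob P) X"

definition cobang :: "('o, 'm) tcat \<Rightarrow> 'o \<Rightarrow> 'm" where
  "cobang P X = Zero P X (zob P)"

definition Bang :: "('o, 'm) tcat \<Rightarrow> ('m, 'p, 'n, 'u) pstruct \<Rightarrow> ('o, 'm, 'p, 'n) ftor" where
  "Bang P S = \<lparr>
     FO = (\<lambda>X. pob S (bang P X)),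
     FM = (\<lambda>g. lift S (bang P (Dom P g)) (bang P (Cod P g)) (Ide P (zob P)) g)\<rparr>"

definition Cobang :: "('o, 'm) tcat \<Rightarrow> ('m, 'p, 'n, 'u) pstruct \<Rightarrow> ('o, 'm, 'p, 'n) ftor" where
  "Cobang P S = \<lparr>
     FO = (\<lambda>X. pob S (cobang P X)),
     FM = (\<lambda>g. lift S (cobang P (Dom P g)) (cobang P (Cod P g)) g (Ide P (zob P)))\<rparr>"

text \<open>The identification \<open>Hom(A[1],B) = \<Delta>(A \<rightarrow> 0, 0 \<rightarrow> B) \<cong> Hom(A \<rightarrow> 0, 0 \<rightarrow> B)\<close> (the latter in \<open>Ptr\<close>).\<close>

definition conn :: "('o, 'm) tcat \<Rightarrow> ('m, 'p, 'n, 'u) pstruct \<Rightarrow> 'o \<Rightarrow> 'o \<Rightarrow> 'm \<Rightarrow> 'n" where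
  "conn P S A B x = Inc S (pob S (cobang P A)) (pob S (bang P B))
     (Phi S (cobang P A) (bang P B) (toda_class P (cobang P A) (bang P B) x))"

definition can_i :: "('o, 'm) tcat \<Rightarrow> ('m, 'p, 'n, 'u) pstruct \<Rightarrow> 'm \<Rightarrow> 'n" where
  "can_i P S f =
     lift S (bang P (Cod P f)) f (Zero P (zob P) (Dom P f)) (Ide P (Cod P f))"

definition can_k :: "('o, 'm) tcat \<Rightarrow> ('m, 'p, 'n, 'u) pstruct \<Rightarrow> 'm \<Rightarrow> 'n" where
  "can_k P S f =
     lift S f (cobang P (Dom P f)) (Ide P (Dom P f)) (Zero P (Cod P f) (zob P))"

definition can_j :: "('o, 'm) tcat \<Rightarrow> ('m, 'p, 'n, 'u) pstruct \<Rightarrow> 'm \<Rightarrow> 'n" where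
  "can_j P S f = conn P S (Dom P f) (ShO P (Dom P f)) (Ide P (ShO P (Dom P f)))
     \<cdot>\<^bsub>Ptr S\<^esub> can_k P S f"

definition indet :: "('o, 'm) tcat \<Rightarrow> 'm \<Rightarrow> 'm \<Rightarrow> 'm \<Rightarrow> 'm set" where
  "indet P h g f =
     {Add P (h \<cdot>\<^bsub>P\<^esub> s) (t \<cdot>\<^bsub>P\<^esub> ShM P f) | s t.
        s \<in> Hom P (ShO P (Dom P f)) (Dom P h) \<and> t \<in> Hom P (ShO P (Cod P f)) (Cod P h)}"

definition massey_class :: "('o, 'm) tcat \<Rightarrow> 'm \<Rightarrow> 'm \<Rightarrow> 'm \<Rightarrow> 'm \<Rightarrow> 'm set" where
  "massey_class P h g f y =
     indet P h g f #>\<^bsub>homgrp P (ShO P (Dom P f)) (Cod P h)\<^esub> y"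

text \<open>
  Sign convention: the Massey product is the class of the \<open>y : X[1] \<rightarrow> W\<close> for which \<open>w x\<close>
  corresponds to \<open>-y\<close> under \<open>conn\<close>. With the signs used here for triangles (rotation of
  \<open>(f, g, h)\<close> to \<open>(g, h, -f[1])\<close>, and \<open>x \<mapsto> u x v\<close> for the structure given by triangles),
  this is the normalization for which a distinguished triangle \<open>(f, u, v)\<close> satisfies
  \<open>{v, u, f} = id\<close>. Indeed, taking \<open>(u, v, -f[1])\<close> for the triangle of \<open>u\<close>, the maps
  between cones in \<open>x\<close> and \<open>w\<close> can be taken to be \<open>-id\<close> and \<open>id\<close>, so that \<open>w x\<close>
  corresponds to \<open>-id\<close>: taking the class of \<open>w x\<close> itself would give \<open>{v, u, f} = -id\<close>.
\<close>

definition massey ::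
  "('o, 'm) tcat \<Rightarrow> ('m, 'p, 'n, 'u) pstruct \<Rightarrow> 'm \<Rightarrow> 'm \<Rightarrow> 'm \<Rightarrow> 'm set" where
  "massey P S h g f = (THE K. \<exists>x w y.
     x \<in> Hom (Ptr S) (pob S (cobang P (Dom P f))) (pob S g) \<and>
     FM (Prj S) x = (cobang P (Dom P f), g, f, Zero P (zob P) (Cod P g)) \<and>
     w \<in> Hom (Ptr S) (pob S g) (pob S (bang P (Cod P h))) \<and>
     FM (Prj S) w = (g, bang P (Cod P h), Zero P (Dom P g) (zob P), h) \<and>
     y \<in> Hom P (ShO P (Dom P f)) (Cod P h) \<and>
     w \<cdot>\<^bsub>Ptr S\<^esub> x = conn P S (Dom P f) (Cod P h) (Neg P y) \<and>
     K = massey_class P h g f y)"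

text \<open>
  The maps \<open>u\<^sub>f : B \<rightarrow> L[f]\<close> and \<open>v\<^sub>f : L[f] \<rightarrow> A[1]\<close> obtained from an adjunction between \<open>L\<close>
  and \<open>Bang\<close> with unit \<open>w\<close>.
\<close>

definition adj_u ::
  "('o, 'm) tcat \<Rightarrow> ('m, 'p, 'n, 'u) pstruct \<Rightarrow> ('p, 'n, 'o, 'm) ftor \<Rightarrow> ('p \<Rightarrow> 'n)
    \<Rightarrow> 'm \<Rightarrow> 'm" where
  "adj_u P S L w f = (THE u. u \<in> Hom P (Cod P f) (FO L (pob S f)) \<and>
     FM (Bang P S) u = w (pob S f) \<cdot>\<^bsub>Ptr S\<^esub> can_i P S f)"

definition adj_v ::
  "('o, 'm) tcat \<Rightarrow> ('m, 'p, 'n, 'u) pstruct \<Rightarrow> ('p, 'n, 'o, 'm) ftor \<Rightarrow> ('p \<Rightarrow> 'n)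
    \<Rightarrow> 'm \<Rightarrow> 'm" where
  "adj_v P S L w f = (THE v. v \<in> Hom P (FO L (pob S f)) (ShO P (Dom P f)) \<and>
     can_j P S f = FM (Bang P S) v \<cdot>\<^bsub>Ptr S\<^esub> w (pob S f))"

text \<open>\<open>dominated P S\<^sub>1 S\<close> is \<open>Ptr\<^sub>1 \<le> Ptr\<close>. The objects of both are identified with those of the
  arrow category, so that a functor compatible with the projections is the identity on objects.\<close>

definition dominated ::
  "('o, 'm) tcat \<Rightarrow> ('m, 'q, 'r, 'v) pstruct \<Rightarrow> ('m, 'p, 'n, 'u) pstruct \<Rightarrow> bool" where
  "dominated P S\<^sub>1 S \<longleftrightarrow> (\<exists>\<xi> j.
     tau_trans (arrowcat P) (Ups S) (Ups S\<^sub>1) \<xi> \<and>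
     (\<forall>f\<in>Arr P. \<forall>f'\<in>Arr P. split_arrow P f \<or> split_arrow P f' \<longrightarrow>
        \<xi> f f' \<in> iso (BG (Ups S) f f') (BG (Ups S\<^sub>1) f f')) \<and>
     (\<forall>f\<in>Arr P. \<forall>f'\<in>Arr P. \<forall>x\<in>carrier (BG (Toda P) f f').
        Phi S\<^sub>1 f f' x = \<xi> f f' (Phi S f f' x)) \<and>
     tau_ftor (Ptr S) (Ptr S\<^sub>1) j \<and>
     (\<forall>X\<in>Ob (Ptr S). FO (Prj S\<^sub>1) (FO j X) = FO (Prj S) X) \<and>
     (\<forall>m\<in>Arr (Ptr S). FM (Prj S\<^sub>1) (FM j m) = FM (Prj S) m) \<and>
     (\<forall>X\<in>Ob (Ptr S). \<forall>Y\<in>Ob (Ptr S).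
        \<forall>x\<in>carrier (BG (Ups S) (FO (Prj S) X) (FO (Prj S) Y)).
          FM j (Inc S X Y x) =
          Inc S\<^sub>1 (FO j X) (FO j Y) (\<xi> (FO (Prj S) X) (FO (Prj S) Y) x)))"


section \<open>Triangulated categories\<close>

definition triangle :: "('o, 'm) tcat \<Rightarrow> 'm \<times> 'm \<times> 'm \<Rightarrow> bool" where
  "triangle P = (\<lambda>(f, g, h). f \<in> Arr P \<and> g \<in> Arr P \<and> h \<in> Arr P \<and>
     Dom P g = Cod P f \<and> Dom P h = Cod P g \<and> Cod P h = ShO P (Dom P f))"

definition triangle_map ::
  "('o, 'm) tcat \<Rightarrow> 'm \<times> 'm \<times> 'm \<Rightarrow> 'm \<times> 'm \<times> 'm \<Rightarrow> 'm \<Rightarrow> 'm \<Rightarrow> 'm \<Rightarrow> bool" where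
  "triangle_map P = (\<lambda>(f, g, h) (f', g', h') a b c.
     a \<in> Hom P (Dom P f) (Dom P f') \<and> b \<in> Hom P (Dom P g) (Dom P g') \<and>
     c \<in> Hom P (Dom P h) (Dom P h') \<and>
     b \<cdot>\<^bsub>P\<^esub> f = f' \<cdot>\<^bsub>P\<^esub> a \<and> c \<cdot>\<^bsub>P\<^esub> g = g' \<cdot>\<^bsub>P\<^esub> b \<and> ShM P a \<cdot>\<^bsub>P\<^esub> h = h' \<cdot>\<^bsub>P\<^esub> c)"

locale triangulated_category =
  fixes P :: "('o, 'm) tcat" and \<D> :: "('m \<times> 'm \<times> 'm) set"
  assumes tau: "tau_category P"
    and triangles: "t \<in> \<D> \<Longrightarrow> triangle P t"
    and TR1: "\<lbrakk>t \<in> \<D>; triangle P t'; triangle_map P t t' a b c;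
      iso_arrow P a; iso_arrow P b; iso_arrow P c\<rbrakk> \<Longrightarrow> t' \<in> \<D>"
    and TR2: "X \<in> Ob P \<Longrightarrow> (Ide P X, Zero P X (zob P), Zero P (zob P) (ShO P X)) \<in> \<D>"
    and TR3: "(f, g, h) \<in> \<D> \<Longrightarrow> (g, h, Neg P (ShM P f)) \<in> \<D>"
    and TR4: "f \<in> Arr P \<Longrightarrow> \<exists>g h. (f, g, h) \<in> \<D>"
    and TR5: "\<lbrakk>(f, g, h) \<in> \<D>; (f', g', h') \<in> \<D>; a \<in> Hom P (Dom P f) (Dom P f');
      b \<in> Hom P (Cod P f) (Cod P f'); b \<cdot>\<^bsub>P\<^esub> f = f' \<cdot>\<^bsub>P\<^esub> a\<rbrakk>
      \<Longrightarrow> \<exists>c. triangle_map P (f, g, h) (f', g', h') a b c"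

text \<open>
  A choice of distinguished triangles \<open>(f, u f, v f)\<close>, for all \<open>f\<close>. The translate of \<open>[f]\<close>
  is \<open>[-f[1]]\<close>, whose triangle should be \<open>(-f[1], -u\<^sub>f[1], -v\<^sub>f[1])\<close>. As a strictly
  translation-invariant choice need not exist (for instance if \<open>f[1] = -f\<close> and \<open>u\<^sub>f[1] = u\<^sub>f\<close>), the
  choice includes isomorphisms \<open>k f\<close> which identify this triangle with the chosen one.
\<close>

definition triangle_choice ::
  "('o, 'm) tcat \<Rightarrow> ('m \<times> 'm \<times> 'm) set \<Rightarrow> ('m \<Rightarrow> 'm) \<Rightarrow> ('m \<Rightarrow> 'm) \<Rightarrow> ('m \<Rightarrow> 'm) \<Rightarrow> bool" where
  "triangle_choice P \<D> u v k \<longleftrightarrow> (\<forall>f\<in>Arr P.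
     (f, u f, v f) \<in> \<D> \<and> iso_arrow P (k f) \<and>
     triangle_map P
       (Neg P (ShM P f), Neg P (ShM P (u f)), Neg P (ShM P (v f)))
       (Neg P (ShM P f), u (Neg P (ShM P f)), v (Neg P (ShM P f)))
       (Ide P (ShO P (Dom P f))) (Ide P (ShO P (Cod P f))) (k f))"

text \<open>An arrow \<open>(a,b,c)\<close> from \<open>[f]\<close> to \<open>[f']\<close> is represented as \<open>(f, f', a, b, c)\<close>.\<close>

type_synonym 'm tm = "'m \<times> 'm \<times> 'm \<times> 'm \<times> 'm"

definition tri_cat ::
  "('o, 'm) tcat \<Rightarrow> ('m \<Rightarrow> 'm) \<Rightarrow> ('m \<Rightarrow> 'm) \<Rightarrow> ('m \<Rightarrow> 'm) \<Rightarrow> ('m, 'm tm) tcat" where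
  "tri_cat P u v k = \<lparr>
     Ob = Arr P,
     Arr = {(f, f', a, b, c). f \<in> Arr P \<and> f' \<in> Arr P \<and>
              triangle_map P (f, u f, v f) (f', u f', v f') a b c},
     Dom = (\<lambda>(f, f', a, b, c). f),
     Cod = (\<lambda>(f, f', a, b, c). f'),
     Ide = (\<lambda>f. (f, f, Ide P (Dom P f), Ide P (Cod P f), Ide P (Cod P (u f)))),
     Comp = (\<lambda>(f\<^sub>1, f\<^sub>2, a', b', c') (f, f', a, b, c).
               (f, f\<^sub>2, a' \<cdot>\<^bsub>P\<^esub> a, b' \<cdot>\<^bsub>P\<^esub> b, c' \<cdot>\<^bsub>P\<^esub> c)),
     Add = (\<lambda>(f, f', a, b, c) (f\<^sub>1, f\<^sub>2, a', b', c').
               (f, f', Add P a a', Add P b b', Add P c c')),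
     Zero = (\<lambda>f f'. (f, f', Zero P (Dom P f) (Dom P f'), Zero P (Cod P f) (Cod P f'),
               Zero P (Cod P (u f)) (Cod P (u f')))),
     ShO = (\<lambda>f. Neg P (ShM P f)),
     ShM = (\<lambda>(f, f', a, b, c). (Neg P (ShM P f), Neg P (ShM P f'), ShM P a, ShM P b,
               k f' \<cdot>\<^bsub>P\<^esub> ShM P c \<cdot>\<^bsub>P\<^esub> Inv P (k f)))\<rparr>"

text \<open>
  In \<open>Theta\<close>, an arrow of the arrow category acts by composition with any lift of it to a map
  of triangles; the result does not depend on the lift.
\<close>

definition Theta ::
  "('o, 'm) tcat \<Rightarrow> ('m \<Rightarrow> 'm) \<Rightarrow> ('m \<Rightarrow> 'm) \<Rightarrow> ('m \<Rightarrow> 'm) \<Rightarrow> ('m, 'm sq, 'm) bifun" where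
  "Theta P u v k = \<lparr>
     BG = (\<lambda>f f'. (homgrp P (Cod P (u f)) (Cod P (u f')))
             \<lparr>carrier := {c \<in> Hom P (Cod P (u f)) (Cod P (u f')).
                c \<cdot>\<^bsub>P\<^esub> u f = Zero P (Cod P f) (Cod P (u f')) \<and>
                v f' \<cdot>\<^bsub>P\<^esub> c = Zero P (Cod P (u f)) (ShO P (Dom P f'))}\<rparr>),
     BM = (\<lambda>(f\<^sub>0, f, a, b) (f', f\<^sub>1, a', b') c. THE d. \<exists>c\<^sub>0 c\<^sub>1.
             triangle_map P (f\<^sub>0, u f\<^sub>0, v f\<^sub>0) (f, u f, v f) a b c\<^sub>0 \<and>
             triangle_map P (f', u f', v f') (f\<^sub>1, u f\<^sub>1, v f\<^sub>1) a' b' c\<^sub>1 \<and>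
             d = c\<^sub>1 \<cdot>\<^bsub>P\<^esub> c \<cdot>\<^bsub>P\<^esub> c\<^sub>0),
     BT = (\<lambda>f f' c. k f' \<cdot>\<^bsub>P\<^esub> ShM P c \<cdot>\<^bsub>P\<^esub> Inv P (k f))\<rparr>"

definition Triangles0 ::
  "('o, 'm) tcat \<Rightarrow> ('m \<Rightarrow> 'm) \<Rightarrow> ('m \<Rightarrow> 'm) \<Rightarrow> ('m \<Rightarrow> 'm) \<Rightarrow> ('m, 'm, 'm tm, 'm) pstruct" where
  "Triangles0 P u v k = \<lparr>
     Ups = Theta P u v k,
     Inc = (\<lambda>f f' c. (f, f', Zero P (Dom P f) (Dom P f'), Zero P (Cod P f) (Cod P f'), c)),
     Ptr = tri_cat P u v k,
     Prj = \<lparr>FO = (\<lambda>f. f), FM = (\<lambda>(f, f', a, b, c). (f, f', a, b))\<rparr>,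
     Phi = (\<lambda>f f' K. the_elem ((\<lambda>x. u f' \<cdot>\<^bsub>P\<^esub> x \<cdot>\<^bsub>P\<^esub> v f) ` K))\<rparr>"

end

theory Submission
  imports Defs
begin

text \<open>
  From a triangulation to the adjunctions: the functor \<open>j\<close> of the domination sends an arrow of \<open>Ptr\<close>
  to a map of triangles, and \<open>L\<close> takes its third component. On arrows starting at \<open>\<^sup>X!\<close> or ending at
  \<open>!\<^sub>X\<close> the functor \<open>j\<close> is bijective, because \<open>\<xi>\<close> is an isomorphism there, so both adjunctions and the
  Massey product can be computed with triangles.

  Conversely, the left adjunction makes \<open>Hom(-,Y)\<close> exact on the sequence \<open>A \<rightarrow> B \<rightarrow> L[f] \<rightarrow> A[1]\<close>.
  The sequences isomorphic to some \<open>(f, u\<^sub>f, v\<^sub>f)\<close> are the distinguished triangles, and the only axiom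
  which is not formal is rotation: lifts \<open>x\<close> and \<open>w\<close> which compute \<open>{v\<^sub>f, u\<^sub>f, f} = id\<close> give maps
  \<open>A[1] \<rightarrow> L[u\<^sub>f] \<rightarrow> A[1]\<close> with composite the identity, and by exactness they are inverse to each other.
  For the domination, \<open>\<xi>\<close> is induced by \<open>L\<close>; it is an isomorphism at split arrows because
  \<open>\<Delta> \<rightarrow> \<Theta>\<close> is one in every triangulated category.
\<close>

text \<open>The axioms give maps of triangles without uniqueness. What replaces uniqueness is a
  remark on differences: two third components over the same square differ by a map \<open>n\<close>
  with \<open>n u = 0\<close> and \<open>v' n = 0\<close>, which by exactness factors through
  \<open>v\<close> and also through \<open>u'\<close>. So an endomorphism of this kind squares to
  zero, and in other composites the difference vanishes. In the converse direction only exactness of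
  \<open>Hom(-,Y)\<close> is at hand before the triangulation exists. The Massey condition supplies
  a right inverse of the comparison map of a rotated sequence, and exactness in this one variable
  has to produce a left inverse. Since the translation is merely an autoequivalence, objects are
  translates only up to isomorphism, maps are desuspended by full faithfulness, and
  \<open>0[1]\<close> is a zero object different from the chosen one. Hence lifts are studied at
  arbitrary zero objects. Two signs matter: the arrow category translates \<open>f\<close> to
  \<open>-f[1]\<close>, which negates the natural comparison of the cones, and the Massey product is
  normalized by \<open>-y\<close>.\<close>

section \<open>Additive categories with translation\<close>

context category
begin

lemma HomI [intro?]: "\<lbrakk>f \<in> Arr C; Dom C f = A; Cod C f = B\<rbrakk> \<Longrightarrow> f \<in> Hom C A B"
  by (auto simp: Hom_def)

lemma dom_cod_ob [simp]: "f \<in> Arr C \<Longrightarrow> Dom C f \<in> Ob C" "f \<in> Arr C \<Longrightarrow> Cod C f \<in> Ob C"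
  using dom_ob cod_ob by auto

lemma ide_simps [simp]:
  assumes "A \<in> Ob C"
  shows "Ide C A \<in> Arr C" "Dom C (Ide C A) = A" "Cod C (Ide C A) = A"
  using ide_hom[OF assms] by (auto simp: Hom_def)

lemma comp_simps [simp]:
  assumes "f \<in> Arr C" "g \<in> Arr C" "Dom C g = Cod C f"
  shows "g \<cdot> f \<in> Arr C" "Dom C (g \<cdot> f) = Dom C f" "Cod C (g \<cdot> f) = Cod C g"
  using comp_hom[of f "Dom C f" "Cod C f" g "Cod C g"] assms by (auto simp: Hom_def)

lemma comp_ide [simp]: "\<lbrakk>f \<in> Arr C; Cod C f = B\<rbrakk> \<Longrightarrow> Ide C B \<cdot> f = f"
  "\<lbrakk>f \<in> Arr C; Dom C f = B\<rbrakk> \<Longrightarrow> f \<cdot> Ide C B = f"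
  using comp_ide_left[of f "Dom C f" "Cod C f"] comp_ide_right[of f "Dom C f" "Cod C f"]
  by (auto simp: Hom_def)

lemma assoc: "\<lbrakk>f \<in> Arr C; g \<in> Arr C; h \<in> Arr C; Dom C g = Cod C f; Dom C h = Cod C g\<rbrakk>
  \<Longrightarrow> (h \<cdot> g) \<cdot> f = h \<cdot> (g \<cdot> f)"
  using comp_assoc[of f "Dom C f" "Cod C f" g "Cod C g" h "Cod C h"] by (auto simp: Hom_def)

lemma comp_reduce:
  assumes "g \<cdot> f = k" "f \<in> Arr C" "g \<in> Arr C" "Dom C g = Cod C f" "z \<in> Arr C" "Cod C z = Dom C f"
  shows "g \<cdot> (f \<cdot> z) = k \<cdot> z"
  using assms assoc[of z f g] by simp

lemma inverse_arrowsD: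
  assumes "inverse_arrows C f g"
  shows "f \<in> Arr C" "g \<in> Arr C" "Dom C g = Cod C f" "Cod C g = Dom C f"
    "g \<cdot> f = Ide C (Dom C f)" "f \<cdot> g = Ide C (Cod C f)"
  using assms by (auto simp: inverse_arrows_def Hom_def)

lemma inverse_arrowsI:
  assumes "f \<in> Arr C" "g \<in> Arr C" "Dom C g = Cod C f" "Cod C g = Dom C f"
    "g \<cdot> f = Ide C (Dom C f)" "f \<cdot> g = Ide C (Cod C f)"
  shows "inverse_arrows C f g"
  using assms by (auto simp: inverse_arrows_def Hom_def)

lemma inverse_arrows_sym: assumes "inverse_arrows C f g" shows "inverse_arrows C g f"
  using inverse_arrowsD[OF assms] by (intro inverse_arrowsI) simp_all

lemma left_right_inverse:
  assumes "f \<in> Arr C" "g \<in> Arr C" "h \<in> Arr C" "Dom C g = Cod C f" "Cod C g = Dom C f"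
    "Dom C h = Cod C f" "Cod C h = Dom C f"
    "g \<cdot> f = Ide C (Dom C f)" "f \<cdot> h = Ide C (Cod C f)"
  shows "g = h"
proof -
  have "g = g \<cdot> (f \<cdot> h)" using assms by simp
  also have "\<dots> = h" using assms assoc[of h f g] by simp
  finally show ?thesis .
qed

lemma iso_arrowI_left_right:
  assumes "f \<in> Arr C" "g \<in> Arr C" "h \<in> Arr C" "Dom C g = Cod C f" "Cod C g = Dom C f"
    "Dom C h = Cod C f" "Cod C h = Dom C f"
    "g \<cdot> f = Ide C (Dom C f)" "f \<cdot> h = Ide C (Cod C f)"
  shows "iso_arrow C f"
  unfolding iso_arrow_def
  by (rule exI[of _ g], rule inverse_arrowsI) (use assms left_right_inverse[OF assms] in simp_all)

lemma Inv_eq: assumes "inverse_arrows C f g" shows "Inv C f = g"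
  unfolding Inv_def
proof (rule the_equality)
  show "inverse_arrows C f g" by fact
next
  fix h assume "inverse_arrows C f h"
  then show "h = g"
    by (intro left_right_inverse[of f h g]) (use assms in \<open>auto dest: inverse_arrowsD\<close>)
qed

lemma iso_inverse: "iso_arrow C f \<Longrightarrow> inverse_arrows C f (Inv C f)"
  using Inv_eq unfolding iso_arrow_def by metis

lemma Inv_simps [simp]:
  assumes "iso_arrow C f"
  shows "Inv C f \<in> Arr C" "Dom C (Inv C f) = Cod C f" "Cod C (Inv C f) = Dom C f"
    "Inv C f \<cdot> f = Ide C (Dom C f)" "f \<cdot> Inv C f = Ide C (Cod C f)"
  using inverse_arrowsD[OF iso_inverse[OF assms]] by auto

lemma iso_arr: "iso_arrow C f \<Longrightarrow> f \<in> Arr C"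
  using inverse_arrowsD(1)[OF iso_inverse] .

lemma iso_Inv: "iso_arrow C f \<Longrightarrow> iso_arrow C (Inv C f)"
  using inverse_arrows_sym[OF iso_inverse] unfolding iso_arrow_def by blast

lemma iso_ide [simp]: "A \<in> Ob C \<Longrightarrow> iso_arrow C (Ide C A)"
  unfolding iso_arrow_def by (rule exI[of _ "Ide C A"], rule inverse_arrowsI) auto

lemma Inv_comp_cancel [simp]:
  assumes "iso_arrow C f" "z \<in> Arr C"
  shows "Cod C z = Dom C f \<Longrightarrow> Inv C f \<cdot> (f \<cdot> z) = z"
    "Cod C z = Cod C f \<Longrightarrow> f \<cdot> (Inv C f \<cdot> z) = z"
  using assms comp_reduce[OF Inv_simps(4)[OF assms(1)]] comp_reduce[OF Inv_simps(5)[OF assms(1)]]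
  by (auto simp: iso_arr)

lemma iso_comp:
  assumes "iso_arrow C f" "iso_arrow C g" "Dom C g = Cod C f"
  shows "iso_arrow C (g \<cdot> f)"
  unfolding iso_arrow_def
  by (rule exI[of _ "Inv C f \<cdot> Inv C g"], rule inverse_arrowsI)
    (use assms in \<open>auto simp: iso_arr assoc\<close>)

end

section \<open>Subtraction and bilinearity of composition\<close>

definition Sub :: "('o, 'm) tcat \<Rightarrow> 'm \<Rightarrow> 'm \<Rightarrow> 'm" where
  "Sub C f g = Add C f (Neg C g)"

context additive_category
begin

lemma homgrp_simps [simp]: "carrier (homgrp C A B) = Hom C A B"
  "mult (homgrp C A B) = Add C" "one (homgrp C A B) = Zero C A B"
  by (auto simp: homgrp_def)

lemma zero_simps [simp]:
  assumes "A \<in> Ob C" "B \<in> Ob C"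
  shows "Zero C A B \<in> Arr C" "Dom C (Zero C A B) = A" "Cod C (Zero C A B) = B"
proof -
  interpret comm_group "homgrp C A B" by (rule hom_comm_group[OF assms])
  show "Zero C A B \<in> Arr C" "Dom C (Zero C A B) = A" "Cod C (Zero C A B) = B"
    using one_closed by (auto simp: Hom_def)
qed

lemma add_simps [simp]:
  assumes "f \<in> Arr C" "g \<in> Arr C" "Dom C g = Dom C f" "Cod C g = Cod C f"
  shows "Add C f g \<in> Arr C" "Dom C (Add C f g) = Dom C f" "Cod C (Add C f g) = Cod C f"
proof -
  interpret comm_group "homgrp C (Dom C f) (Cod C f)" using assms by (intro hom_comm_group) auto
  show "Add C f g \<in> Arr C" "Dom C (Add C f g) = Dom C f" "Cod C (Add C f g) = Cod C f"
    using m_closed[of f g] assms by (auto simp: Hom_def)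
qed

lemma neg_simps [simp]:
  assumes "f \<in> Arr C"
  shows "Neg C f \<in> Arr C" "Dom C (Neg C f) = Dom C f" "Cod C (Neg C f) = Cod C f"
proof -
  interpret comm_group "homgrp C (Dom C f) (Cod C f)" using assms by (intro hom_comm_group) auto
  show "Neg C f \<in> Arr C" "Dom C (Neg C f) = Dom C f" "Cod C (Neg C f) = Cod C f"
    using inv_closed[of f] assms by (auto simp: Hom_def Neg_def)
qed

lemma sub_simps [simp]:
  assumes "f \<in> Arr C" "g \<in> Arr C" "Dom C g = Dom C f" "Cod C g = Cod C f"
  shows "Sub C f g \<in> Arr C" "Dom C (Sub C f g) = Dom C f" "Cod C (Sub C f g) = Cod C f"
  using assms by (auto simp: Sub_def)

lemma add_laws:
  assumes f: "f \<in> Arr C"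
  shows add_neg_self: "Add C f (Neg C f) = Zero C (Dom C f) (Cod C f)"
    and neg_add_self: "Add C (Neg C f) f = Zero C (Dom C f) (Cod C f)"
    and add_zero': "Add C f (Zero C (Dom C f) (Cod C f)) = f"
    and zero_add': "Add C (Zero C (Dom C f) (Cod C f)) f = f"
    and neg_neg [simp]: "Neg C (Neg C f) = f"
    and neg_zero': "Neg C (Zero C (Dom C f) (Cod C f)) = Zero C (Dom C f) (Cod C f)"
    and "\<lbrakk>g \<in> Arr C; Dom C g = Dom C f; Cod C g = Cod C f\<rbrakk> \<Longrightarrow> Add C f g = Add C g f"
    and "\<lbrakk>g \<in> Arr C; Dom C g = Dom C f; Cod C g = Cod C f\<rbrakk>
      \<Longrightarrow> Neg C (Add C f g) = Add C (Neg C f) (Neg C g)"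
    and "\<lbrakk>g \<in> Arr C; Dom C g = Dom C f; Cod C g = Cod C f\<rbrakk> \<Longrightarrow> Add C (Add C f (Neg C g)) g = f"
    and "\<lbrakk>g \<in> Arr C; Dom C g = Dom C f; Cod C g = Cod C f;
      h \<in> Arr C; Dom C h = Dom C f; Cod C h = Cod C f\<rbrakk>
      \<Longrightarrow> Add C (Add C f g) h = Add C f (Add C g h)"
    and "\<lbrakk>g \<in> Arr C; Dom C g = Dom C f; Cod C g = Cod C f;
      h \<in> Arr C; Dom C h = Dom C f; Cod C h = Cod C f\<rbrakk> \<Longrightarrow> Add C f g = Add C f h \<longleftrightarrow> g = h"
proof -
  let ?G = "homgrp C (Dom C f) (Cod C f)"
  interpret comm_group ?G using f by (intro hom_comm_group) auto
  have c: "x \<in> carrier ?G" if "x \<in> Arr C" "Dom C x = Dom C f" "Cod C x = Cod C f" for x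
    using that by (simp add: Hom_def)
  have n: "Neg C x = inv\<^bsub>?G\<^esub> x" if "x \<in> carrier ?G" for x
    using that by (auto simp: Neg_def Hom_def)
  have fc: "f \<in> carrier ?G" by (rule c[OF f refl refl])
  show "Add C f (Neg C f) = Zero C (Dom C f) (Cod C f)" "Add C (Neg C f) f = Zero C (Dom C f) (Cod C f)"
    using r_inv[OF fc] l_inv[OF fc] n[OF fc] by simp_all
  show "Add C f (Zero C (Dom C f) (Cod C f)) = f" "Add C (Zero C (Dom C f) (Cod C f)) f = f"
    using r_one[OF fc] l_one[OF fc] by simp_all
  show "Neg C (Neg C f) = f" using inv_inv[OF fc] n[OF fc] n[OF inv_closed[OF fc]] by simp
  show "Neg C (Zero C (Dom C f) (Cod C f)) = Zero C (Dom C f) (Cod C f)"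
    using inv_one n[OF one_closed] by simp
  assume "g \<in> Arr C" "Dom C g = Dom C f" "Cod C g = Cod C f"
  note gc = c[OF this]
  show "Add C f g = Add C g f" using m_comm[OF fc gc] by simp
  show "Neg C (Add C f g) = Add C (Neg C f) (Neg C g)"
    using inv_mult[OF fc gc] n[OF fc] n[OF gc] n[OF m_closed[OF fc gc]] by simp
  show "Add C (Add C f (Neg C g)) g = f"
    using m_assoc[OF fc inv_closed[OF gc] gc] l_inv[OF gc] r_one[OF fc] n[OF gc] by simp
  assume "h \<in> Arr C" "Dom C h = Dom C f" "Cod C h = Cod C f"
  note hc = c[OF this]
  show "Add C (Add C f g) h = Add C f (Add C g h)" using m_assoc[OF fc gc hc] by simp
  show "Add C f g = Add C f h \<longleftrightarrow> g = h"
    using right_cancel[OF fc gc hc] m_comm[OF fc gc] m_comm[OF fc hc] by simp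
qed

lemmas add_comm = add_laws(7) and neg_add = add_laws(8) and add_assoc = add_laws(10)
  and add_cancel = add_laws(11)

lemma add_left_comm: "\<lbrakk>f \<in> Arr C; g \<in> Arr C; Dom C g = Dom C f; Cod C g = Cod C f;
    h \<in> Arr C; Dom C h = Dom C f; Cod C h = Cod C f\<rbrakk>
  \<Longrightarrow> Add C g (Add C f h) = Add C f (Add C g h)"
  using add_assoc[of f g h] add_assoc[of g f h] add_comm[of f g] by simp

lemmas add_ac = add_assoc add_comm add_left_comm

lemma add_zero [simp]: "\<lbrakk>f \<in> Arr C; Dom C f = A; Cod C f = B\<rbrakk> \<Longrightarrow> Add C f (Zero C A B) = f"
  "\<lbrakk>f \<in> Arr C; Dom C f = A; Cod C f = B\<rbrakk> \<Longrightarrow> Add C (Zero C A B) f = f"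
  using add_zero' zero_add' by auto

lemma neg_zero [simp]: "A \<in> Ob C \<Longrightarrow> B \<in> Ob C \<Longrightarrow> Neg C (Zero C A B) = Zero C A B"
  using neg_zero'[of "Zero C A B"] by auto

lemma sub_self [simp]: "f \<in> Arr C \<Longrightarrow> Sub C f f = Zero C (Dom C f) (Cod C f)"
  using add_neg_self[of f] by (auto simp: Sub_def)

lemma sub_zero [simp]: "\<lbrakk>f \<in> Arr C; Dom C f = A; Cod C f = B\<rbrakk> \<Longrightarrow> Sub C f (Zero C A B) = f"
  by (auto simp: Sub_def)

lemma zero_sub [simp]: "\<lbrakk>f \<in> Arr C; Dom C f = A; Cod C f = B\<rbrakk> \<Longrightarrow> Sub C (Zero C A B) f = Neg C f"
  by (auto simp: Sub_def)

lemma sub_add [simp]: "\<lbrakk>f \<in> Arr C; g \<in> Arr C; Dom C g = Dom C f; Cod C g = Cod C f\<rbrakk>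
  \<Longrightarrow> Add C (Sub C f g) g = f"
  using add_laws(9) by (auto simp: Sub_def)

lemma add_sub [simp]: "\<lbrakk>f \<in> Arr C; g \<in> Arr C; Dom C g = Dom C f; Cod C g = Cod C f\<rbrakk>
  \<Longrightarrow> Add C g (Sub C f g) = f"
  using add_comm[of g "Sub C f g"] by simp

lemma eq_if_sub_zero: "\<lbrakk>Sub C f g = Zero C A B; f \<in> Arr C; g \<in> Arr C; Dom C f = A; Cod C f = B;
    Dom C g = A; Cod C g = B\<rbrakk> \<Longrightarrow> f = g"
  using sub_add[of f g] by simp

lemma add_sub_cancel [simp]:
  assumes "f \<in> Arr C" "g \<in> Arr C" "Dom C g = Dom C f" "Cod C g = Cod C f"
  shows "Sub C (Add C f g) g = f"
proof (rule iffD1[OF add_cancel[of g]])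
  show "Add C g (Sub C (Add C f g) g) = Add C g f"
    using assms add_comm[of f g] by simp
qed (use assms in simp_all)

lemma neg_unique: "\<lbrakk>Add C f g = Zero C A B; f \<in> Arr C; g \<in> Arr C; Dom C f = A; Cod C f = B;
    Dom C g = A; Cod C g = B\<rbrakk> \<Longrightarrow> f = Neg C g"
  using add_sub_cancel[of f g] by simp

lemma comp_add: "\<lbrakk>f \<in> Arr C; g \<in> Arr C; g' \<in> Arr C; Dom C g = Cod C f; Dom C g' = Cod C f;
    Cod C g' = Cod C g\<rbrakk> \<Longrightarrow> Add C g g' \<cdot> f = Add C (g \<cdot> f) (g' \<cdot> f)"
  "\<lbrakk>f \<in> Arr C; f' \<in> Arr C; g \<in> Arr C; Dom C f' = Dom C f; Cod C f' = Cod C f; Dom C g = Cod C f\<rbrakk>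
  \<Longrightarrow> g \<cdot> Add C f f' = Add C (g \<cdot> f) (g \<cdot> f')"
  using comp_add_left[of f "Dom C f" "Cod C f" g "Cod C g" g']
    comp_add_right[of f "Dom C f" "Cod C f" f' g "Cod C g"] by (auto simp: Hom_def)

text \<open>Serves to show that composition, translation, projections and third components preserve
  zero: the image of zero is idempotent for addition, and a group has only one such element.\<close>

lemma zero_unique:
  assumes "Add C f f = f" "f \<in> Arr C" shows "f = Zero C (Dom C f) (Cod C f)"
  using add_cancel[of f f "Zero C (Dom C f) (Cod C f)"] assms by auto

lemma comp_zero [simp]:
  "\<lbrakk>g \<in> Arr C; Dom C g = B; A \<in> Ob C\<rbrakk> \<Longrightarrow> g \<cdot> Zero C A B = Zero C A (Cod C g)"
  "\<lbrakk>g \<in> Arr C; Cod C g = A; B \<in> Ob C\<rbrakk> \<Longrightarrow> Zero C A B \<cdot> g = Zero C (Dom C g) B"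
proof -
  show "g \<cdot> Zero C A B = Zero C A (Cod C g)" if "g \<in> Arr C" "Dom C g = B" "A \<in> Ob C"
    using zero_unique[of "g \<cdot> Zero C A B"] comp_add(2)[of "Zero C A B" "Zero C A B" g] that by auto
  show "Zero C A B \<cdot> g = Zero C (Dom C g) B" if "g \<in> Arr C" "Cod C g = A" "B \<in> Ob C"
    using zero_unique[of "Zero C A B \<cdot> g"] comp_add(1)[of g "Zero C A B" "Zero C A B"] that by auto
qed

lemma comp_neg: "\<lbrakk>f \<in> Arr C; g \<in> Arr C; Dom C g = Cod C f\<rbrakk> \<Longrightarrow> Neg C g \<cdot> f = Neg C (g \<cdot> f)"
  "\<lbrakk>f \<in> Arr C; g \<in> Arr C; Dom C g = Cod C f\<rbrakk> \<Longrightarrow> g \<cdot> Neg C f = Neg C (g \<cdot> f)"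
proof -
  assume a: "f \<in> Arr C" "g \<in> Arr C" "Dom C g = Cod C f"
  have "Add C (Neg C g \<cdot> f) (g \<cdot> f) = Add C (Neg C g) g \<cdot> f" using a by (simp add: comp_add)
  then show "Neg C g \<cdot> f = Neg C (g \<cdot> f)"
    using a neg_add_self[of g] by (intro neg_unique[of _ _ "Dom C f" "Cod C g"]) auto
  have "Add C (g \<cdot> Neg C f) (g \<cdot> f) = g \<cdot> Add C (Neg C f) f" using a by (simp add: comp_add)
  then show "g \<cdot> Neg C f = Neg C (g \<cdot> f)"
    using a neg_add_self[of f] by (intro neg_unique[of _ _ "Dom C f" "Cod C g"]) auto
qed

lemma comp_sub: "\<lbrakk>f \<in> Arr C; g \<in> Arr C; g' \<in> Arr C; Dom C g = Cod C f; Dom C g' = Cod C f;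
    Cod C g' = Cod C g\<rbrakk> \<Longrightarrow> Sub C g g' \<cdot> f = Sub C (g \<cdot> f) (g' \<cdot> f)"
  "\<lbrakk>f \<in> Arr C; f' \<in> Arr C; g \<in> Arr C; Dom C f' = Dom C f; Cod C f' = Cod C f; Dom C g = Cod C f\<rbrakk>
  \<Longrightarrow> g \<cdot> Sub C f f' = Sub C (g \<cdot> f) (g \<cdot> f')"
  by (auto simp: Sub_def comp_add comp_neg)

lemma zob: "zero_object C (zob C)"
  unfolding zob_def using ex_zero_object by (rule someI_ex)

lemma zob_ob [simp]: "zob C \<in> Ob C"
  using zob by (simp add: zero_object_def)

lemma zero_object_arr:
  assumes "zero_object C Z" "f \<in> Arr C"
  shows "Dom C f = Z \<Longrightarrow> f = Zero C Z (Cod C f)" "Cod C f = Z \<Longrightarrow> f = Zero C (Dom C f) Z"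
proof -
  have Z: "Z \<in> Ob C" using assms by (simp add: zero_object_def)
  { assume "Dom C f = Z"
    then have "\<exists>!g. g \<in> Hom C Z (Cod C f)" using assms by (simp add: zero_object_def)
    then show "f = Zero C Z (Cod C f)" using assms \<open>Dom C f = Z\<close> Z by (auto simp: Hom_def) }
  { assume "Cod C f = Z"
    then have "\<exists>!g. g \<in> Hom C (Dom C f) Z" using assms by (simp add: zero_object_def)
    then show "f = Zero C (Dom C f) Z" using assms \<open>Cod C f = Z\<close> Z by (auto simp: Hom_def) }
qed

text \<open>Each arrow into or out of \<open>Z\<close> equals its composite with
  \<open>Ide C Z\<close>, hence is zero.\<close>

lemma zero_objectI:
  assumes "Z \<in> Ob C" "Ide C Z = Zero C Z Z"
  shows "zero_object C Z"
  unfolding zero_object_def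
proof (intro conjI ballI ex_ex1I)
  fix A assume A: "A \<in> Ob C"
  show "\<exists>f. f \<in> Hom C A Z" "\<exists>f. f \<in> Hom C Z A"
    using A assms(1) by (simp_all add: Hom_def) (metis zero_simps)+
  show "f = g" if fg: "f \<in> Hom C A Z" "g \<in> Hom C A Z" for f g
  proof -
    have "h = Zero C A Z" if "h \<in> Hom C A Z" for h
      using that A assms comp_ide(1)[of h Z] by (auto simp: Hom_def)
    then show ?thesis using fg by metis
  qed
  show "f = g" if fg: "f \<in> Hom C Z A" "g \<in> Hom C Z A" for f g
  proof -
    have "h = Zero C Z A" if "h \<in> Hom C Z A" for h
      using that A assms comp_ide(2)[of h Z] by (auto simp: Hom_def)
    then show ?thesis using fg by metis
  qed
qed fact

lemma iso_neg: "iso_arrow C f \<Longrightarrow> iso_arrow C (Neg C f)"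
  unfolding iso_arrow_def
  by (rule exI[of _ "Neg C (Inv C f)"], rule inverse_arrowsI)
    (auto simp: iso_arr comp_neg iso_arrow_def[symmetric])

end

section \<open>The translation as an additive functor; zero objects\<close>

locale translation_category = additive_category +
  assumes tau_cat: "tau_category C"
begin

abbreviation "sh \<equiv> ShM C"
abbreviation "so \<equiv> ShO C"

lemma shift_additive: "additive_ftor C C (shift_ftor C)"
  using tau_cat by (simp add: tau_category_def)

lemma so_ob [simp]: "X \<in> Ob C \<Longrightarrow> so X \<in> Ob C"
  using shift_additive by (simp add: additive_ftor_def is_ftor_def shift_ftor_def)

lemma sh_simps [simp]:
  assumes "f \<in> Arr C"
  shows "sh f \<in> Arr C" "Dom C (sh f) = so (Dom C f)" "Cod C (sh f) = so (Cod C f)"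
proof -
  have "sh f \<in> Hom C (so (Dom C f)) (so (Cod C f))"
    using shift_additive dom_cod_ob[OF assms] HomI[OF assms refl refl]
    by (simp add: additive_ftor_def is_ftor_def shift_ftor_def)
  then show "sh f \<in> Arr C" "Dom C (sh f) = so (Dom C f)" "Cod C (sh f) = so (Cod C f)"
    by (auto simp: Hom_def)
qed

lemma sh_ide [simp]: "X \<in> Ob C \<Longrightarrow> sh (Ide C X) = Ide C (so X)"
  using shift_additive by (simp add: additive_ftor_def is_ftor_def shift_ftor_def)

lemma sh_comp [simp]: "\<lbrakk>f \<in> Arr C; g \<in> Arr C; Dom C g = Cod C f\<rbrakk> \<Longrightarrow> sh (g \<cdot> f) = sh g \<cdot> sh f"
  using shift_additive by (simp add: additive_ftor_def is_ftor_def shift_ftor_def)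

lemma sh_add [simp]: "\<lbrakk>f \<in> Arr C; g \<in> Arr C; Dom C g = Dom C f; Cod C g = Cod C f\<rbrakk>
  \<Longrightarrow> sh (Add C f g) = Add C (sh f) (sh g)"
proof -
  assume a: "f \<in> Arr C" "g \<in> Arr C" "Dom C g = Dom C f" "Cod C g = Cod C f"
  then have "sh \<in> hom (homgrp C (Dom C f) (Cod C f)) (homgrp C (so (Dom C f)) (so (Cod C f)))"
    using shift_additive by (simp add: additive_ftor_def shift_ftor_def)
  then show ?thesis using a by (auto simp: hom_def Hom_def)
qed

lemma sh_zero [simp]: "A \<in> Ob C \<Longrightarrow> B \<in> Ob C \<Longrightarrow> sh (Zero C A B) = Zero C (so A) (so B)"
  using zero_unique[of "sh (Zero C A B)"] by (simp flip: sh_add)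

lemma sh_neg [simp]: "f \<in> Arr C \<Longrightarrow> sh (Neg C f) = Neg C (sh f)"
  by (rule neg_unique[of _ _ "so (Dom C f)" "so (Cod C f)"])
    (use neg_add_self[of f] in \<open>auto simp flip: sh_add\<close>)

lemma sh_sub [simp]: "\<lbrakk>f \<in> Arr C; g \<in> Arr C; Dom C g = Dom C f; Cod C g = Cod C f\<rbrakk>
  \<Longrightarrow> sh (Sub C f g) = Sub C (sh f) (sh g)"
  by (simp add: Sub_def)

lemma sh_iso: "iso_arrow C f \<Longrightarrow> iso_arrow C (sh f)"
  unfolding iso_arrow_def
  by (rule exI[of _ "sh (Inv C f)"], rule inverse_arrowsI)
    (auto simp: iso_arr iso_arrow_def[symmetric] simp flip: sh_comp)

text \<open>The translation preserves the equation \<open>id = 0\<close>. So \<open>0[1]\<close> is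
  a zero object, although it need not be the chosen \<open>zob C\<close>.\<close>

lemma zero_object_so: "zero_object C Z \<Longrightarrow> zero_object C (so Z)"
proof (rule zero_objectI)
  assume Z: "zero_object C Z"
  then have o: "Z \<in> Ob C" by (simp add: zero_object_def)
  then have "Ide C Z = Zero C Z Z" using zero_object_arr(1)[OF Z, of "Ide C Z"] by simp
  then have "sh (Ide C Z) = sh (Zero C Z Z)" by simp
  then show "Ide C (so Z) = Zero C (so Z) (so Z)" "so Z \<in> Ob C" using o by auto
qed

lemma arr_to_zob: "\<lbrakk>f \<in> Arr C; Cod C f = zob C; Dom C f = A\<rbrakk> \<Longrightarrow> f = Zero C A (zob C)"
  "\<lbrakk>f \<in> Arr C; Dom C f = zob C; Cod C f = A\<rbrakk> \<Longrightarrow> f = Zero C (zob C) A"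
  "\<lbrakk>f \<in> Arr C; Cod C f = so (zob C); Dom C f = A\<rbrakk> \<Longrightarrow> f = Zero C A (so (zob C))"
  "\<lbrakk>f \<in> Arr C; Dom C f = so (zob C); Cod C f = A\<rbrakk> \<Longrightarrow> f = Zero C (so (zob C)) A"
  using zero_object_arr[OF zob] zero_object_arr[OF zero_object_so[OF zob]] by auto

lemma ide_zob: "Ide C (zob C) = Zero C (zob C) (zob C)"
  "Ide C (so (zob C)) = Zero C (so (zob C)) (so (zob C))"
  by (rule arr_to_zob; simp)+

end

section \<open>Quasi-inverse functors are full and faithful\<close>

context category
begin

lemma ftorD:
  assumes "is_ftor C D F"
  shows "X \<in> Ob C \<Longrightarrow> FO F X \<in> Ob D"
    and "f \<in> Arr C \<Longrightarrow> FM F f \<in> Arr D"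
    and "f \<in> Arr C \<Longrightarrow> Dom D (FM F f) = FO F (Dom C f)"
    and "f \<in> Arr C \<Longrightarrow> Cod D (FM F f) = FO F (Cod C f)"
    and "X \<in> Ob C \<Longrightarrow> FM F (Ide C X) = Ide D (FO F X)"
    and "\<lbrakk>f \<in> Arr C; g \<in> Arr C; Dom C g = Cod C f\<rbrakk> \<Longrightarrow> FM F (g \<cdot> f) = FM F g \<cdot>\<^bsub>D\<^esub> FM F f"
proof -
  have h: "FM F f \<in> Hom D (FO F (Dom C f)) (FO F (Cod C f))" if "f \<in> Arr C"
    using assms dom_cod_ob[OF that] HomI[OF that refl refl] unfolding is_ftor_def by blast
  show "f \<in> Arr C \<Longrightarrow> FM F f \<in> Arr D"
    "f \<in> Arr C \<Longrightarrow> Dom D (FM F f) = FO F (Dom C f)"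
    "f \<in> Arr C \<Longrightarrow> Cod D (FM F f) = FO F (Cod C f)"
    using h by (auto simp: Hom_def)
qed (use assms in \<open>auto simp: is_ftor_def\<close>)

lemma nat_isomorphic_idD:
  assumes "nat_isomorphic C C (comp_ftor G F) id_ftor"
  obtains e where "\<And>X. X \<in> Ob C \<Longrightarrow> iso_arrow C (e X)"
    "\<And>X. X \<in> Ob C \<Longrightarrow> Dom C (e X) = FO G (FO F X)"
    "\<And>X. X \<in> Ob C \<Longrightarrow> Cod C (e X) = X"
    "\<And>f. f \<in> Arr C \<Longrightarrow> e (Cod C f) \<cdot> FM G (FM F f) = f \<cdot> e (Dom C f)"
  using assms by (auto simp: nat_isomorphic_def nat_trans_def comp_ftor_def id_ftor_def Hom_def)

text \<open>By naturality \<open>f e = e GF(f)\<close> depends only on \<open>F f\<close>, and the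
  component \<open>e\<close> can be cancelled.\<close>

lemma quasi_inverse_faithful:
  assumes "nat_isomorphic C C (comp_ftor G F) id_ftor"
    and fg: "f \<in> Arr C" "g \<in> Arr C" "Dom C f = Dom C g" "Cod C f = Cod C g" "FM F f = FM F g"
  shows "f = g"
proof -
  obtain e where e: "\<And>X. X \<in> Ob C \<Longrightarrow> iso_arrow C (e X)"
    "\<And>X. X \<in> Ob C \<Longrightarrow> Cod C (e X) = X"
    "\<And>f. f \<in> Arr C \<Longrightarrow> e (Cod C f) \<cdot> FM G (FM F f) = f \<cdot> e (Dom C f)"
    using assms(1) by (rule nat_isomorphic_idD) blast
  let ?A = "Dom C g"
  have "f \<cdot> e ?A = g \<cdot> e ?A" using e(3)[of f] e(3)[of g] fg by simp
  then have "(f \<cdot> e ?A) \<cdot> Inv C (e ?A) = (g \<cdot> e ?A) \<cdot> Inv C (e ?A)" by simp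
  then show ?thesis using fg e(1,2)[of ?A] by (simp add: assoc iso_arr)
qed

text \<open>The preimage is \<open>G g\<close> conjugated by the isomorphism \<open>GF = id\<close>.
  No triangle identity links the two isomorphisms, so \<open>F f = g\<close> is not checked directly
  but after applying \<open>G\<close>, which is faithful by \<open>FG = id\<close>.\<close>

lemma quasi_inverse_full:
  assumes F: "is_ftor C C F" and G: "is_ftor C C G"
    and GF: "nat_isomorphic C C (comp_ftor G F) id_ftor"
    and FG: "nat_isomorphic C C (comp_ftor F G) id_ftor"
    and g: "A \<in> Ob C" "B \<in> Ob C" "g \<in> Arr C" "Dom C g = FO F A" "Cod C g = FO F B"
  obtains f where "f \<in> Arr C" "Dom C f = A" "Cod C f = B" "FM F f = g"
proof -
  obtain e where e: "\<And>X. X \<in> Ob C \<Longrightarrow> iso_arrow C (e X)"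
    "\<And>X. X \<in> Ob C \<Longrightarrow> Dom C (e X) = FO G (FO F X)"
    "\<And>X. X \<in> Ob C \<Longrightarrow> Cod C (e X) = X"
    "\<And>f. f \<in> Arr C \<Longrightarrow> e (Cod C f) \<cdot> FM G (FM F f) = f \<cdot> e (Dom C f)"
    using GF by (rule nat_isomorphic_idD) blast
  note [simp] = ftorD[OF F] ftorD[OF G] e(1-3) iso_arr[OF e(1)] g
  define f where "f = e B \<cdot> (FM G g \<cdot> Inv C (e A))"
  have f [simp]: "f \<in> Arr C" "Dom C f = A" "Cod C f = B" by (auto simp: f_def)
  have "FM F f = g"
  proof (rule quasi_inverse_faithful[OF FG])
    have "FM G (FM F f) = Inv C (e B) \<cdot> (e B \<cdot> FM G (FM F f))" by simp
    also have "\<dots> = Inv C (e B) \<cdot> (f \<cdot> e A)" using e(4)[of f] by simp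
    also have "\<dots> = FM G g" by (simp add: f_def assoc)
    finally show "FM G (FM F f) = FM G g" .
  qed auto
  then show thesis using that f by blast
qed

end

context translation_category
begin

lemma quasi_inverse: obtains M where "inverse_translation C M"
  using tau_cat by (auto simp: tau_category_def)

lemma sh_faithful:
  assumes "sh f = sh g" "f \<in> Arr C" "g \<in> Arr C" "Dom C f = Dom C g" "Cod C f = Cod C g"
  shows "f = g"
proof -
  obtain M where M: "inverse_translation C M" by (rule quasi_inverse)
  show ?thesis
    by (rule quasi_inverse_faithful[of M "shift_ftor C"])
      (use M assms in \<open>auto simp: inverse_translation_def shift_ftor_def\<close>)
qed

lemma sh_full:
  assumes "g \<in> Arr C" "Dom C g = so A" "Cod C g = so B" "A \<in> Ob C" "B \<in> Ob C"
  obtains f where "f \<in> Arr C" "Dom C f = A" "Cod C f = B" "sh f = g"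
proof -
  obtain M where M: "inverse_translation C M" by (rule quasi_inverse)
  show thesis
    by (rule quasi_inverse_full[of "shift_ftor C" M A B g])
      (use M assms that shift_additive
        in \<open>auto simp: inverse_translation_def shift_ftor_def additive_ftor_def\<close>)
qed

lemma so_essentially_surjective:
  assumes "X \<in> Ob C"
  obtains Y i where "Y \<in> Ob C" "iso_arrow C i" "Dom C i = so Y" "Cod C i = X"
proof -
  obtain M where M: "inverse_translation C M" by (rule quasi_inverse)
  then have F: "is_ftor C C M" by (simp add: inverse_translation_def)
  obtain e where e: "\<And>X. X \<in> Ob C \<Longrightarrow> iso_arrow C (e X)"
    "\<And>X. X \<in> Ob C \<Longrightarrow> Dom C (e X) = FO (shift_ftor C) (FO M X)"
    "\<And>X. X \<in> Ob C \<Longrightarrow> Cod C (e X) = X"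
    using M unfolding inverse_translation_def by (metis nat_isomorphic_idD)
  show thesis
    by (rule that[of "FO M X" "e X"]) (use e assms ftorD(1)[OF F] in \<open>auto simp: shift_ftor_def\<close>)
qed

section \<open>Composition and inversion of maps of triangles\<close>

lemma triangleD:
  assumes "triangle C (f, g, h)"
  shows "f \<in> Arr C" "g \<in> Arr C" "h \<in> Arr C" "Dom C g = Cod C f" "Dom C h = Cod C g"
    "Cod C h = so (Dom C f)"
  using assms by (auto simp: triangle_def)

lemma triangle_mapD:
  assumes "triangle_map C (f, g, h) (f', g', h') a b c"
  shows "a \<in> Arr C" "Dom C a = Dom C f" "Cod C a = Dom C f'"
    "b \<in> Arr C" "Dom C b = Dom C g" "Cod C b = Dom C g'"
    "c \<in> Arr C" "Dom C c = Dom C h" "Cod C c = Dom C h'"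
    "b \<cdot> f = f' \<cdot> a" "c \<cdot> g = g' \<cdot> b" "sh a \<cdot> h = h' \<cdot> c"
  using assms by (auto simp: triangle_map_def Hom_def)

lemma triangle_mapI:
  assumes "a \<in> Arr C" "Dom C a = Dom C f" "Cod C a = Dom C f'"
    "b \<in> Arr C" "Dom C b = Dom C g" "Cod C b = Dom C g'"
    "c \<in> Arr C" "Dom C c = Dom C h" "Cod C c = Dom C h'"
    "b \<cdot> f = f' \<cdot> a" "c \<cdot> g = g' \<cdot> b" "sh a \<cdot> h = h' \<cdot> c"
  shows "triangle_map C (f, g, h) (f', g', h') a b c"
  using assms by (auto simp: triangle_map_def Hom_def)

lemma triangle_map_comp:
  assumes "triangle_map C t t' a b c" "triangle_map C t' t'' a' b' c'"
    "triangle C t" "triangle C t'" "triangle C t''"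
  shows "triangle_map C t t'' (a' \<cdot> a) (b' \<cdot> b) (c' \<cdot> c)"
proof -
  obtain f g h f' g' h' f'' g'' h'' where t: "t = (f, g, h)" "t' = (f', g', h')" "t'' = (f'', g'', h'')"
    by (metis prod.exhaust)
  note m = triangle_mapD[OF assms(1)[unfolded t]]
  note m' = triangle_mapD[OF assms(2)[unfolded t]]
  note [simp] = triangleD[OF assms(3)[unfolded t(1)]] triangleD[OF assms(4)[unfolded t(2)]]
    triangleD[OF assms(5)[unfolded t(3)]] m(1-9) m'(1-9)
  have *: "(b' \<cdot> b) \<cdot> f = f'' \<cdot> (a' \<cdot> a)"
    using m(10) m'(10) assoc[of a f' b'] by (simp add: assoc)
  have **: "(c' \<cdot> c) \<cdot> g = g'' \<cdot> (b' \<cdot> b)"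
    using m(11) m'(11) assoc[of b g' c'] by (simp add: assoc)
  have ***: "sh (a' \<cdot> a) \<cdot> h = h'' \<cdot> (c' \<cdot> c)"
    using m(12) m'(12) assoc[of c h' "sh a'"] by (simp add: assoc)
  show ?thesis unfolding t by (rule triangle_mapI) (use * ** *** in simp_all)
qed

lemma triangle_map_Inv:
  assumes "triangle_map C t t' a b c" "triangle C t" "triangle C t'"
    and [simp]: "iso_arrow C a" "iso_arrow C b" "iso_arrow C c"
  shows "triangle_map C t' t (Inv C a) (Inv C b) (Inv C c)"
proof -
  obtain f g h f' g' h' where t: "t = (f, g, h)" "t' = (f', g', h')"
    by (metis prod.exhaust)
  note m = triangle_mapD[OF assms(1)[unfolded t]]
  note [simp] = triangleD[OF assms(2)[unfolded t(1)]] triangleD[OF assms(3)[unfolded t(2)]]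
    m(1-9)
  have square: "q \<cdot> u = v \<cdot> p \<Longrightarrow> Inv C q \<cdot> v = u \<cdot> Inv C p"
    if [simp]: "iso_arrow C p" "iso_arrow C q" "u \<in> Arr C" "v \<in> Arr C"
      "Dom C u = Dom C p" "Cod C u = Dom C q" "Dom C v = Cod C p" "Cod C v = Cod C q"
    for p q u v
  proof -
    note [simp] = iso_arr[OF that(1)] iso_arr[OF that(2)]
    assume *: "q \<cdot> u = v \<cdot> p"
    have "u \<cdot> Inv C p = Inv C q \<cdot> ((q \<cdot> u) \<cdot> Inv C p)" by (simp add: assoc)
    also have "\<dots> = Inv C q \<cdot> v" by (simp add: * assoc)
    finally show ?thesis by simp
  qed
  have i: "Inv C (sh a) = sh (Inv C a)"
    by (rule Inv_eq, rule inverse_arrowsI) (auto simp flip: sh_comp)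
  show ?thesis unfolding t
    by (rule triangle_mapI)
      (use square[OF assms(4,5), of f f'] square[OF assms(5,6), of g g']
         square[OF assms(6) sh_iso[OF assms(4)], of h h'] m(10-12) in \<open>simp_all add: i\<close>)
qed

end

section \<open>Triangulated categories\<close>

sublocale triangulated_category \<subseteq> translation_category P
proof -
  interpret additive_category P using tau by (simp add: tau_category_def)
  show "translation_category P" by unfold_locales (rule tau)
qed

context triangulated_category
begin

abbreviation comp_T (infixr \<open>\<bullet>\<close> 75) where "g \<bullet> f \<equiv> g \<cdot>\<^bsub>P\<^esub> f"

section \<open>Elementary distinguished triangles and vanishing composites\<close>

lemma distinguishedD:
  assumes "(f, g, h) \<in> \<D>"
  shows "f \<in> Arr P" "g \<in> Arr P" "h \<in> Arr P" "Dom P g = Cod P f" "Dom P h = Cod P g"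
    "Cod P h = so (Dom P f)"
  by (rule triangleD[OF triangles[OF assms]])+

text \<open>Rotating the triangle of \<open>Ide P X\<close> gives third map \<open>-id\<close>; the
  isomorphism \<open>-id\<close> on the third vertex removes the sign.\<close>

lemma rotate_zero_ide:
  assumes "X \<in> Ob P"
  shows "(Zero P X (zob P), Zero P (zob P) (so X), Ide P (so X)) \<in> \<D>"
proof -
  have r: "(Zero P X (zob P), Zero P (zob P) (so X), Neg P (Ide P (so X))) \<in> \<D>"
    using TR3[OF TR2[OF assms]] assms by simp
  show ?thesis
    by (rule TR1[OF r, of _ "Ide P X" "Ide P (zob P)" "Neg P (Ide P (so X))"])
      (use assms in \<open>auto simp: triangle_def comp_neg intro!: triangle_mapI iso_neg\<close>)
qed

text \<open>One more rotation gives the claim when \<open>Y\<close> is a translate. A general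
  \<open>Y\<close> is only isomorphic to some \<open>X[1]\<close>, and TR1 transports the
  triangle.\<close>

lemma zero_ide:
  assumes Y: "Y \<in> Ob P"
  shows "(Zero P (zob P) Y, Ide P Y, Zero P Y (so (zob P))) \<in> \<D>"
proof -
  obtain X i where [simp]: "X \<in> Ob P" "iso_arrow P i" "Dom P i = so X" "Cod P i = Y"
    using so_essentially_surjective[OF Y] .
  note [simp] = Y iso_arr[OF \<open>iso_arrow P i\<close>]
  have r: "(Zero P (zob P) (so X), Ide P (so X), Zero P (so X) (so (zob P))) \<in> \<D>"
    using TR3[OF rotate_zero_ide, of X] by simp
  show ?thesis
    by (rule TR1[OF r, of _ "Ide P (zob P)" i i])
      (auto simp: triangle_def intro!: triangle_mapI)
qed

lemma composite_zero:
  assumes t: "(f, g, h) \<in> \<D>"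
  shows "g \<bullet> f = Zero P (Dom P f) (Cod P g)"
proof -
  note [simp] = distinguishedD[OF t]
  \<comment> \<open>The map of triangles with components \<open>id\<close> and \<open>f\<close>
    starts at the triangle of \<open>id\<close>, whose third vertex is zero; its middle square says
    \<open>g f = c 0\<close>.\<close>
  obtain c where "triangle_map P (Ide P (Dom P f), Zero P (Dom P f) (zob P),
      Zero P (zob P) (so (Dom P f))) (f, g, h) (Ide P (Dom P f)) f c"
    using TR5[OF TR2[of "Dom P f"] t, of "Ide P (Dom P f)" f] by (auto simp: Hom_def)
  from triangle_mapD[OF this] show ?thesis by simp
qed

lemma composite_zero':
  assumes t: "(f, g, h) \<in> \<D>"
  shows "h \<bullet> g = Zero P (Dom P g) (Cod P h)"
    "sh f \<bullet> h = Zero P (Dom P h) (so (Cod P f))"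
proof -
  note [simp] = distinguishedD[OF t]
  show "h \<bullet> g = Zero P (Dom P g) (Cod P h)" using composite_zero[OF TR3[OF t]] by simp
  have "Neg P (Neg P (sh f) \<bullet> h) = Zero P (Dom P h) (so (Cod P f))"
    using composite_zero[OF TR3[OF TR3[OF t]]] by simp
  then show "sh f \<bullet> h = Zero P (Dom P h) (so (Cod P f))" by (simp add: comp_neg)
qed

section \<open>Exactness of \<open>Hom(-,Y)\<close> and \<open>Hom(X,-)\<close> on distinguished
  triangles\<close>

lemma extend_second:
  assumes t: "(f, g, h) \<in> \<D>" and e [simp]: "e \<in> Arr P" "Dom P e = Cod P f"
    and z: "e \<bullet> f = Zero P (Dom P f) (Cod P e)"
  obtains y where "y \<in> Arr P" "Dom P y = Cod P g" "Cod P y = Cod P e" "e = y \<bullet> g"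
proof -
  note [simp] = distinguishedD[OF t]
  \<comment> \<open>The triangle on \<open>0 -> Y\<close> has the identity as second map, so the
    third component of a map into it is an extension of \<open>e\<close> along
    \<open>g\<close>.\<close>
  obtain c where "triangle_map P (f, g, h) (Zero P (zob P) (Cod P e), Ide P (Cod P e),
      Zero P (Cod P e) (so (zob P))) (Zero P (Dom P f) (zob P)) e c"
    using TR5[OF t zero_ide[of "Cod P e"], of "Zero P (Dom P f) (zob P)" e] z by (auto simp: Hom_def)
  from triangle_mapD[OF this] show ?thesis by (intro that[of c]) simp_all
qed

lemma extend_third:
  assumes t: "(f, g, h) \<in> \<D>" and e [simp]: "e \<in> Arr P" "Dom P e = Cod P g"
    and z: "e \<bullet> g = Zero P (Dom P g) (Cod P e)"
  obtains y where "y \<in> Arr P" "Dom P y = so (Dom P f)" "Cod P y = Cod P e" "e = y \<bullet> h"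
proof -
  note [simp] = distinguishedD[OF t]
  show thesis
  proof (rule extend_second[OF TR3[OF t] e(1)])
    fix y assume "y \<in> Arr P" "Dom P y = Cod P h" "Cod P y = Cod P e" "e = y \<bullet> h"
    then show thesis by (intro that[of y]) simp_all
  qed (use z in \<open>simp_all\<close>)
qed

lemma extend_fourth:
  assumes t: "(f, g, h) \<in> \<D>" and e [simp]: "e \<in> Arr P" "Dom P e = so (Dom P f)"
    and z: "e \<bullet> h = Zero P (Dom P h) (Cod P e)"
  obtains y where "y \<in> Arr P" "Dom P y = so (Cod P f)" "Cod P y = Cod P e" "e = y \<bullet> sh f"
proof -
  note [simp] = distinguishedD[OF t]
  obtain y where "y \<in> Arr P" "Dom P y = so (Cod P f)" "Cod P y = Cod P e"
      "e = y \<bullet> Neg P (sh f)"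
    using extend_third[OF TR3[OF t], of e] z by auto
  then show thesis by (intro that[of "Neg P y"]) (auto simp: comp_neg)
qed

text \<open>TR5 fills in third components only, so the lift is found one translation later: a map
  from \<open>X -> 0 -> X[1] = X[1]\<close> to the rotated triangle has a third component
  \<open>c\<close> with \<open>e[1] = -f[1] c\<close>, and \<open>-c\<close> is desuspended.\<close>

lemma lift_first:
  assumes t: "(f, g, h) \<in> \<D>" and e [simp]: "e \<in> Arr P" "Cod P e = Dom P g"
    and z: "g \<bullet> e = Zero P (Dom P e) (Cod P g)"
  obtains y where "y \<in> Arr P" "Dom P y = Dom P e" "Cod P y = Dom P f" "e = f \<bullet> y"
proof -
  note [simp] = distinguishedD[OF t]
  obtain c where "triangle_map P (Zero P (Dom P e) (zob P), Zero P (zob P) (so (Dom P e)),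
       Ide P (so (Dom P e))) (g, h, Neg P (sh f)) e (Zero P (zob P) (Dom P h)) c"
    using TR5[OF rotate_zero_ide[of "Dom P e"] TR3[OF t], of e "Zero P (zob P) (Dom P h)"] z
    by (auto simp: Hom_def)
  note c = triangle_mapD[OF this]
  obtain y where y [simp]: "y \<in> Arr P" "Dom P y = Dom P e" "Cod P y = Dom P f" "sh y = Neg P c"
    using sh_full[of "Neg P c" "Dom P e" "Dom P f"] c by auto
  have "sh e = sh (f \<bullet> y)" using c by (simp add: comp_neg)
  then have "e = f \<bullet> y" by (rule sh_faithful) auto
  then show thesis using that y by blast
qed

lemma lift_second:
  assumes t: "(f, g, h) \<in> \<D>" and e [simp]: "e \<in> Arr P" "Cod P e = Dom P h"
    and z: "h \<bullet> e = Zero P (Dom P e) (Cod P h)"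
  obtains y where "y \<in> Arr P" "Dom P y = Dom P e" "Cod P y = Dom P g" "e = g \<bullet> y"
proof -
  note [simp] = distinguishedD[OF t]
  show thesis
  proof (rule lift_first[OF TR3[OF t] e(1)])
    fix y assume "y \<in> Arr P" "Dom P y = Dom P e" "Cod P y = Dom P g" "e = g \<bullet> y"
    then show thesis by (intro that[of y]) simp_all
  qed (use z in \<open>simp_all\<close>)
qed

lemma lift_third:
  assumes t: "(f, g, h) \<in> \<D>" and e [simp]: "e \<in> Arr P" "Cod P e = Cod P h"
    and z: "sh f \<bullet> e = Zero P (Dom P e) (so (Cod P f))"
  obtains y where "y \<in> Arr P" "Dom P y = Dom P e" "Cod P y = Dom P h" "e = h \<bullet> y"
proof -
  note [simp] = distinguishedD[OF t]
  show thesis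
  proof (rule lift_second[OF TR3[OF t] e(1)])
    fix y assume "y \<in> Arr P" "Dom P y = Dom P e" "Cod P y = Dom P h" "e = h \<bullet> y"
    then show thesis by (intro that[of y]) simp_all
  qed (use z in \<open>simp_all add: comp_neg\<close>)
qed

text \<open>With a map \<open>d\<close> in the opposite direction, \<open>d c\<close> and
  \<open>c d\<close> fix the second and third maps but need not be identities. An endomorphism
  \<open>x\<close> of this kind is \<open>1 + n\<close> with \<open>n k = 0\<close> and
  \<open>l n = 0\<close>; then \<open>n = s l\<close>, hence \<open>n n = s l n = 0\<close>, and
  \<open>1 - n\<close> inverts \<open>x\<close>. So \<open>c\<close> has inverses on both
  sides.\<close>

lemma third_component_iso:
  assumes t: "(f, g, h) \<in> \<D>" "(f, g', h') \<in> \<D>"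
    and m: "triangle_map P (f, g, h) (f, g', h') (Ide P (Dom P f)) (Ide P (Cod P f)) c"
  shows "iso_arrow P c"
proof -
  note [simp] = distinguishedD[OF t(1)] distinguishedD[OF t(2)]
  have unipotent: "\<exists>r. r \<in> Arr P \<and> Dom P r = Cod P k \<and> Cod P r = Cod P k \<and>
      x \<bullet> r = Ide P (Cod P k) \<and> r \<bullet> x = Ide P (Cod P k)"
    if t: "(f, k, l) \<in> \<D>" and x [simp]: "x \<in> Arr P" "Dom P x = Cod P k" "Cod P x = Cod P k"
      "x \<bullet> k = k" "l \<bullet> x = l" for k l x
  proof -
    note [simp] = distinguishedD[OF t]
    define n where "n = Sub P x (Ide P (Cod P k))"
    have n [simp]: "n \<in> Arr P" "Dom P n = Cod P k" "Cod P n = Cod P k" by (auto simp: n_def)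
    have "n \<bullet> k = Zero P (Dom P k) (Cod P k)" by (simp add: n_def comp_sub)
    then obtain s where s: "s \<in> Arr P" "Dom P s = so (Dom P f)" "Cod P s = Cod P k" "n = s \<bullet> l"
      using extend_third[OF t n(1,2)] n(3) distinguishedD(4)[OF t] by metis
    have "l \<bullet> n = Zero P (Cod P k) (Cod P l)" by (simp add: n_def comp_sub)
    then have nn: "n \<bullet> n = Zero P (Cod P k) (Cod P k)" using s assoc[of n l s] by simp
    have x': "x = Add P (Ide P (Cod P k)) n" by (simp add: n_def)
    show ?thesis
      by (rule exI[of _ "Sub P (Ide P (Cod P k)) n"])
        (simp add: x' comp_add comp_sub nn)
  qed
  obtain d where d: "triangle_map P (f, g', h') (f, g, h) (Ide P (Dom P f)) (Ide P (Cod P f)) d"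
    using TR5[OF t(2,1), of "Ide P (Dom P f)" "Ide P (Cod P f)"] by (auto simp: Hom_def)
  note c = triangle_mapD[OF m] and d = triangle_mapD[OF d]
  note [simp] = c(7-9) d(7-9)
  have 1: "(d \<bullet> c) \<bullet> g = g" "h \<bullet> (d \<bullet> c) = h" "(c \<bullet> d) \<bullet> g' = g'" "h' \<bullet> (c \<bullet> d) = h'"
  proof -
    have *: "h' \<bullet> c = h" "h \<bullet> d = h'" using c(12) d(12) by simp_all
    show "(d \<bullet> c) \<bullet> g = g" "(c \<bullet> d) \<bullet> g' = g'"
      using c(11) d(11) by (simp_all add: assoc)
    show "h \<bullet> (d \<bullet> c) = h" "h' \<bullet> (c \<bullet> d) = h'"
      by (simp_all add: * comp_reduce[OF *(1)] comp_reduce[OF *(2)])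
  qed
  have "\<exists>r. r \<in> Arr P \<and> Dom P r = Cod P g \<and> Cod P r = Cod P g \<and>
      (d \<bullet> c) \<bullet> r = Ide P (Cod P g) \<and> r \<bullet> (d \<bullet> c) = Ide P (Cod P g)"
    by (rule unipotent[OF t(1) _ _ _ 1(1,2)]) simp_all
  then obtain r where r: "r \<in> Arr P" "Dom P r = Cod P g" "Cod P r = Cod P g"
    "r \<bullet> (d \<bullet> c) = Ide P (Cod P g)" by blast
  have "\<exists>r. r \<in> Arr P \<and> Dom P r = Cod P g' \<and> Cod P r = Cod P g' \<and>
      (c \<bullet> d) \<bullet> r = Ide P (Cod P g') \<and> r \<bullet> (c \<bullet> d) = Ide P (Cod P g')"
    by (rule unipotent[OF t(2) _ _ _ 1(3,4)]) simp_all
  then obtain r' where r': "r' \<in> Arr P" "Dom P r' = Cod P g'" "Cod P r' = Cod P g'"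
    "(c \<bullet> d) \<bullet> r' = Ide P (Cod P g')" by blast
  show ?thesis
    by (rule iso_arrowI_left_right[of c "r \<bullet> d" "d \<bullet> r'"]) (use r r' in \<open>simp_all add: assoc\<close>)
qed

section \<open>The map from \<open>\<Delta>\<close> to \<open>\<Theta>\<close> is bijective at
  splittable arrows\<close>

lemma splittableE:
  assumes "splittable P f"
  obtains s where "f \<in> Arr P" "s \<in> Arr P" "Dom P s = Cod P f" "Cod P s = Dom P f"
    "f \<bullet> s \<bullet> f = f"
  using assms by (auto simp: splittable_def Hom_def)

text \<open>From \<open>c u = 0\<close> one gets \<open>c = y v\<close>, where \<open>y\<close> may
  be changed by multiples of \<open>f[1]\<close> because \<open>f[1] v = 0\<close>. The aim is to
  change \<open>y\<close> so that \<open>v' y = 0\<close>, for then \<open>y\<close> factors through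
  \<open>u'\<close>. As \<open>v' y v = 0\<close>, the obstacle has the form
  \<open>v' y = h f[1]\<close>.\<close>

lemma theta_surj:
  assumes t: "(f, u, v) \<in> \<D>" and t': "(f', u', v') \<in> \<D>"
    and split: "splittable P f \<or> splittable P f'"
    and c [simp]: "c \<in> Arr P" "Dom P c = Cod P u" "Cod P c = Cod P u'"
    and cu: "c \<bullet> u = Zero P (Cod P f) (Cod P u')"
    and vc: "v' \<bullet> c = Zero P (Cod P u) (so (Dom P f'))"
  shows "\<exists>x. x \<in> Arr P \<and> Dom P x = so (Dom P f) \<and> Cod P x = Cod P f' \<and> c = u' \<bullet> x \<bullet> v"
proof -
  note [simp] = distinguishedD[OF t] distinguishedD[OF t'] composite_zero'[OF t] composite_zero'[OF t']
  obtain y where y [simp]: "y \<in> Arr P" "Dom P y = so (Dom P f)" "Cod P y = Cod P u'" and cy: "c = y \<bullet> v"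
    using extend_third[OF t c(1,2)] cu c(3) distinguishedD(4)[OF t] by metis
  have "(v' \<bullet> y) \<bullet> v = Zero P (Dom P v) (Cod P (v' \<bullet> y))"
    using vc by (simp add: assoc cy)
  then obtain h where h [simp]: "h \<in> Arr P" "Dom P h = so (Cod P f)" "Cod P h = so (Dom P f')"
    and hf: "v' \<bullet> y = h \<bullet> sh f"
    using extend_fourth[OF t, of "v' \<bullet> y"] by (metis comp_simps y distinguishedD[OF t'])
  have 0: "sh f' \<bullet> h \<bullet> sh f = Zero P (so (Dom P f)) (so (Cod P f'))"
    using assoc[of y v' "sh f'"] by (simp add: hf)
  \<comment> \<open>The correction of \<open>y\<close> must lift \<open>h\<close> through
    \<open>v'\<close>, which requires \<open>f'[1] h = 0\<close>; only
    \<open>f'[1] h f[1] = 0\<close> is known. A splitting of \<open>f\<close> or of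
    \<open>f'\<close> allows \<open>h\<close> to be replaced by \<open>k\<close>, equal to it after
    composition with \<open>f[1]\<close>, for which the condition holds.\<close>
  obtain k where k [simp]: "k \<in> Arr P" "Dom P k = so (Cod P f)" "Cod P k = so (Dom P f')"
    and kf: "k \<bullet> sh f = h \<bullet> sh f"
    and fk: "sh f' \<bullet> k = Zero P (so (Cod P f)) (so (Cod P f'))"
  proof (cases "splittable P f")
    case True
    then obtain s where s [simp]: "s \<in> Arr P" "Dom P s = Cod P f" "Cod P s = Dom P f"
      and fsf: "f \<bullet> s \<bullet> f = f" by (rule splittableE)
    have fsf': "sh f \<bullet> sh s \<bullet> sh f = sh f" using arg_cong[OF fsf, of sh] by simp
    have "sh f' \<bullet> (h \<bullet> sh f) \<bullet> sh s = Zero P (so (Cod P f)) (so (Cod P f'))"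
      using assoc[of "sh s" "h \<bullet> sh f" "sh f'"] 0 by simp
    then show thesis by (intro that[of "(h \<bullet> sh f) \<bullet> sh s"]) (simp_all add: assoc fsf')
  next
    case False
    then obtain s where s [simp]: "s \<in> Arr P" "Dom P s = Cod P f'" "Cod P s = Dom P f'"
      and fsf: "f' \<bullet> s \<bullet> f' = f'" using split by (metis splittableE)
    have fsf': "sh f' \<bullet> sh s \<bullet> sh f' = sh f'" using arg_cong[OF fsf, of sh] by simp
    have "sh f' \<bullet> sh s \<bullet> sh f' \<bullet> h = sh f' \<bullet> h"
      using comp_reduce[OF fsf', of h] by (simp add: assoc)
    then show thesis
      by (intro that[of "Sub P h (sh s \<bullet> sh f' \<bullet> h)"]) (simp_all add: assoc comp_sub 0)
  qed
  obtain r where r [simp]: "r \<in> Arr P" "Dom P r = so (Cod P f)" "Cod P r = Cod P u'" and kr: "k = v' \<bullet> r"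
    using lift_third[OF t', of k] fk by (metis k distinguishedD(5,6)[OF t'])
  define y' where "y' = Sub P y (r \<bullet> sh f)"
  have y' [simp]: "y' \<in> Arr P" "Dom P y' = so (Dom P f)" "Cod P y' = Cod P u'" by (simp_all add: y'_def)
  have "v' \<bullet> y' = Sub P (h \<bullet> sh f) (k \<bullet> sh f)"
    by (simp add: comp_sub hf kr assoc y'_def)
  then have "v' \<bullet> y' = Zero P (Dom P y') (Cod P v')" by (simp add: kf)
  then obtain x where x: "x \<in> Arr P" "Dom P x = so (Dom P f)" "Cod P x = Cod P f'" "y' = u' \<bullet> x"
    using lift_second[OF t' y'(1)] by (metis y' distinguishedD[OF t'])
  have "c = y' \<bullet> v" by (simp add: comp_sub cy assoc y'_def)
  then have "c = u' \<bullet> x \<bullet> v" using x(1-3) by (simp add: x(4) assoc)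
  then show ?thesis using x by blast
qed

text \<open>Here \<open>u' x = h f[1]\<close> by exactness, and \<open>x\<close> lies in the
  indeterminacy once \<open>h\<close> can be chosen of the form \<open>u' q\<close>: then
  \<open>u' (x - q f[1]) = 0\<close>, so that \<open>x - q f[1]\<close> factors through
  \<open>f'\<close>. The choice needs \<open>v' h = 0\<close>, and again splittability provides
  it.\<close>

lemma theta_inj:
  assumes t: "(f, u, v) \<in> \<D>" and t': "(f', u', v') \<in> \<D>"
    and split: "splittable P f \<or> splittable P f'"
    and x [simp]: "x \<in> Arr P" "Dom P x = so (Dom P f)" "Cod P x = Cod P f'"
    and z: "u' \<bullet> x \<bullet> v = Zero P (Cod P u) (Cod P u')"
  shows "\<exists>g h. g \<in> Arr P \<and> Dom P g = so (Dom P f) \<and> Cod P g = Dom P f' \<and>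
    h \<in> Arr P \<and> Dom P h = so (Cod P f) \<and> Cod P h = Cod P f' \<and>
    x = Sub P (f' \<bullet> g) (h \<bullet> sh f)"
proof -
  note [simp] = distinguishedD[OF t] distinguishedD[OF t'] composite_zero'[OF t] composite_zero'[OF t']
  have "(u' \<bullet> x) \<bullet> v = Zero P (Dom P v) (Cod P (u' \<bullet> x))" using z by (simp add: assoc)
  then obtain h where h [simp]: "h \<in> Arr P" "Dom P h = so (Cod P f)" "Cod P h = Cod P u'"
    and hf: "u' \<bullet> x = h \<bullet> sh f"
    using extend_fourth[OF t, of "u' \<bullet> x"] by (metis comp_simps x distinguishedD[OF t'])
  have 0: "v' \<bullet> h \<bullet> sh f = Zero P (so (Dom P f)) (so (Dom P f'))"
    using assoc[of x u' v'] by (simp add: hf)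
  obtain k where k [simp]: "k \<in> Arr P" "Dom P k = so (Cod P f)" "Cod P k = Cod P u'"
    and kf: "k \<bullet> sh f = h \<bullet> sh f"
    and vk: "v' \<bullet> k = Zero P (so (Cod P f)) (so (Dom P f'))"
  proof (cases "splittable P f")
    case True
    then obtain s where s [simp]: "s \<in> Arr P" "Dom P s = Cod P f" "Cod P s = Dom P f"
      and fsf: "f \<bullet> s \<bullet> f = f" by (rule splittableE)
    have fsf': "sh f \<bullet> sh s \<bullet> sh f = sh f" using arg_cong[OF fsf, of sh] by simp
    have "v' \<bullet> (h \<bullet> sh f) \<bullet> sh s = Zero P (so (Cod P f)) (so (Dom P f'))"
      using assoc[of "sh s" "h \<bullet> sh f" v'] 0 by simp
    then show thesis by (intro that[of "(h \<bullet> sh f) \<bullet> sh s"]) (simp_all add: assoc fsf')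
  next
    case False
    then obtain s where s [simp]: "s \<in> Arr P" "Dom P s = Cod P f'" "Cod P s = Dom P f'"
      and fsf: "f' \<bullet> s \<bullet> f' = f'" using split by (metis splittableE)
    have fsf': "sh f' \<bullet> sh s \<bullet> sh f' = sh f'" using arg_cong[OF fsf, of sh] by simp
    \<comment> \<open>The idempotent complementary to \<open>s[1] f'[1]\<close>. It satisfies
      \<open>f'[1] e = 0\<close> and \<open>e v' = v'\<close>, so a lift \<open>r\<close> of
      \<open>e\<close> through \<open>v'\<close> gives \<open>v' r v' = v'\<close>, and
      \<open>r v' h\<close> can be subtracted from \<open>h\<close>.\<close>
    define e where "e = Sub P (Ide P (so (Dom P f'))) (sh s \<bullet> sh f')"
    have e [simp]: "e \<in> Arr P" "Dom P e = so (Dom P f')" "Cod P e = so (Dom P f')" by (simp_all add: e_def)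
    have "sh f' \<bullet> e = Zero P (Dom P e) (so (Cod P f'))" by (simp add: comp_sub fsf' e_def)
    then obtain r where r [simp]: "r \<in> Arr P" "Dom P r = so (Dom P f')" "Cod P r = Cod P u'"
      and er: "e = v' \<bullet> r"
      using lift_third[OF t' e(1)] by (metis e distinguishedD[OF t'])
    have "v' \<bullet> r \<bullet> v' \<bullet> h = e \<bullet> v' \<bullet> h" by (simp add: er assoc)
    also have "\<dots> = v' \<bullet> h"
      using comp_reduce[OF composite_zero'(2)[OF t'], of h] by (simp add: comp_sub assoc e_def)
    finally show thesis
      by (intro that[of "Sub P h (r \<bullet> v' \<bullet> h)"]) (simp_all add: assoc comp_sub 0)
  qed
  obtain q where q [simp]: "q \<in> Arr P" "Dom P q = so (Cod P f)" "Cod P q = Cod P f'" and kq: "k = u' \<bullet> q"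
    using lift_second[OF t', of k] vk by (metis k distinguishedD[OF t'])
  define y' where "y' = Sub P x (q \<bullet> sh f)"
  have y' [simp]: "y' \<in> Arr P" "Dom P y' = so (Dom P f)" "Cod P y' = Cod P f'" by (simp_all add: y'_def)
  have "u' \<bullet> y' = Sub P (h \<bullet> sh f) (k \<bullet> sh f)"
    by (simp add: comp_sub hf kq assoc y'_def)
  then have "u' \<bullet> y' = Zero P (Dom P y') (Cod P u')" by (simp add: kf)
  then obtain g where g [simp]: "g \<in> Arr P" "Dom P g = so (Dom P f)" "Cod P g = Dom P f'" and y: "y' = f' \<bullet> g"
    using lift_first[OF t' y'(1)] by (metis y' distinguishedD[OF t'])
  have "x = Add P y' (q \<bullet> sh f)" by (simp add: y'_def)
  then have "x = Add P (f' \<bullet> g) (q \<bullet> sh f)" unfolding y .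
  then have "x = Sub P (f' \<bullet> g) (Neg P q \<bullet> sh f)" by (simp add: Sub_def comp_neg)
  then show ?thesis by (intro exI[of _ g] exI[of _ "Neg P q"]) simp
qed

end

section \<open>The Toda bifunctor\<close>

lemma arrowcat_simps [simp]:
  "Ob (arrowcat P) = Arr P"
  "Dom (arrowcat P) (f, f', a, b) = f"
  "Cod (arrowcat P) (f, f', a, b) = f'"
  "Ide (arrowcat P) f = (f, f, Ide P (Dom P f), Ide P (Cod P f))"
  "Comp (arrowcat P) (f\<^sub>1, f\<^sub>2, a', b') (f, f', a, b) = (f, f\<^sub>2, a' \<cdot>\<^bsub>P\<^esub> a, b' \<cdot>\<^bsub>P\<^esub> b)"
  "Add (arrowcat P) (f, f', a, b) (f\<^sub>1, f\<^sub>2, a', b') = (f, f', Add P a a', Add P b b')"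
  "Zero (arrowcat P) f f' = (f, f', Zero P (Dom P f) (Dom P f'), Zero P (Cod P f) (Cod P f'))"
  "ShO (arrowcat P) f = Neg P (ShM P f)"
  "ShM (arrowcat P) (f, f', a, b) = (Neg P (ShM P f), Neg P (ShM P f'), ShM P a, ShM P b)"
  by (simp_all add: arrowcat_def)

lemma arrowcat_arr [simp]: "(f, f', a, b) \<in> Arr (arrowcat P) \<longleftrightarrow> f \<in> Arr P \<and> f' \<in> Arr P \<and>
    a \<in> Arr P \<and> Dom P a = Dom P f \<and> Cod P a = Dom P f' \<and>
    b \<in> Arr P \<and> Dom P b = Cod P f \<and> Cod P b = Cod P f' \<and> b \<cdot>\<^bsub>P\<^esub> f = f' \<cdot>\<^bsub>P\<^esub> a"
  by (auto simp: arrowcat_def Hom_def)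

context translation_category
begin

lemma toda_rel_iff: "z \<in> toda_rel C f f' \<longleftrightarrow> (\<exists>g h. z = Sub C (f' \<cdot> g) (h \<cdot> sh f) \<and>
    g \<in> Arr C \<and> Dom C g = so (Dom C f) \<and> Cod C g = Dom C f' \<and>
    h \<in> Arr C \<and> Dom C h = so (Cod C f) \<and> Cod C h = Cod C f')"
  by (auto simp: toda_rel_def Sub_def Hom_def)

context
  fixes f f' assumes f [simp]: "f \<in> Arr C" "f' \<in> Arr C"
begin

abbreviation (input) "TG \<equiv> homgrp C (so (Dom C f)) (Cod C f')"

lemma TG_comm: "comm_group TG" by (rule hom_comm_group) auto

lemma TG_inv: "x \<in> Hom C (so (Dom C f)) (Cod C f') \<Longrightarrow> inv\<^bsub>TG\<^esub> x = Neg C x"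
  by (auto simp: Neg_def Hom_def)

lemma toda_rel_subgroup: "subgroup (toda_rel C f f') TG"
proof -
  interpret comm_group TG by (rule TG_comm)
  show ?thesis
  proof (rule subgroupI)
    show s: "toda_rel C f f' \<subseteq> carrier TG" by (auto simp: toda_rel_iff Hom_def)
    have "Zero C (so (Dom C f)) (Cod C f') \<in> toda_rel C f f'"
      unfolding toda_rel_iff
      by (rule exI[of _ "Zero C (so (Dom C f)) (Dom C f')"], rule exI[of _ "Zero C (so (Cod C f)) (Cod C f')"]) simp
    then show "toda_rel C f f' \<noteq> {}" by blast
    fix x assume x: "x \<in> toda_rel C f f'"
    then obtain g h where g: "x = Sub C (f' \<cdot> g) (h \<cdot> sh f)"
      "g \<in> Arr C" "Dom C g = so (Dom C f)" "Cod C g = Dom C f'"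
      "h \<in> Arr C" "Dom C h = so (Cod C f)" "Cod C h = Cod C f'" unfolding toda_rel_iff by blast
    have "Neg C x = Sub C (f' \<cdot> Neg C g) (Neg C h \<cdot> sh f)"
      using g by (simp add: Sub_def neg_add comp_neg)
    then have "Neg C x \<in> toda_rel C f f'" unfolding toda_rel_iff using g
      by (intro exI[of _ "Neg C g"] exI[of _ "Neg C h"]) simp
    then show "inv\<^bsub>TG\<^esub> x \<in> toda_rel C f f'" using TG_inv x s by auto
    fix y assume "y \<in> toda_rel C f f'"
    then obtain g' h' where g': "y = Sub C (f' \<cdot> g') (h' \<cdot> sh f)"
      "g' \<in> Arr C" "Dom C g' = so (Dom C f)" "Cod C g' = Dom C f'"
      "h' \<in> Arr C" "Dom C h' = so (Cod C f)" "Cod C h' = Cod C f'" unfolding toda_rel_iff by blast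
    have "Add C x y = Sub C (f' \<cdot> Add C g g') (Add C h h' \<cdot> sh f)"
      using g g' by (simp add: Sub_def comp_add neg_add add_ac)
    then have "Add C x y \<in> toda_rel C f f'" unfolding toda_rel_iff using g g'
      by (intro exI[of _ "Add C g g'"] exI[of _ "Add C h h'"]) simp
    then show "x \<otimes>\<^bsub>TG\<^esub> y \<in> toda_rel C f f'" by simp
  qed
qed

lemma toda_class_add:
  assumes "x \<in> Hom C (so (Dom C f)) (Cod C f')" "y \<in> Hom C (so (Dom C f)) (Cod C f')"
  shows "toda_class C f f' x <#>\<^bsub>TG\<^esub> toda_class C f f' y = toda_class C f f' (Add C x y)"
proof -
  interpret comm_group TG by (rule TG_comm)
  have "toda_rel C f f' \<lhd> TG" using toda_rel_subgroup by (rule subgroup_imp_normal)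
  from normal.rcos_sum[OF this] show ?thesis unfolding toda_class_def using assms by simp
qed

lemma toda_class_carrier: "x \<in> Hom C (so (Dom C f)) (Cod C f') \<Longrightarrow>
    toda_class C f f' x \<in> carrier (BG (Toda C) f f')"
  by (auto simp: Toda_def FactGroup_def RCOSETS_def toda_class_def)

lemma toda_class_surj: "K \<in> carrier (BG (Toda C) f f') \<Longrightarrow>
    \<exists>x. x \<in> Hom C (so (Dom C f)) (Cod C f') \<and> K = toda_class C f f' x"
  by (auto simp: Toda_def FactGroup_def RCOSETS_def toda_class_def)

lemma toda_class_eqI:
  assumes "y \<in> toda_class C f f' x" "x \<in> Hom C (so (Dom C f)) (Cod C f')"
  shows "toda_class C f f' y = toda_class C f f' x"
proof -
  interpret comm_group TG by (rule TG_comm)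
  show ?thesis using repr_independence[OF _ _ toda_rel_subgroup, of y x] assms
    by (simp add: toda_class_def)
qed

lemma toda_class_self: "x \<in> Hom C (so (Dom C f)) (Cod C f') \<Longrightarrow> x \<in> toda_class C f f' x"
proof -
  interpret comm_group TG by (rule TG_comm)
  show "x \<in> Hom C (so (Dom C f)) (Cod C f') \<Longrightarrow> x \<in> toda_class C f f' x"
    using rcos_self[OF _ toda_rel_subgroup, of x] by (simp add: toda_class_def)
qed

lemma toda_class_mem: "y \<in> toda_class C f f' x \<longleftrightarrow> (\<exists>r\<in>toda_rel C f f'. y = Add C r x)"
  by (auto simp: toda_class_def r_coset_def)

lemma toda_one: "one (BG (Toda C) f f') = toda_rel C f f'"
  by (simp add: Toda_def FactGroup_def)

lemma toda_class_one:
  assumes "x \<in> Hom C (so (Dom C f)) (Cod C f')"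
  shows "toda_class C f f' x = one (BG (Toda C) f f') \<longleftrightarrow> x \<in> toda_rel C f f'"
proof -
  interpret comm_group TG by (rule TG_comm)
  show ?thesis unfolding toda_one toda_class_def
    using coset_join1[OF _ _ toda_rel_subgroup, of x] coset_join2[OF _ toda_rel_subgroup, of x] assms by auto
qed

end

text \<open>The maps \<open>x \<mapsto> u' x v\<close> are of this kind. The image of a class is a
  singleton, so \<open>the_elem\<close> in the structure map of \<open>Triangles0\<close> returns
  the value at any representative.\<close>

lemma toda_class_image:
  assumes f: "f \<in> Arr C" "f' \<in> Arr C" and x: "x \<in> Hom C (so (Dom C f)) (Cod C f')"
    and q [simp]: "q \<in> Arr C" "Dom C q = Cod C f'" and p [simp]: "p \<in> Arr C" "Cod C p = so (Dom C f)"
    and qf: "q \<cdot> f' = Zero C (Dom C f') (Cod C q)" and fp: "sh f \<cdot> p = Zero C (Dom C p) (so (Cod C f))"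
  shows "(\<lambda>x. q \<cdot> x \<cdot> p) ` toda_class C f f' x = {q \<cdot> x \<cdot> p}"
proof -
  note [simp] = f
  have [simp]: "x \<in> Arr C" "Dom C x = so (Dom C f)" "Cod C x = Cod C f'" using x by (auto simp: Hom_def)
  have "q \<cdot> y \<cdot> p = q \<cdot> x \<cdot> p" if y: "y \<in> toda_class C f f' x" for y
  proof -
    obtain r where "r \<in> toda_rel C f f'" "y = Add C r x" using y toda_class_mem[OF f, of y x] by auto
    then obtain g h where y: "y = Add C (Sub C (f' \<cdot> g) (h \<cdot> sh f)) x"
      and [simp]: "g \<in> Arr C" "Dom C g = so (Dom C f)" "Cod C g = Dom C f'"
      "h \<in> Arr C" "Dom C h = so (Cod C f)" "Cod C h = Cod C f'" unfolding toda_rel_iff by blast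
    have 1: "q \<cdot> f' \<cdot> g \<cdot> p = Zero C (Dom C p) (Cod C q)"
      using comp_reduce[OF qf, of "g \<cdot> p"] by simp
    have "y \<cdot> p = Add C (f' \<cdot> g \<cdot> p) (x \<cdot> p)"
      unfolding y by (simp add: comp_add comp_sub assoc fp)
    then show ?thesis by (simp add: comp_add 1)
  qed
  then have "(\<lambda>x. q \<cdot> x \<cdot> p) ` toda_class C f f' x = (\<lambda>_. q \<cdot> x \<cdot> p) ` toda_class C f f' x"
    by (rule image_cong[OF refl])
  also have "\<dots> = {q \<cdot> x \<cdot> p}" by (rule image_constant[OF toda_class_self[OF f x]])
  finally show ?thesis .
qed

text \<open>The two commuting squares carry the indeterminacy of the source into that of the target:
  \<open>b' f' = f\<^sub>1 a'\<close> and \<open>f[1] a[1] = b[1] f\<^sub>0[1]\<close>. Hence all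
  classes in the union coincide.\<close>

lemma toda_BM:
  assumes "(f\<^sub>0, f, a, b) \<in> Arr (arrowcat C)" "(f', f\<^sub>1, a', b') \<in> Arr (arrowcat C)"
    and x: "x \<in> Hom C (so (Dom C f)) (Cod C f')"
  shows "BM (Toda C) (f\<^sub>0, f, a, b) (f', f\<^sub>1, a', b') (toda_class C f f' x) =
    toda_class C f\<^sub>0 f\<^sub>1 (b' \<cdot> x \<cdot> sh a)"
proof -
  note [simp] = assms(1)[simplified] assms(2)[simplified]
  have x' [simp]: "x \<in> Arr C" "Dom C x = so (Dom C f)" "Cod C x = Cod C f'"
    using x by (auto simp: Hom_def)
  have "toda_class C f\<^sub>0 f\<^sub>1 (b' \<cdot> y \<cdot> sh a) = toda_class C f\<^sub>0 f\<^sub>1 (b' \<cdot> x \<cdot> sh a)"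
    if y: "y \<in> toda_class C f f' x" for y
  proof -
    obtain r where r: "r \<in> toda_rel C f f'" "y = Add C r x"
      using y toda_class_mem[of f f' y x] by auto
    then obtain g h where yy: "y = Add C (Sub C (f' \<cdot> g) (h \<cdot> sh f)) x"
      and [simp]: "g \<in> Arr C" "Dom C g = so (Dom C f)" "Cod C g = Dom C f'"
      "h \<in> Arr C" "Dom C h = so (Cod C f)" "Cod C h = Cod C f'"
      unfolding toda_rel_iff by blast
    have 1: "b' \<cdot> f' \<cdot> g \<cdot> sh a = f\<^sub>1 \<cdot> a' \<cdot> g \<cdot> sh a"
      using comp_reduce[of b' f' "f\<^sub>1 \<cdot> a'" "g \<cdot> sh a"] by (simp add: assoc)
    have 2: "sh f \<cdot> sh a = sh b \<cdot> sh f\<^sub>0" by (simp flip: sh_comp)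
    have "b' \<cdot> y \<cdot> sh a = Add C (Sub C (f\<^sub>1 \<cdot> a' \<cdot> g \<cdot> sh a) ((b' \<cdot> h \<cdot> sh b) \<cdot> sh f\<^sub>0)) (b' \<cdot> x \<cdot> sh a)"
      by (simp add: yy comp_add comp_sub assoc 1 2)
    moreover have "Sub C (f\<^sub>1 \<cdot> a' \<cdot> g \<cdot> sh a) ((b' \<cdot> h \<cdot> sh b) \<cdot> sh f\<^sub>0) \<in> toda_rel C f\<^sub>0 f\<^sub>1"
      unfolding toda_rel_iff
      by (rule exI[of _ "a' \<cdot> g \<cdot> sh a"], rule exI[of _ "b' \<cdot> h \<cdot> sh b"]) simp
    ultimately have "b' \<cdot> y \<cdot> sh a \<in> toda_class C f\<^sub>0 f\<^sub>1 (b' \<cdot> x \<cdot> sh a)"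
      by (auto simp: toda_class_mem)
    then show ?thesis by (rule toda_class_eqI[rotated 2]) (auto simp: Hom_def)
  qed
  then have "(\<Union>y\<in>toda_class C f f' x. toda_class C f\<^sub>0 f\<^sub>1 (b' \<cdot> y \<cdot> sh a)) = (\<Union>y\<in>toda_class C f f' x. toda_class C f\<^sub>0 f\<^sub>1 (b' \<cdot> x \<cdot> sh a))"
    by (rule SUP_cong[OF refl])
  also have "\<dots> = toda_class C f\<^sub>0 f\<^sub>1 (b' \<cdot> x \<cdot> sh a)" using toda_class_self[OF _ _ x] by auto
  finally show ?thesis by (simp add: Toda_def)
qed

lemma toda_BT:
  assumes [simp]: "f \<in> Arr C" "f' \<in> Arr C"
    and x: "x \<in> Hom C (so (Dom C f)) (Cod C f')"
  shows "BT (Toda C) f f' (toda_class C f f' x) =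
    toda_class C (Neg C (sh f)) (Neg C (sh f')) (sh x)"
proof -
  have x' [simp]: "x \<in> Arr C" "Dom C x = so (Dom C f)" "Cod C x = Cod C f'"
    using x by (auto simp: Hom_def)
  have "toda_class C (Neg C (sh f)) (Neg C (sh f')) (sh y) = toda_class C (Neg C (sh f)) (Neg C (sh f')) (sh x)"
    if y: "y \<in> toda_class C f f' x" for y
  proof -
    obtain r where r: "r \<in> toda_rel C f f'" "y = Add C r x"
      using y toda_class_mem[of f f' y x] by auto
    then obtain g h where yy: "y = Add C (Sub C (f' \<cdot> g) (h \<cdot> sh f)) x"
      and [simp]: "g \<in> Arr C" "Dom C g = so (Dom C f)" "Cod C g = Dom C f'"
      "h \<in> Arr C" "Dom C h = so (Cod C f)" "Cod C h = Cod C f'"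
      unfolding toda_rel_iff by blast
    \<comment> \<open>The arrows are translated to \<open>-f[1]\<close> and \<open>-f'[1]\<close>,
      so \<open>g[1]\<close> and \<open>h[1]\<close> have to change sign as well; the two signs in
      each product cancel.\<close>
    have "sh y = Add C (Sub C (Neg C (sh f') \<cdot> Neg C (sh g)) (Neg C (sh h) \<cdot> sh (Neg C (sh f)))) (sh x)"
      by (simp add: yy comp_neg)
    moreover have "Sub C (Neg C (sh f') \<cdot> Neg C (sh g)) (Neg C (sh h) \<cdot> sh (Neg C (sh f))) \<in>
        toda_rel C (Neg C (sh f)) (Neg C (sh f'))"
      unfolding toda_rel_iff
      by (rule exI[of _ "Neg C (sh g)"], rule exI[of _ "Neg C (sh h)"]) simp
    ultimately have "sh y \<in> toda_class C (Neg C (sh f)) (Neg C (sh f')) (sh x)"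
      by (auto simp: toda_class_mem)
    then show ?thesis by (rule toda_class_eqI[rotated 2]) (auto simp: Hom_def)
  qed
  then have "(\<Union>y\<in>toda_class C f f' x. toda_class C (Neg C (sh f)) (Neg C (sh f')) (sh y)) = (\<Union>y\<in>toda_class C f f' x. toda_class C (Neg C (sh f)) (Neg C (sh f')) (sh x))"
    by (rule SUP_cong[OF refl])
  also have "\<dots> = toda_class C (Neg C (sh f)) (Neg C (sh f')) (sh x)" using toda_class_self[OF _ _ x] by auto
  finally show ?thesis by (simp add: Toda_def)
qed

section \<open>Splittable arrows, split arrows and the arrows \<open>0 -> X\<close>,
  \<open>X -> 0\<close>\<close>

lemma splittable_zero: "A \<in> Ob C \<Longrightarrow> B \<in> Ob C \<Longrightarrow> splittable C (Zero C A B)"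
  unfolding splittable_def by (rule conjI, simp, rule bexI[of _ "Zero C B A"]) (simp_all add: Hom_def)

lemma bang_simps [simp]:
  assumes "X \<in> Ob C"
  shows "bang C X \<in> Arr C" "Dom C (bang C X) = zob C" "Cod C (bang C X) = X"
    "cobang C X \<in> Arr C" "Dom C (cobang C X) = X" "Cod C (cobang C X) = zob C"
  using assms by (auto simp: bang_def cobang_def)

lemma splittable_bang: "X \<in> Ob C \<Longrightarrow> splittable C (bang C X)" "X \<in> Ob C \<Longrightarrow> splittable C (cobang C X)"
  by (auto simp: bang_def cobang_def splittable_zero)

text \<open>The indeterminacy \<open>h s + t f[1]\<close> is the subgroup that defines
  \<open>\<Delta>(f,h)\<close>, after \<open>t\<close> is replaced by \<open>-t\<close>. Massey
  products are handled as elements of \<open>\<Delta>(f,h)\<close> from here on.\<close>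

lemma massey_class_eq_toda_class:
  assumes "f \<in> Arr C" "h \<in> Arr C"
  shows "massey_class C h g f y = toda_class C f h y"
proof -
  have "indet C h g f = toda_rel C f h"
  proof (rule Set.set_eqI, rule iffI)
    fix z assume "z \<in> indet C h g f"
    then obtain s t where z: "z = Add C (h \<cdot> s) (t \<cdot> sh f)"
      "s \<in> Arr C" "Dom C s = so (Dom C f)" "Cod C s = Dom C h"
      "t \<in> Arr C" "Dom C t = so (Cod C f)" "Cod C t = Cod C h"
      by (auto simp: indet_def Hom_def)
    then show "z \<in> toda_rel C f h" unfolding toda_rel_iff
      by (intro exI[of _ s] exI[of _ "Neg C t"]) (simp add: Sub_def comp_neg assms)
  next
    fix z assume "z \<in> toda_rel C f h"
    then obtain s t where "z = Sub C (h \<cdot> s) (t \<cdot> sh f)"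
      "s \<in> Arr C" "Dom C s = so (Dom C f)" "Cod C s = Dom C h"
      "t \<in> Arr C" "Dom C t = so (Cod C f)" "Cod C t = Cod C h"
      unfolding toda_rel_iff by blast
    then show "z \<in> indet C h g f" unfolding indet_def mem_Collect_eq
      by (intro exI[of _ s] exI[of _ "Neg C t"]) (simp add: Sub_def comp_neg assms Hom_def)
  qed
  then show ?thesis by (simp add: massey_class_def toda_class_def)
qed

lemma biproduct_zob: "X \<in> Ob C \<Longrightarrow> biproduct C (zob C) X X (Zero C (zob C) X) (Ide C X) (Zero C X (zob C)) (Ide C X)"
  by (auto simp: biproduct_def Hom_def ide_zob)

text \<open>A zero arrow is the matrix with rows \<open>(1 0)\<close> and \<open>(0 0)\<close> whose
  common summand \<open>X\<close> is zero. This makes \<open>\<xi>\<close> an isomorphism as soon as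
  one argument is \<open>0 -> X\<close> or \<open>X -> 0\<close>.\<close>

lemma split_arrow_bang:
  assumes "X \<in> Ob C"
  shows "split_arrow C (bang C X)" "split_arrow C (cobang C X)"
proof -
  have i: "iso_arrow (arrowcat C) (f, f, Ide C (Dom C f), Ide C (Cod C f))"
    "(f, f, Ide C (Dom C f), Ide C (Cod C f)) \<in> Hom (arrowcat C) f f" if "f \<in> Arr C" for f
    unfolding iso_arrow_def inverse_arrows_def using that
    by (intro exI[of _ "(f, f, Ide C (Dom C f), Ide C (Cod C f))"]) (simp_all add: Hom_def that)
  have "split_arrow C (Zero C A B)" if "A \<in> Ob C" "B \<in> Ob C" for A B
  proof -
    have e: "Zero C (zob C) B \<cdot> Zero C A (zob C) = Zero C A B" using that by simp
    show ?thesis unfolding split_arrow_def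
      by ((rule exI)+, (rule conjI, rule biproduct_zob, rule that)+, unfold e, rule conjI,
        rule i(2), simp add: that, rule i(1), simp add: that)
  qed
  then show "split_arrow C (bang C X)" "split_arrow C (cobang C X)"
    using assms by (simp_all add: bang_def cobang_def)
qed

text \<open>For the model \<open>j\<^sub>1 p\<^sub>1\<close> the arrow
  \<open>i\<^sub>1 q\<^sub>1\<close> is a weak inverse; an isomorphism of arrows transports
  it.\<close>

lemma split_imp_splittable:
  assumes "split_arrow C f" and f [simp]: "f \<in> Arr C" shows "splittable C f"
proof -
  obtain X X' X'' S i\<^sub>1 i\<^sub>2 p\<^sub>1 p\<^sub>2 T j\<^sub>1 j\<^sub>2 q\<^sub>1 q\<^sub>2 m where
    b: "biproduct C X X' S i\<^sub>1 i\<^sub>2 p\<^sub>1 p\<^sub>2" "biproduct C X X'' T j\<^sub>1 j\<^sub>2 q\<^sub>1 q\<^sub>2"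
    and m: "m \<in> Hom (arrowcat C) f (j\<^sub>1 \<cdot> p\<^sub>1)" "iso_arrow (arrowcat C) m"
    using assms(1) unfolding split_arrow_def by blast
  note b' = b[unfolded biproduct_def Hom_def mem_Collect_eq]
  have [simp]: "X \<in> Ob C" "S \<in> Ob C" "T \<in> Ob C" "i\<^sub>1 \<in> Arr C" "Dom C i\<^sub>1 = X" "Cod C i\<^sub>1 = S"
    "p\<^sub>1 \<in> Arr C" "Dom C p\<^sub>1 = S" "Cod C p\<^sub>1 = X" "j\<^sub>1 \<in> Arr C" "Dom C j\<^sub>1 = X" "Cod C j\<^sub>1 = T"
    "q\<^sub>1 \<in> Arr C" "Dom C q\<^sub>1 = T" "Cod C q\<^sub>1 = X" "p\<^sub>1 \<cdot> i\<^sub>1 = Ide C X" "q\<^sub>1 \<cdot> j\<^sub>1 = Ide C X"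
    using b' by blast+
  define f1 where "f1 = j\<^sub>1 \<cdot> p\<^sub>1"
  have f1 [simp]: "f1 \<in> Arr C" "Dom C f1 = S" "Cod C f1 = T" by (simp_all add: f1_def)
  have r: "f1 \<cdot> i\<^sub>1 \<cdot> q\<^sub>1 \<cdot> f1 = f1"
    using comp_reduce[of p\<^sub>1 i\<^sub>1 "Ide C X" "q\<^sub>1 \<cdot> j\<^sub>1 \<cdot> p\<^sub>1"] comp_reduce[of q\<^sub>1 j\<^sub>1 "Ide C X" p\<^sub>1]
    by (simp add: f1_def assoc)
  obtain n where n: "inverse_arrows (arrowcat C) m n" using m(2) by (auto simp: iso_arrow_def)
  obtain a b where me: "m = (f, f1, a, b)" using m(1) by (cases m) (simp add: Hom_def f1_def)
  have mm: "m \<in> Arr (arrowcat C)" using m(1) by (simp add: Hom_def)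
  have ab [simp]: "a \<in> Arr C" "Dom C a = Dom C f" "Cod C a = S" "b \<in> Arr C" "Dom C b = Cod C f" "Cod C b = T"
    and sq: "b \<cdot> f = f1 \<cdot> a" using mm unfolding me by simp_all
  have nn: "n \<in> Hom (arrowcat C) f1 f" using n by (simp add: inverse_arrows_def me)
  obtain a' b' where ne: "n = (f1, f, a', b')" using nn by (cases n) (simp add: Hom_def)
  have nn': "n \<in> Arr (arrowcat C)" using nn by (simp add: Hom_def)
  have ab' [simp]: "a' \<in> Arr C" "Dom C a' = S" "Cod C a' = Dom C f" "b' \<in> Arr C" "Dom C b' = T" "Cod C b' = Cod C f"
    and sq': "f \<cdot> a' = b' \<cdot> f1" using nn' unfolding ne by simp_all
  have inv: "b' \<cdot> b = Ide C (Cod C f)" using n by (simp add: inverse_arrows_def me ne)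
  have "f \<cdot> (a' \<cdot> i\<^sub>1 \<cdot> q\<^sub>1 \<cdot> b) \<cdot> f = (f \<cdot> a') \<cdot> i\<^sub>1 \<cdot> q\<^sub>1 \<cdot> (b \<cdot> f)" by (simp add: assoc)
  also have "\<dots> = b' \<cdot> (f1 \<cdot> i\<^sub>1 \<cdot> q\<^sub>1 \<cdot> f1) \<cdot> a" by (simp add: sq sq' assoc)
  also have "\<dots> = (b' \<cdot> b) \<cdot> f" by (simp add: r sq assoc)
  also have "\<dots> = f" by (simp add: inv)
  finally have "f \<cdot> (a' \<cdot> i\<^sub>1 \<cdot> q\<^sub>1 \<cdot> b) \<cdot> f = f" .
  then show ?thesis unfolding splittable_def
    by (intro conjI bexI[of _ "a' \<cdot> i\<^sub>1 \<cdot> q\<^sub>1 \<cdot> b"]) (simp_all add: Hom_def)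
qed

end

section \<open>Pseudo-triangulated categories\<close>

locale pseudo_triangulated_category =
  fixes P :: "('o, 'm) tcat" and S :: "('m, 'p, 'n, 'u) pstruct"
  assumes base_tau: "tau_category P" and pseudo: "pseudo_triangulated P S"
begin

abbreviation "Q \<equiv> Ptr S"
abbreviation "ob \<equiv> pob S"
abbreviation "ar \<equiv> FO (Prj S)"
abbreviation comp_P (infixr \<open>\<odot>\<close> 75) where "g \<odot> f \<equiv> g \<cdot>\<^bsub>P\<^esub> f"
abbreviation comp_Q (infixr \<open>\<star>\<close> 75) where "g \<star> f \<equiv> g \<cdot>\<^bsub>Ptr S\<^esub> f"

definition pa :: "'n \<Rightarrow> 'm" where "pa m = fst (snd (snd (FM (Prj S) m)))"
definition pb :: "'n \<Rightarrow> 'm" where "pb m = snd (snd (snd (FM (Prj S) m)))"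

text \<open>The arrow of \<open>Ptr\<close> given by \<open>x : A[1] \<rightarrow> B'\<close>, along \<open>\<Delta>(f,f') \<rightarrow> \<Upsilon>(f,f') \<rightarrow> Ptr\<close>.\<close>

definition el :: "'m \<Rightarrow> 'm \<Rightarrow> 'm \<Rightarrow> 'n" where
  "el f f' x = Inc S (ob f) (ob f') (Phi S f f' (toda_class P f f' x))"

lemma structureD:
  "tau_category Q" "tau_category (arrowcat P)" "tau_ftor Q (arrowcat P) (Prj S)"
  "quotient_iso Q (arrowcat P) (Prj S)" "bij_betw ar (Ob Q) (Arr P)"
  "tau_trans Q (pull_bifun (Prj S) (Ups S)) (ker_bifun Q (arrowcat P) (Prj S)) (Inc S)"
  "tau_trans (arrowcat P) (Toda P) (Ups S) (Phi S)"
  "tau_bifunctor (arrowcat P) (Ups S)"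
  using pseudo
  by (auto simp: pseudo_triangulated_def singular_tau_extension_def singular_extension_def quotient_iso_def)

end

sublocale pseudo_triangulated_category \<subseteq> P: translation_category P
proof -
  interpret additive_category P using base_tau by (simp add: tau_category_def)
  show "translation_category P" by unfold_locales (rule base_tau)
qed

sublocale pseudo_triangulated_category \<subseteq> Q: translation_category "Ptr S"
proof -
  interpret additive_category "Ptr S" using structureD(1) by (simp add: tau_category_def)
  show "translation_category (Ptr S)" by unfold_locales (rule structureD(1))
qed

context pseudo_triangulated_category
begin

lemma arrowcat_translation: "translation_category (arrowcat P)"
proof -
  interpret additive_category "arrowcat P" using structureD(2) by (simp add: tau_category_def)
  show "translation_category (arrowcat P)" by unfold_locales (rule structureD(2))
qed

lemma ob_bij: "f \<in> Arr P \<Longrightarrow> ob f \<in> Ob Q" "f \<in> Arr P \<Longrightarrow> ar (ob f) = f"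
  "X \<in> Ob Q \<Longrightarrow> ob (ar X) = X" "X \<in> Ob Q \<Longrightarrow> ar X \<in> Arr P"
proof -
  note b = structureD(5)
  have i: "inj_on ar (Ob Q)" and im: "ar ` Ob Q = Arr P" using b by (auto simp: bij_betw_def)
  show "f \<in> Arr P \<Longrightarrow> ob f \<in> Ob Q" "f \<in> Arr P \<Longrightarrow> ar (ob f) = f"
    "X \<in> Ob Q \<Longrightarrow> ob (ar X) = X" "X \<in> Ob Q \<Longrightarrow> ar X \<in> Arr P"
    using im the_inv_into_into[OF i, of f "Ob Q"] f_the_inv_into_f[OF i, of f] the_inv_into_f_f[OF i, of X]
    by (auto simp: pob_def)
qed

lemmas [simp] = ob_bij

section \<open>The two components of an arrow of \<open>Ptr\<close>\<close>

lemma prj_ftor: "is_ftor Q (arrowcat P) (Prj S)"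
  using structureD(3) by (simp add: tau_ftor_def additive_ftor_def)

lemma prj_eq:
  assumes "m \<in> Arr Q"
  shows "FM (Prj S) m = (ar (Dom Q m), ar (Cod Q m), pa m, pb m)"
    and "(ar (Dom Q m), ar (Cod Q m), pa m, pb m) \<in> Arr (arrowcat P)"
proof -
  note F = Q.ftorD[OF prj_ftor]
  obtain f f' a b where e: "FM (Prj S) m = (f, f', a, b)" by (metis prod.exhaust)
  then show "FM (Prj S) m = (ar (Dom Q m), ar (Cod Q m), pa m, pb m)"
    using F(3,4)[OF assms] by (simp add: pa_def pb_def)
  then show "(ar (Dom Q m), ar (Cod Q m), pa m, pb m) \<in> Arr (arrowcat P)"
    using F(2)[OF assms] by simp
qed

lemma pa_pb_simps [simp]:
  assumes "m \<in> Arr Q"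
  shows "pa m \<in> Arr P" "Dom P (pa m) = Dom P (ar (Dom Q m))" "Cod P (pa m) = Dom P (ar (Cod Q m))"
    "pb m \<in> Arr P" "Dom P (pb m) = Cod P (ar (Dom Q m))" "Cod P (pb m) = Cod P (ar (Cod Q m))"
  using prj_eq(2)[OF assms] by simp_all

lemma square: "m \<in> Arr Q \<Longrightarrow> pb m \<odot> ar (Dom Q m) = ar (Cod Q m) \<odot> pa m"
  using prj_eq(2)[of m] by simp

lemma pa_pb_comp [simp]:
  assumes "m \<in> Arr Q" "n \<in> Arr Q" "Dom Q n = Cod Q m"
  shows "pa (n \<star> m) = pa n \<odot> pa m" "pb (n \<star> m) = pb n \<odot> pb m"
  using Q.ftorD(6)[OF prj_ftor, of m n] assms by (simp_all add: prj_eq)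

lemma pa_pb_ide [simp]:
  assumes "X \<in> Ob Q"
  shows "pa (Ide Q X) = Ide P (Dom P (ar X))" "pb (Ide Q X) = Ide P (Cod P (ar X))"
  using Q.ftorD(5)[OF prj_ftor, of X] assms by (simp_all add: prj_eq)

lemma pa_pb_add [simp]:
  assumes "m \<in> Arr Q" "n \<in> Arr Q" "Dom Q n = Dom Q m" "Cod Q n = Cod Q m"
  shows "pa (Add Q m n) = Add P (pa m) (pa n)" "pb (Add Q m n) = Add P (pb m) (pb n)"
proof -
  interpret A: translation_category "arrowcat P" by (rule arrowcat_translation)
  have "FM (Prj S) \<in> hom (homgrp Q (Dom Q m) (Cod Q m)) (homgrp (arrowcat P) (ar (Dom Q m)) (ar (Cod Q m)))"
    using structureD(3) assms by (simp add: tau_ftor_def additive_ftor_def)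
  then have "FM (Prj S) (Add Q m n) = Add (arrowcat P) (FM (Prj S) m) (FM (Prj S) n)"
    using assms by (auto simp: hom_def Hom_def)
  then show "pa (Add Q m n) = Add P (pa m) (pa n)" "pb (Add Q m n) = Add P (pb m) (pb n)"
    using assms by (simp_all add: prj_eq)
qed

lemma pa_pb_zero [simp]:
  assumes "X \<in> Ob Q" "Y \<in> Ob Q"
  shows "pa (Zero Q X Y) = Zero P (Dom P (ar X)) (Dom P (ar Y))"
    "pb (Zero Q X Y) = Zero P (Cod P (ar X)) (Cod P (ar Y))"
  using P.zero_unique[of "pa (Zero Q X Y)"] P.zero_unique[of "pb (Zero Q X Y)"] assms
  by (simp_all flip: pa_pb_add)

lemma pa_pb_neg [simp]:
  assumes "m \<in> Arr Q"
  shows "pa (Neg Q m) = Neg P (pa m)" "pb (Neg Q m) = Neg P (pb m)"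
proof -
  have "Add Q (Neg Q m) m = Zero Q (Dom Q m) (Cod Q m)" using Q.neg_add_self[of m] assms by simp
  then have "pa (Add Q (Neg Q m) m) = pa (Zero Q (Dom Q m) (Cod Q m))"
    "pb (Add Q (Neg Q m) m) = pb (Zero Q (Dom Q m) (Cod Q m))" by auto
  then show "pa (Neg Q m) = Neg P (pa m)" "pb (Neg Q m) = Neg P (pb m)"
    using assms by (auto intro!: P.neg_unique)
qed

lemma pa_pb_sub [simp]:
  assumes "m \<in> Arr Q" "n \<in> Arr Q" "Dom Q n = Dom Q m" "Cod Q n = Cod Q m"
  shows "pa (Sub Q m n) = Sub P (pa m) (pa n)" "pb (Sub Q m n) = Sub P (pb m) (pb n)"
  using assms by (simp_all add: Sub_def)

lemma ar_so [simp]: "X \<in> Ob Q \<Longrightarrow> ar (ShO Q X) = Neg P (P.sh (ar X))"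
  using structureD(3) by (simp add: tau_ftor_def)

lemma ob_so [simp]: "f \<in> Arr P \<Longrightarrow> ShO Q (ob f) = ob (Neg P (P.sh f))"
  using ar_so[of "ob f"] ob_bij(3)[of "ShO Q (ob f)"] by simp

lemma pa_pb_sh [simp]:
  assumes "m \<in> Arr Q"
  shows "pa (Q.sh m) = P.sh (pa m)" "pb (Q.sh m) = P.sh (pb m)"
  using structureD(3) assms by (simp_all add: tau_ftor_def prj_eq)

text \<open>The ideal \<open>ker p\<close> as a predicate on arrows, which read off source and
  target instead of carrying them as parameters.\<close>

definition null :: "'n \<Rightarrow> bool" where
  "null m \<longleftrightarrow> m \<in> Arr Q \<and>
    pa m = Zero P (Dom P (ar (Dom Q m))) (Dom P (ar (Cod Q m))) \<and>
    pb m = Zero P (Cod P (ar (Dom Q m))) (Cod P (ar (Cod Q m)))"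

lemma ker_hom_iff: "X \<in> Ob Q \<Longrightarrow> Y \<in> Ob Q \<Longrightarrow>
  m \<in> ker_hom Q (arrowcat P) (Prj S) X Y \<longleftrightarrow> null m \<and> Dom Q m = X \<and> Cod Q m = Y"
proof -
  interpret A: translation_category "arrowcat P" by (rule arrowcat_translation)
  show "X \<in> Ob Q \<Longrightarrow> Y \<in> Ob Q \<Longrightarrow> ?thesis"
    by (auto simp: ker_hom_def kernel_def null_def prj_eq Hom_def)
qed

lemma null_comp_null:
  assumes "null m" "null n" "Dom Q n = Cod Q m"
  shows "n \<star> m = Zero Q (Dom Q m) (Cod Q n)"
proof -
  have m: "m \<in> Arr Q" "n \<in> Arr Q" using assms by (auto simp: null_def)
  have "m \<in> ker_hom Q (arrowcat P) (Prj S) (Dom Q m) (Cod Q m)"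
    "n \<in> ker_hom Q (arrowcat P) (Prj S) (Cod Q m) (Cod Q n)"
    using assms m by (auto simp: ker_hom_iff)
  then show ?thesis using pseudo m unfolding pseudo_triangulated_def
    singular_tau_extension_def singular_extension_def by (metis Q.dom_cod_ob)
qed

text \<open>Fullness of \<open>p\<close>, extracted from surjectivity of the isomorphism on quotient
  groups: adding an element of the kernel does not change the projection, so the image of a coset is
  a singleton and \<open>the_elem\<close> is the projection of any representative.\<close>

lemma lift_exists:
  assumes "(f, f', a, b) \<in> Arr (arrowcat P)"
  obtains m where "m \<in> Arr Q" "Dom Q m = ob f" "Cod Q m = ob f'" "pa m = a" "pb m = b"
proof -
  interpret A: translation_category "arrowcat P" by (rule arrowcat_translation)
  note [simp] = assms[simplified]
  let ?X = "ob f" and ?Y = "ob f'"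
  let ?K = "ker_hom Q (arrowcat P) (Prj S) ?X ?Y"
  have "\<forall>X\<in>Ob Q. \<forall>Y\<in>Ob Q. (\<lambda>K. the_elem (FM (Prj S) ` K)) \<in>
      iso (homgrp Q X Y Mod ker_hom Q (arrowcat P) (Prj S) X Y) (homgrp (arrowcat P) (ar X) (ar Y))"
    using structureD(4) by (simp add: quotient_iso_def)
  from bspec[OF bspec[OF this], of ?X ?Y]
  have "(\<lambda>K. the_elem (FM (Prj S) ` K)) \<in> iso (homgrp Q ?X ?Y Mod ?K) (homgrp (arrowcat P) f f')"
    by simp
  then have "Hom (arrowcat P) f f' = (\<lambda>K. the_elem (FM (Prj S) ` K)) ` carrier (homgrp Q ?X ?Y Mod ?K)"
    by (auto simp: iso_def bij_betw_def)
  moreover have "(f, f', a, b) \<in> Hom (arrowcat P) f f'" by (simp add: Hom_def)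
  ultimately obtain K where K: "K \<in> carrier (homgrp Q ?X ?Y Mod ?K)"
    "the_elem (FM (Prj S) ` K) = (f, f', a, b)" by (metis (no_types, lifting) imageE)
  then obtain m where m: "m \<in> Hom Q ?X ?Y" "K = ?K #>\<^bsub>homgrp Q ?X ?Y\<^esub> m"
    by (auto simp: FactGroup_def RCOSETS_def)
  have m': "m \<in> Arr Q" "Dom Q m = ?X" "Cod Q m = ?Y" using m(1) by (auto simp: Hom_def)
  have "FM (Prj S) (Add Q k m) = FM (Prj S) m" if "k \<in> ?K" for k
    using that m' by (auto simp: ker_hom_iff null_def prj_eq)
  moreover have "Zero Q ?X ?Y \<in> ?K" by (simp add: ker_hom_iff null_def)
  moreover have "K = (\<lambda>k. Add Q k m) ` ?K" unfolding m(2) by (auto simp: r_coset_def)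
  ultimately have "FM (Prj S) ` K = {FM (Prj S) m}" by (auto simp: image_image intro!: image_eqI)
  then have "FM (Prj S) m = (f, f', a, b)" using K by simp
  then show thesis using that m' by (simp add: prj_eq)
qed

lemma Inc_iso:
  "X \<in> Ob Q \<Longrightarrow> Y \<in> Ob Q \<Longrightarrow> Inc S X Y \<in> iso (BG (Ups S) (ar X) (ar Y))
     ((homgrp Q X Y)\<lparr>carrier := ker_hom Q (arrowcat P) (Prj S) X Y\<rparr>)"
  using pseudo by (simp add: pseudo_triangulated_def singular_tau_extension_def
      singular_extension_def pull_bifun_def ker_bifun_def)

lemma Inc_props:
  assumes "X \<in> Ob Q" "Y \<in> Ob Q"
  shows "x \<in> carrier (BG (Ups S) (ar X) (ar Y)) \<Longrightarrow>
      null (Inc S X Y x) \<and> Dom Q (Inc S X Y x) = X \<and> Cod Q (Inc S X Y x) = Y"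
    and "\<lbrakk>x \<in> carrier (BG (Ups S) (ar X) (ar Y)); y \<in> carrier (BG (Ups S) (ar X) (ar Y))\<rbrakk>
      \<Longrightarrow> Inc S X Y (x \<otimes>\<^bsub>BG (Ups S) (ar X) (ar Y)\<^esub> y) = Add Q (Inc S X Y x) (Inc S X Y y)"
    and "\<lbrakk>Inc S X Y x = Inc S X Y y; x \<in> carrier (BG (Ups S) (ar X) (ar Y));
      y \<in> carrier (BG (Ups S) (ar X) (ar Y))\<rbrakk> \<Longrightarrow> x = y"
    and "\<lbrakk>null m; Dom Q m = X; Cod Q m = Y\<rbrakk> \<Longrightarrow>
      \<exists>x\<in>carrier (BG (Ups S) (ar X) (ar Y)). m = Inc S X Y x"
    and "Inc S X Y (one (BG (Ups S) (ar X) (ar Y))) = Zero Q X Y"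
proof -
  let ?G = "BG (Ups S) (ar X) (ar Y)"
  have h: "Inc S X Y \<in> hom ?G ((homgrp Q X Y)\<lparr>carrier := ker_hom Q (arrowcat P) (Prj S) X Y\<rparr>)"
    and b: "bij_betw (Inc S X Y) (carrier ?G) (ker_hom Q (arrowcat P) (Prj S) X Y)"
    using Inc_iso[OF assms] by (auto simp: iso_def)
  show 1: "null (Inc S X Y x) \<and> Dom Q (Inc S X Y x) = X \<and> Cod Q (Inc S X Y x) = Y"
    if "x \<in> carrier ?G" for x
    using bij_betwE[OF b] that ker_hom_iff[OF assms] by auto
  show 2: "Inc S X Y (x \<otimes>\<^bsub>?G\<^esub> y) = Add Q (Inc S X Y x) (Inc S X Y y)"
    if "x \<in> carrier ?G" "y \<in> carrier ?G" for x y
    using hom_mult[OF h that] by simp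
  show "x = y" if "Inc S X Y x = Inc S X Y y" "x \<in> carrier ?G" "y \<in> carrier ?G"
    using b that by (auto simp: bij_betw_def inj_on_def)
  show "\<exists>x\<in>carrier ?G. m = Inc S X Y x" if "null m" "Dom Q m = X" "Cod Q m = Y"
    using bij_betw_imp_surj_on[OF b] that ker_hom_iff[OF assms, of m] by auto
  have "comm_group ?G" using structureD(8) assms by (simp add: tau_bifunctor_def bifunctor_def)
  then interpret comm_group ?G .
  have "Add Q (Inc S X Y \<one>\<^bsub>?G\<^esub>) (Inc S X Y \<one>\<^bsub>?G\<^esub>) = Inc S X Y \<one>\<^bsub>?G\<^esub>"
    using 2[of "\<one>\<^bsub>?G\<^esub>" "\<one>\<^bsub>?G\<^esub>"] by simp
  from Q.zero_unique[OF this] 1[of "\<one>\<^bsub>?G\<^esub>"] show "Inc S X Y \<one>\<^bsub>?G\<^esub> = Zero Q X Y"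
    by (simp add: null_def)
qed

lemma null_is_Inc:
  assumes f [simp]: "f \<in> Arr P" "f' \<in> Arr P" and m: "null m" "Dom Q m = ob f" "Cod Q m = ob f'"
  obtains x where "x \<in> carrier (BG (Ups S) f f')" "m = Inc S (ob f) (ob f') x"
proof -
  have "\<exists>x\<in>carrier (BG (Ups S) (ar (ob f)) (ar (ob f'))). m = Inc S (ob f) (ob f') x"
    by (rule Inc_props(4)) (use m in simp_all)
  then show thesis using that unfolding ob_bij(2)[OF f(1)] ob_bij(2)[OF f(2)] by blast
qed

lemma Inc_natural:
  assumes "m \<in> Arr Q" "n \<in> Arr Q" "x \<in> carrier (BG (Ups S) (ar (Cod Q m)) (ar (Dom Q n)))"
  shows "Inc S (Dom Q m) (Cod Q n) (BM (Ups S) (FM (Prj S) m) (FM (Prj S) n) x) =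
    n \<star> Inc S (Cod Q m) (Dom Q n) x \<star> m"
  using structureD(6) assms by (simp add: tau_trans_def bifun_trans_def pull_bifun_def ker_bifun_def)

lemma Inc_sh:
  assumes "X \<in> Ob Q" "Y \<in> Ob Q" "x \<in> carrier (BG (Ups S) (ar X) (ar Y))"
  shows "Inc S (ShO Q X) (ShO Q Y) (BT (Ups S) (ar X) (ar Y) x) = Q.sh (Inc S X Y x)"
  using structureD(6) assms by (simp add: tau_trans_def pull_bifun_def ker_bifun_def)

lemma Phi_hom: "f \<in> Arr P \<Longrightarrow> f' \<in> Arr P \<Longrightarrow> Phi S f f' \<in> hom (BG (Toda P) f f') (BG (Ups S) f f')"
  using structureD(7) by (simp add: tau_trans_def bifun_trans_def)

lemma Phi_iso: "\<lbrakk>f \<in> Arr P; f' \<in> Arr P; splittable P f \<or> splittable P f'\<rbrakk>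
    \<Longrightarrow> Phi S f f' \<in> iso (BG (Toda P) f f') (BG (Ups S) f f')"
  using pseudo unfolding pseudo_triangulated_def by blast

context
  fixes f f' x
  assumes f: "f \<in> Arr P" "f' \<in> Arr P" and x: "x \<in> Arr P" "Dom P x = P.so (Dom P f)" "Cod P x = Cod P f'"
begin

lemma x_Hom: "x \<in> Hom P (P.so (Dom P f)) (Cod P f')" using x by (simp add: Hom_def)

lemma Phi_carrier: "Phi S f f' (toda_class P f f' x) \<in> carrier (BG (Ups S) f f')"
  using hom_in_carrier[OF Phi_hom[OF f] P.toda_class_carrier[OF f x_Hom]] .

lemma null_el: "null (el f f' x)"
  and el_simps: "el f f' x \<in> Arr Q" "Dom Q (el f f' x) = ob f" "Cod Q (el f f' x) = ob f'"
  using Inc_props(1)[of "ob f" "ob f'"] Phi_carrier f by (auto simp: el_def null_def)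

lemma pa_pb_el: "pa (el f f' x) = Zero P (Dom P f) (Dom P f')" "pb (el f f' x) = Zero P (Cod P f) (Cod P f')"
  using null_el f by (auto simp: null_def el_simps)

text \<open>Naturality of \<open>i\<close> and of \<open>\<varphi>\<close>, combined with the action
  on classes in \<open>\<Delta>\<close>. The composition rules for the connecting arrows below are
  special cases.\<close>

lemma el_natural:
  assumes m: "m \<in> Arr Q" "Cod Q m = ob f" and n: "n \<in> Arr Q" "Dom Q n = ob f'"
  shows "n \<star> el f f' x \<star> m = el (ar (Dom Q m)) (ar (Cod Q n)) (pb n \<odot> x \<odot> P.sh (pa m))"
proof -
  have a: "(ar (Dom Q m), f, pa m, pb m) \<in> Arr (arrowcat P)" "(f', ar (Cod Q n), pa n, pb n) \<in> Arr (arrowcat P)"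
    using prj_eq(2)[OF m(1)] prj_eq(2)[OF n(1)] m n f by auto
  have "n \<star> el f f' x \<star> m = Inc S (Dom Q m) (Cod Q n)
      (BM (Ups S) (ar (Dom Q m), f, pa m, pb m) (f', ar (Cod Q n), pa n, pb n) (Phi S f f' (toda_class P f f' x)))"
    using Inc_natural[OF m(1) n(1), of "Phi S f f' (toda_class P f f' x)"] m n f Phi_carrier
    by (simp add: el_def prj_eq)
  also have "BM (Ups S) (ar (Dom Q m), f, pa m, pb m) (f', ar (Cod Q n), pa n, pb n) (Phi S f f' (toda_class P f f' x)) =
    Phi S (ar (Dom Q m)) (ar (Cod Q n)) (BM (Toda P) (ar (Dom Q m), f, pa m, pb m) (f', ar (Cod Q n), pa n, pb n) (toda_class P f f' x))"
  proof -
    have "\<forall>g\<in>Arr (arrowcat P). \<forall>h\<in>Arr (arrowcat P). \<forall>K\<in>carrier (BG (Toda P) (Cod (arrowcat P) g) (Dom (arrowcat P) h)).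
        Phi S (Dom (arrowcat P) g) (Cod (arrowcat P) h) (BM (Toda P) g h K) =
        BM (Ups S) g h (Phi S (Cod (arrowcat P) g) (Dom (arrowcat P) h) K)"
      using structureD(7) by (simp add: tau_trans_def bifun_trans_def)
    from this[rule_format, OF a, of "toda_class P f f' x"] P.toda_class_carrier[OF f x_Hom]
    show ?thesis by simp
  qed
  also have "BM (Toda P) (ar (Dom Q m), f, pa m, pb m) (f', ar (Cod Q n), pa n, pb n) (toda_class P f f' x) =
      toda_class P (ar (Dom Q m)) (ar (Cod Q n)) (pb n \<odot> x \<odot> P.sh (pa m))"
    by (rule P.toda_BM[OF a x_Hom])
  finally show ?thesis using m n by (simp add: el_def)
qed

lemma comp_el:
  assumes "n \<in> Arr Q" "Dom Q n = ob f'"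
  shows "n \<star> el f f' x = el f (ar (Cod Q n)) (pb n \<odot> x)"
  using el_natural[of "Ide Q (ob f)" n] assms f x by (simp add: el_simps)

lemma el_comp:
  assumes "m \<in> Arr Q" "Cod Q m = ob f"
  shows "el f f' x \<star> m = el (ar (Dom Q m)) f' (x \<odot> P.sh (pa m))"
  using el_natural[of m "Ide Q (ob f')"] assms f x by (simp add: el_simps)

lemma el_add:
  assumes y: "y \<in> Arr P" "Dom P y = P.so (Dom P f)" "Cod P y = Cod P f'"
  shows "el f f' (Add P x y) = Add Q (el f f' x) (el f f' y)"
proof -
  have yH: "y \<in> Hom P (P.so (Dom P f)) (Cod P f')" using y by (simp add: Hom_def)
  have c: "toda_class P f f' x \<in> carrier (BG (Toda P) f f')" "toda_class P f f' y \<in> carrier (BG (Toda P) f f')"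
    using P.toda_class_carrier[OF f] x_Hom yH by auto
  have "toda_class P f f' (Add P x y) = toda_class P f f' x \<otimes>\<^bsub>BG (Toda P) f f'\<^esub> toda_class P f f' y"
    using P.toda_class_add[OF f x_Hom yH] by (simp add: Toda_def FactGroup_def)
  then show ?thesis
    using hom_mult[OF Phi_hom[OF f] c] Inc_props(2)[of "ob f" "ob f'"] hom_in_carrier[OF Phi_hom[OF f]] c f
    by (simp add: el_def)
qed

lemma el_sh: "Q.sh (el f f' x) = el (Neg P (P.sh f)) (Neg P (P.sh f')) (P.sh x)"
proof -
  have "Q.sh (el f f' x) = Inc S (ob (Neg P (P.sh f))) (ob (Neg P (P.sh f'))) (BT (Ups S) f f' (Phi S f f' (toda_class P f f' x)))"
    using Inc_sh[of "ob f" "ob f'"] Phi_carrier f by (simp add: el_def)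
  also have "BT (Ups S) f f' (Phi S f f' (toda_class P f f' x)) =
     Phi S (Neg P (P.sh f)) (Neg P (P.sh f')) (BT (Toda P) f f' (toda_class P f f' x))"
    using structureD(7) P.toda_class_carrier[OF f x_Hom] f by (simp add: tau_trans_def)
  also have "BT (Toda P) f f' (toda_class P f f' x) = toda_class P (Neg P (P.sh f)) (Neg P (P.sh f')) (P.sh x)"
    by (rule P.toda_BT[OF f x_Hom])
  finally show ?thesis by (simp add: el_def)
qed

lemma Phi_one: "Phi S f f' (one (BG (Toda P) f f')) = one (BG (Ups S) f f')"
proof -
  have "comm_group (BG (Ups S) f f')" using structureD(8) f by (simp add: tau_bifunctor_def bifunctor_def)
  then have g: "group (BG (Ups S) f f')" by (simp add: comm_group_def)
  interpret comm_group "homgrp P (P.so (Dom P f)) (Cod P f')" using f by (rule P.TG_comm)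
  have "toda_rel P f f' \<lhd> homgrp P (P.so (Dom P f)) (Cod P f')"
    by (rule subgroup_imp_normal[OF P.toda_rel_subgroup[OF f]])
  then have "group (BG (Toda P) f f')" by (simp add: Toda_def normal.factorgroup_is_group)
  from hom_one[OF Phi_hom[OF f] this g] show ?thesis .
qed

lemma el_eq_zeroI:
  assumes "x \<in> toda_rel P f f'" shows "el f f' x = Zero Q (ob f) (ob f')"
  using P.toda_class_one[OF f x_Hom] assms Phi_one Inc_props(5)[of "ob f" "ob f'"] f by (simp add: el_def)

text \<open>\<open>i\<close> is injective, and \<open>\<varphi>\<close> is injective at splittable
  arrows.\<close>

lemma el_eq_zeroD:
  assumes s: "splittable P f \<or> splittable P f'" and z: "el f f' x = Zero Q (ob f) (ob f')"
  shows "x \<in> toda_rel P f f'"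
proof -
  have i: "Phi S f f' \<in> iso (BG (Toda P) f f') (BG (Ups S) f f')"
    using Phi_iso[OF f s] .
  have "comm_group (BG (Ups S) f f')" using structureD(8) f by (simp add: tau_bifunctor_def bifunctor_def)
  then interpret U: comm_group "BG (Ups S) f f'" .
  have "Phi S f f' (toda_class P f f' x) = one (BG (Ups S) f f')"
    using Inc_props(3)[of "ob f" "ob f'"] Inc_props(5)[of "ob f" "ob f'"] Phi_carrier z f by (simp add: el_def)
  then have "Phi S f f' (toda_class P f f' x) = Phi S f f' (one (BG (Toda P) f f'))" using Phi_one by simp
  moreover have "one (BG (Toda P) f f') \<in> carrier (BG (Toda P) f f')"
    using P.toda_class_carrier[OF f, of "Zero P (P.so (Dom P f)) (Cod P f')"]
      P.toda_class_one[OF f, of "Zero P (P.so (Dom P f)) (Cod P f')"]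
      subgroup.one_closed[OF P.toda_rel_subgroup[OF f]] f by (simp add: Hom_def)
  ultimately have "toda_class P f f' x = one (BG (Toda P) f f')"
    using i P.toda_class_carrier[OF f x_Hom] by (auto simp: iso_def bij_betw_def inj_on_def)
  then show ?thesis using P.toda_class_one[OF f x_Hom] by simp
qed

end

text \<open>Surjectivity of \<open>i\<close> and \<open>\<varphi>\<close>: at splittable arrows the
  whole kernel of \<open>p\<close> is described by arrows \<open>A[1] -> B'\<close> of
  \<open>P\<close>.\<close>

lemma null_is_el:
  assumes f: "f \<in> Arr P" "f' \<in> Arr P" "splittable P f \<or> splittable P f'"
    and m: "null m" "Dom Q m = ob f" "Cod Q m = ob f'"
  obtains x where "x \<in> Arr P" "Dom P x = P.so (Dom P f)" "Cod P x = Cod P f'" "m = el f f' x"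
proof -
  have i: "Phi S f f' \<in> iso (BG (Toda P) f f') (BG (Ups S) f f')"
    using Phi_iso[OF f] .
  obtain u where u: "u \<in> carrier (BG (Ups S) f f')" "m = Inc S (ob f) (ob f') u"
    using Inc_props(4)[of "ob f" "ob f'"] m f by auto
  obtain K where K: "K \<in> carrier (BG (Toda P) f f')" "u = Phi S f f' K"
    using i u by (auto simp: iso_def bij_betw_def)
  obtain x where "x \<in> Hom P (P.so (Dom P f)) (Cod P f')" "K = toda_class P f f' x"
    using P.toda_class_surj[OF f(1,2) K(1)] by blast
  then show thesis using that[of x] u K by (auto simp: el_def Hom_def)
qed

lemma el_zero: "\<lbrakk>f \<in> Arr P; f' \<in> Arr P\<rbrakk> \<Longrightarrow>
    el f f' (Zero P (P.so (Dom P f)) (Cod P f')) = Zero Q (ob f) (ob f')"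
  by (rule el_eq_zeroI) (auto simp: subgroup.one_closed[OF P.toda_rel_subgroup, simplified])

lemma el_neg:
  assumes "f \<in> Arr P" "f' \<in> Arr P" "x \<in> Arr P" "Dom P x = P.so (Dom P f)" "Cod P x = Cod P f'"
  shows "el f f' (Neg P x) = Neg Q (el f f' x)"
proof -
  have "Add Q (el f f' (Neg P x)) (el f f' x) = Zero Q (ob f) (ob f')"
    using el_add[OF assms(1,2), of "Neg P x" x] assms P.neg_add_self[of x] by (simp add: el_zero)
  then show ?thesis using assms el_simps by (intro Q.neg_unique) auto
qed

lemma el_sub:
  assumes "f \<in> Arr P" "f' \<in> Arr P" "x \<in> Arr P" "Dom P x = P.so (Dom P f)" "Cod P x = Cod P f'"
    "y \<in> Arr P" "Dom P y = P.so (Dom P f)" "Cod P y = Cod P f'"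
  shows "el f f' (Sub P x y) = Sub Q (el f f' x) (el f f' y)"
  using assms by (simp add: Sub_def el_add el_neg)

text \<open>An arrow with zero source is itself zero, hence splittable, so null arrows out of it
  come from \<open>Hom(0[1],B') = 0\<close>. The zero object is arbitrary because the translate of
  \<open>0 -> Y\<close> starts at \<open>0[1]\<close>.\<close>

lemma null_from_zero:
  assumes m: "null m" and f: "f \<in> Arr P" "zero_object P (Dom P f)" and d: "Dom Q m = ob f"
  shows "m = Zero Q (Dom Q m) (Cod Q m)"
proof -
  have [simp]: "m \<in> Arr Q" using m by (simp add: null_def)
  let ?f' = "ar (Cod Q m)"
  have s: "splittable P f"
    using P.zero_object_arr(1)[OF f(2) f(1) refl] P.splittable_zero[of "Dom P f" "Cod P f"] f by simp
  obtain x where x: "x \<in> Arr P" "Dom P x = P.so (Dom P f)" "Cod P x = Cod P ?f'" "m = el f ?f' x"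
    using null_is_el[of f ?f' m] m d f s by auto
  have "x = Zero P (P.so (Dom P f)) (Cod P ?f')"
    using P.zero_object_arr(1)[OF P.zero_object_so[OF f(2)] x(1)] x by simp
  then show ?thesis using x(4) el_zero[of f ?f'] f d by simp
qed

lemma null_to_zero:
  assumes m: "null m" and f: "f \<in> Arr P" "zero_object P (Cod P f)" and d: "Cod Q m = ob f"
  shows "m = Zero Q (Dom Q m) (Cod Q m)"
proof -
  have [simp]: "m \<in> Arr Q" using m by (simp add: null_def)
  let ?f' = "ar (Dom Q m)"
  have s: "splittable P f"
    using P.zero_object_arr(2)[OF f(2) f(1) refl] P.splittable_zero[of "Dom P f" "Cod P f"] f by simp
  obtain x where x: "x \<in> Arr P" "Dom P x = P.so (Dom P ?f')" "Cod P x = Cod P f" "m = el ?f' f x"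
    using null_is_el[of ?f' f m] m d f s by auto
  have "x = Zero P (P.so (Dom P ?f')) (Cod P f)"
    using P.zero_object_arr(2)[OF f(2) x(1)] x by simp
  then show ?thesis using x(4) el_zero[of ?f' f] f d by simp
qed

lemma eq_from_zero:
  assumes m: "m \<in> Arr Q" "n \<in> Arr Q" "Dom Q n = Dom Q m" "Cod Q n = Cod Q m" "pb m = pb n"
    and f: "f \<in> Arr P" "zero_object P (Dom P f)" "Dom Q m = ob f"
  shows "m = n"
proof -
  have "pa m = pa n" using P.zero_object_arr(1)[OF f(2), of "pa m"] P.zero_object_arr(1)[OF f(2), of "pa n"] m f by simp
  then have "null (Sub Q m n)" using m by (simp add: null_def)
  from null_from_zero[OF this f(1,2)] m f show ?thesis
    by (intro Q.eq_if_sub_zero[of m n "Dom Q m" "Cod Q m"]) simp_all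
qed

lemma eq_to_zero:
  assumes m: "m \<in> Arr Q" "n \<in> Arr Q" "Dom Q n = Dom Q m" "Cod Q n = Cod Q m" "pa m = pa n"
    and f: "f \<in> Arr P" "zero_object P (Cod P f)" "Cod Q m = ob f"
  shows "m = n"
proof -
  have "pb m = pb n" using P.zero_object_arr(2)[OF f(2), of "pb m"] P.zero_object_arr(2)[OF f(2), of "pb n"] m f by simp
  then have "null (Sub Q m n)" using m by (simp add: null_def)
  from null_to_zero[OF this f(1,2)] m f show ?thesis
    by (intro Q.eq_if_sub_zero[of m n "Dom Q m" "Cod Q m"]) simp_all
qed

text \<open>Justifies the definite description in \<open>lift\<close>: if the source arrow starts at
  a zero object or the target arrow ends at one, an arrow of \<open>Ptr\<close> is determined by its
  projection.\<close>

lemma lift_eq: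
  assumes "m \<in> Arr Q" "Dom Q m = ob f" "Cod Q m = ob f'" "pa m = a" "pb m = b"
    and f: "f \<in> Arr P" "f' \<in> Arr P" "zero_object P (Dom P f) \<or> zero_object P (Cod P f')"
  shows "lift S f f' a b = m"
  unfolding lift_def
proof (rule the_equality)
  show "m \<in> Hom Q (ob f) (ob f') \<and> FM (Prj S) m = (f, f', a, b)" using assms by (simp add: Hom_def prj_eq)
  fix n assume n: "n \<in> Hom Q (ob f) (ob f') \<and> FM (Prj S) n = (f, f', a, b)"
  then have n': "n \<in> Arr Q" "Dom Q n = ob f" "Cod Q n = ob f'" by (auto simp: Hom_def)
  have "pa n = a" "pb n = b" using n n' by (auto simp: prj_eq)
  from f(3) show "n = m"
  proof
    assume "zero_object P (Dom P f)"
    then show ?thesis by (intro eq_from_zero[of n m f]) (use n' \<open>pb n = b\<close> assms in simp_all)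
  next
    assume "zero_object P (Cod P f')"
    then show ?thesis by (intro eq_to_zero[of n m f']) (use n' \<open>pa n = a\<close> assms in simp_all)
  qed
qed

lemma lift_props_from:
  assumes f: "f \<in> Arr P" "f' \<in> Arr P" "zero_object P (Dom P f)" "b \<in> Arr P" "Dom P b = Cod P f" "Cod P b = Cod P f'"
    "a \<in> Arr P" "Dom P a = Dom P f" "Cod P a = Dom P f'"
  shows "lift S f f' a b \<in> Arr Q \<and> Dom Q (lift S f f' a b) = ob f \<and>
    Cod Q (lift S f f' a b) = ob f' \<and> pa (lift S f f' a b) = a \<and> pb (lift S f f' a b) = b"
proof -
  have "b \<odot> f = f' \<odot> a"
    using P.zero_object_arr(1)[OF f(3), of "b \<odot> f"] P.zero_object_arr(1)[OF f(3), of "f' \<odot> a"] f by simp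
  then obtain m where "m \<in> Arr Q" "Dom Q m = ob f" "Cod Q m = ob f'" "pa m = a" "pb m = b"
    using lift_exists[of f f' a b] f by auto
  then show ?thesis using lift_eq[of m f f' a b] f by simp
qed

lemma lift_props_to:
  assumes f: "f \<in> Arr P" "f' \<in> Arr P" "zero_object P (Cod P f')" "b \<in> Arr P" "Dom P b = Cod P f" "Cod P b = Cod P f'"
    "a \<in> Arr P" "Dom P a = Dom P f" "Cod P a = Dom P f'"
  shows "lift S f f' a b \<in> Arr Q \<and> Dom Q (lift S f f' a b) = ob f \<and>
    Cod Q (lift S f f' a b) = ob f' \<and> pa (lift S f f' a b) = a \<and> pb (lift S f f' a b) = b"
proof -
  have "b \<odot> f = f' \<odot> a"
    using P.zero_object_arr(2)[OF f(3), of "b \<odot> f"] P.zero_object_arr(2)[OF f(3), of "f' \<odot> a"] f by simp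
  then obtain m where "m \<in> Arr Q" "Dom Q m = ob f" "Cod Q m = ob f'" "pa m = a" "pb m = b"
    using lift_exists[of f f' a b] f by auto
  then show ?thesis using lift_eq[of m f f' a b] f by simp
qed

section \<open>The two embeddings of \<open>P\<close> in \<open>Ptr\<close> and the canonical
  sequence\<close>

abbreviation "bo X \<equiv> ob (bang P X)"
abbreviation "co X \<equiv> ob (cobang P X)"
abbreviation "bm g \<equiv> FM (Bang P S) g"
abbreviation "cm g \<equiv> FM (Cobang P S) g"
abbreviation "ci \<equiv> can_i P S"
abbreviation "ck \<equiv> can_k P S"
abbreviation "cj \<equiv> can_j P S"
abbreviation "cn \<equiv> conn P S"

lemma Bang_FO [simp]: "FO (Bang P S) X = bo X" "FO (Cobang P S) X = co X"
  by (auto simp: Bang_def Cobang_def)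

lemma bm_simps [simp]:
  assumes "g \<in> Arr P"
  shows "bm g \<in> Arr Q" "Dom Q (bm g) = bo (Dom P g)" "Cod Q (bm g) = bo (Cod P g)"
    "pa (bm g) = Ide P (zob P)" "pb (bm g) = g"
  using lift_props_from[of "bang P (Dom P g)" "bang P (Cod P g)" g "Ide P (zob P)"] assms P.zob
  by (auto simp: Bang_def)

lemma cm_simps [simp]:
  assumes "g \<in> Arr P"
  shows "cm g \<in> Arr Q" "Dom Q (cm g) = co (Dom P g)" "Cod Q (cm g) = co (Cod P g)"
    "pb (cm g) = Ide P (zob P)" "pa (cm g) = g"
  using lift_props_to[of "cobang P (Dom P g)" "cobang P (Cod P g)" "Ide P (zob P)" g] assms P.zob
  by (auto simp: Cobang_def)

lemma ci_simps [simp]: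
  assumes "f \<in> Arr P"
  shows "ci f \<in> Arr Q" "Dom Q (ci f) = bo (Cod P f)" "Cod Q (ci f) = ob f"
    "pa (ci f) = Zero P (zob P) (Dom P f)" "pb (ci f) = Ide P (Cod P f)"
  using lift_props_from[of "bang P (Cod P f)" f "Ide P (Cod P f)" "Zero P (zob P) (Dom P f)"] assms P.zob
  by (auto simp: can_i_def)

lemma ck_simps [simp]:
  assumes "f \<in> Arr P"
  shows "ck f \<in> Arr Q" "Dom Q (ck f) = ob f" "Cod Q (ck f) = co (Dom P f)"
    "pb (ck f) = Zero P (Cod P f) (zob P)" "pa (ck f) = Ide P (Dom P f)"
  using lift_props_to[of f "cobang P (Dom P f)" "Zero P (Cod P f) (zob P)" "Ide P (Dom P f)"] assms P.zob
  by (auto simp: can_k_def)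

lemma eq_from_bang:
  assumes "Dom Q m = bo X" "m \<in> Arr Q" "n \<in> Arr Q" "Dom Q n = Dom Q m" "Cod Q n = Cod Q m" "pb m = pb n" "X \<in> Ob P"
  shows "m = n"
  by (rule eq_from_zero[of m n "bang P X"]) (use assms P.zob in simp_all)

lemma eq_to_cobang:
  assumes "Cod Q m = co X" "m \<in> Arr Q" "n \<in> Arr Q" "Dom Q n = Dom Q m" "Cod Q n = Cod Q m" "pa m = pa n" "X \<in> Ob P"
  shows "m = n"
  by (rule eq_to_zero[of m n "cobang P X"]) (use assms P.zob in simp_all)

lemma bm_comp [simp]: "\<lbrakk>f \<in> Arr P; g \<in> Arr P; Dom P g = Cod P f\<rbrakk> \<Longrightarrow> bm (g \<odot> f) = bm g \<star> bm f"
  by (rule eq_from_bang, simp) simp_all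

lemma bm_ide [simp]: "X \<in> Ob P \<Longrightarrow> bm (Ide P X) = Ide Q (bo X)"
  by (rule eq_from_bang, simp) simp_all

lemma bm_add: "\<lbrakk>f \<in> Arr P; g \<in> Arr P; Dom P g = Dom P f; Cod P g = Cod P f\<rbrakk>
    \<Longrightarrow> bm (Add P f g) = Add Q (bm f) (bm g)"
  by (rule eq_from_bang, simp) simp_all

lemma bm_zero [simp]: "X \<in> Ob P \<Longrightarrow> Y \<in> Ob P \<Longrightarrow> bm (Zero P X Y) = Zero Q (bo X) (bo Y)"
  by (rule eq_from_bang, simp) simp_all

lemma bm_inj: "\<lbrakk>bm f = bm g; f \<in> Arr P; g \<in> Arr P\<rbrakk> \<Longrightarrow> f = g"
  using bm_simps(5) by metis

lemma cm_comp [simp]: "\<lbrakk>f \<in> Arr P; g \<in> Arr P; Dom P g = Cod P f\<rbrakk> \<Longrightarrow> cm (g \<odot> f) = cm g \<star> cm f"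
  by (rule eq_to_cobang, simp) simp_all

lemma cm_ide [simp]: "X \<in> Ob P \<Longrightarrow> cm (Ide P X) = Ide Q (co X)"
  by (rule eq_to_cobang, simp) simp_all

lemma Bang_ftor: "is_ftor P Q (Bang P S)" "is_ftor P Q (Cobang P S)"
  by (auto simp: is_ftor_def Hom_def)

lemma to_cobang:
  assumes "m \<in> Arr Q" "Cod Q m = co X" "X \<in> Ob P" "Dom Q m = ob f" "f \<in> Arr P"
  shows "m = cm (pa m) \<star> ck f"
  by (rule eq_to_cobang[OF assms(2)]) (use assms in simp_all)

lemma ck_natural:
  assumes "m \<in> Arr Q" "Dom Q m = ob f" "Cod Q m = ob f'" "f \<in> Arr P" "f' \<in> Arr P"
  shows "ck f' \<star> m = cm (pa m) \<star> ck f"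
  using to_cobang[of "ck f' \<star> m" "Dom P f'" f] assms by simp

lemma ci_bang: "X \<in> Ob P \<Longrightarrow> ci (bang P X) = Ide Q (bo X)"
  by (rule eq_from_bang, simp) simp_all

lemma ck_cobang: "X \<in> Ob P \<Longrightarrow> ck (cobang P X) = Ide Q (co X)"
  by (rule eq_to_cobang, simp) simp_all

lemma cn_el: "cn A B x = el (cobang P A) (bang P B) x"
  by (simp add: conn_def el_def)

lemma cn_simps [simp]:
  assumes "A \<in> Ob P" "B \<in> Ob P" "x \<in> Arr P" "Dom P x = P.so A" "Cod P x = B"
  shows "cn A B x \<in> Arr Q" "Dom Q (cn A B x) = co A" "Cod Q (cn A B x) = bo B"
    "pa (cn A B x) = Zero P A (zob P)" "pb (cn A B x) = Zero P (zob P) B"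
  using el_simps[of "cobang P A" "bang P B" x] pa_pb_el[of "cobang P A" "bang P B" x] assms
  by (simp_all add: cn_el)

lemma bm_cn:
  assumes "A \<in> Ob P" "x \<in> Arr P" "Dom P x = P.so A" "y \<in> Arr P" "Dom P y = Cod P x"
  shows "bm y \<star> cn A (Cod P x) x = cn A (Cod P y) (y \<odot> x)"
  using comp_el[of "cobang P A" "bang P (Cod P x)" x "bm y"] assms by (simp add: cn_el)

lemma cn_cm:
  assumes "x \<in> Arr P" "Dom P x = P.so (Cod P a)" "a \<in> Arr P"
  shows "cn (Cod P a) (Cod P x) x \<star> cm a = cn (Dom P a) (Cod P x) (x \<odot> P.sh a)"
  using el_comp[of "cobang P (Cod P a)" "bang P (Cod P x)" x "cm a"] assms by (simp add: cn_el)

text \<open>Naturality along \<open>k_f\<close> and \<open>i_f'\<close>, whose components entering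
  the formula are identities.\<close>

lemma el_factor:
  assumes "f \<in> Arr P" "f' \<in> Arr P" "x \<in> Arr P" "Dom P x = P.so (Dom P f)" "Cod P x = Cod P f'"
  shows "el f f' x = ci f' \<star> cn (Dom P f) (Cod P f') x \<star> ck f"
  using el_natural[of "cobang P (Dom P f)" "bang P (Cod P f')" x "ck f" "ci f'"] assms by (simp add: cn_el)

lemma cn_inj:
  assumes "cn A B x = cn A B y" "A \<in> Ob P" "B \<in> Ob P" "x \<in> Arr P" "Dom P x = P.so A" "Cod P x = B"
    "y \<in> Arr P" "Dom P y = P.so A" "Cod P y = B"
  shows "x = y"
proof -
  have "el (cobang P A) (bang P B) (Sub P x y) = Zero Q (co A) (bo B)"
    using assms el_simps[of "cobang P A" "bang P B" y] by (simp add: el_sub cn_el)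
  then have "Sub P x y \<in> toda_rel P (cobang P A) (bang P B)"
    by (intro el_eq_zeroD) (use assms in \<open>simp_all add: P.splittable_bang\<close>)
  then obtain g h where gh: "Sub P x y = Sub P (bang P B \<odot> g) (h \<odot> P.sh (cobang P A))"
    "g \<in> Arr P" "Dom P g = P.so A" "Cod P g = zob P" "h \<in> Arr P" "Dom P h = P.so (zob P)" "Cod P h = B"
    using assms by (auto simp: P.toda_rel_iff)
  \<comment> \<open>Both summands of the indeterminacy pass through a zero object, so a class of
    \<open>\<Delta>(A \<rightarrow> 0, 0 \<rightarrow> B)\<close> has a single
    representative.\<close>
  then have "Sub P x y = Zero P (P.so A) B" using assms
    by (simp add: bang_def cobang_def)
  then show ?thesis by (rule P.eq_if_sub_zero) (use assms in simp_all)
qed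

lemma cn_surj:
  assumes m: "m \<in> Arr Q" "Dom Q m = co A" "Cod Q m = bo B" "A \<in> Ob P" "B \<in> Ob P"
  obtains x where "x \<in> Arr P" "Dom P x = P.so A" "Cod P x = B" "m = cn A B x"
proof -
  have "null m" using m P.arr_to_zob[of "pa m" A] P.arr_to_zob[of "pb m" B] by (simp add: null_def)
  then show thesis
    using null_is_el[of "cobang P A" "bang P B" m] m that by (auto simp: P.splittable_bang cn_el)
qed

lemma cj_eq: "f \<in> Arr P \<Longrightarrow> cj f = cn (Dom P f) (P.so (Dom P f)) (Ide P (P.so (Dom P f))) \<star> ck f"
  by (simp add: can_j_def)

lemma cj_simps [simp]:
  assumes "f \<in> Arr P"
  shows "cj f \<in> Arr Q" "Dom Q (cj f) = ob f" "Cod Q (cj f) = bo (P.so (Dom P f))"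
  using assms by (simp_all add: cj_eq)

text \<open>For target \<open>0 -> Y\<close> the factor \<open>i\<close> is an identity. Together
  with \<open>null_is_el\<close> this identifies the null arrows from \<open>[f]\<close> to
  \<open>!_Y\<close> with the composites of \<open>j_f\<close> and arrows \<open>!_y\<close>; it is
  the source of exactness at the cone.\<close>

lemma bm_cj:
  assumes "f \<in> Arr P" "y \<in> Arr P" "Dom P y = P.so (Dom P f)"
  shows "bm y \<star> cj f = el f (bang P (Cod P y)) y"
  using comp_el[of f "bang P (P.so (Dom P f))" "Ide P (P.so (Dom P f))" "bm y"] assms
  by (simp add: cj_eq el_factor ci_bang)

lemma cj_natural:
  assumes m: "m \<in> Arr Q" "Dom Q m = ob f" "Cod Q m = ob f'" "f \<in> Arr P" "f' \<in> Arr P"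
  shows "cj f' \<star> m = bm (P.sh (pa m)) \<star> cj f"
proof -
  let ?A = "Dom P f" and ?A' = "Dom P f'"
  have "cj f' \<star> m = (cn ?A' (P.so ?A') (Ide P (P.so ?A')) \<star> cm (pa m)) \<star> ck f"
    using m ck_natural[OF m] by (simp add: cj_eq Q.assoc)
  also have "cn ?A' (P.so ?A') (Ide P (P.so ?A')) \<star> cm (pa m) = bm (P.sh (pa m)) \<star> cn ?A (P.so ?A) (Ide P (P.so ?A))"
    using cn_cm[of "Ide P (P.so ?A')" "pa m"] bm_cn[of ?A "Ide P (P.so ?A)" "P.sh (pa m)"] m by simp
  finally show ?thesis using m by (simp add: cj_eq Q.assoc)
qed

text \<open>\<open>f[1] = 0 - (-id) f[1]\<close> lies in the indeterminacy of
  \<open>\<Delta>(f, 0 \<rightarrow> B[1])\<close>.\<close>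

lemma sh_comp_cj:
  assumes "f \<in> Arr P"
  shows "bm (P.sh f) \<star> cj f = Zero Q (ob f) (bo (P.so (Cod P f)))"
proof -
  have "P.sh f \<in> toda_rel P f (bang P (P.so (Cod P f)))"
    unfolding P.toda_rel_iff using assms
    by (intro exI[of _ "Zero P (P.so (Dom P f)) (zob P)"] exI[of _ "Neg P (Ide P (P.so (Cod P f)))"])
      (simp add: P.comp_neg)
  then show ?thesis using assms el_eq_zeroI[of f "bang P (P.so (Cod P f))" "P.sh f"]
    by (simp add: bm_cj)
qed

section \<open>Massey products\<close>

text \<open>Separates the choice of lifts from the choice of a class: \<open>y\<close> is a
  representative that some pair of lifts realizes on the nose, including the sign of the
  normalization.\<close>

definition massey_rep :: "'m \<Rightarrow> 'm \<Rightarrow> 'm \<Rightarrow> 'm \<Rightarrow> bool" where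
  "massey_rep h g f y \<longleftrightarrow> (\<exists>x w.
     x \<in> Arr Q \<and> Dom Q x = co (Dom P f) \<and> Cod Q x = ob g \<and> pa x = f \<and> pb x = Zero P (zob P) (Cod P g) \<and>
     w \<in> Arr Q \<and> Dom Q w = ob g \<and> Cod Q w = bo (Cod P h) \<and> pa w = Zero P (Dom P g) (zob P) \<and> pb w = h \<and>
     y \<in> Arr P \<and> Dom P y = P.so (Dom P f) \<and> Cod P y = Cod P h \<and>
     w \<star> x = cn (Dom P f) (Cod P h) (Neg P y))"

context
  fixes f g h
  assumes fgh [simp]: "f \<in> Arr P" "g \<in> Arr P" "h \<in> Arr P" "Dom P g = Cod P f" "Dom P h = Cod P g"
begin

lemma massey_unfold:
  "massey P S h g f = (THE K. \<exists>y. massey_rep h g f y \<and> K = toda_class P f h y)"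
proof -
  have hom: "m \<in> Hom Q (ob k) (ob k') \<and> FM (Prj S) m = (k, k', a, b) \<and> R \<longleftrightarrow>
      m \<in> Arr Q \<and> Dom Q m = ob k \<and> Cod Q m = ob k' \<and> pa m = a \<and> pb m = b \<and> R"
    if "k \<in> Arr P" "k' \<in> Arr P" for m k k' a b R
    using that by (auto simp: Hom_def prj_eq)
  have "(\<exists>x w y. x \<in> Hom Q (pob S (cobang P (Dom P f))) (pob S g) \<and>
     FM (Prj S) x = (cobang P (Dom P f), g, f, Zero P (zob P) (Cod P g)) \<and>
     w \<in> Hom Q (pob S g) (pob S (bang P (Cod P h))) \<and>
     FM (Prj S) w = (g, bang P (Cod P h), Zero P (Dom P g) (zob P), h) \<and>
     y \<in> Hom P (ShO P (Dom P f)) (Cod P h) \<and>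
     w \<star> x = conn P S (Dom P f) (Cod P h) (Neg P y) \<and>
     K = massey_class P h g f y) \<longleftrightarrow> (\<exists>y. massey_rep h g f y \<and> K = toda_class P f h y)" for K
    unfolding massey_rep_def P.massey_class_eq_toda_class[OF fgh(1,3)]
    by (subst hom, simp, simp, subst hom, simp, simp) (unfold Hom_def mem_Collect_eq, blast)
  then show ?thesis unfolding massey_def by simp
qed

lemma massey_rep_exists:
  assumes "g \<odot> f = Zero P (Dom P f) (Cod P g)" "h \<odot> g = Zero P (Dom P g) (Cod P h)"
  obtains y where "massey_rep h g f y"
proof -
  obtain x where x: "x \<in> Arr Q" "Dom Q x = co (Dom P f)" "Cod Q x = ob g" "pa x = f" "pb x = Zero P (zob P) (Cod P g)"
    using lift_exists[of "cobang P (Dom P f)" g f "Zero P (zob P) (Cod P g)"] assms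
    by (auto simp: cobang_def)
  obtain w where w: "w \<in> Arr Q" "Dom Q w = ob g" "Cod Q w = bo (Cod P h)" "pa w = Zero P (Dom P g) (zob P)" "pb w = h"
    using lift_exists[of g "bang P (Cod P h)" "Zero P (Dom P g) (zob P)" h] assms
    by (auto simp: bang_def)
  obtain z where z: "z \<in> Arr P" "Dom P z = P.so (Dom P f)" "Cod P z = Cod P h" "w \<star> x = cn (Dom P f) (Cod P h) z"
    using cn_surj[of "w \<star> x" "Dom P f" "Cod P h"] x w by auto
  show thesis
    by (rule that[of "Neg P z"], unfold massey_rep_def, rule exI[of _ x], rule exI[of _ w]) (use x w z in simp)
qed

text \<open>Two choices of lifts differ by null arrows. Expanding the composite, the product of both
  differences vanishes because the kernel is square zero, and the mixed terms are \<open>h s\<close>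
  and \<open>t f[1]\<close>.\<close>

lemma massey_rep_unique:
  assumes "massey_rep h g f y" "massey_rep h g f y'"
  shows "toda_class P f h y' = toda_class P f h y"
proof -
  let ?X = "Dom P f" and ?W = "Cod P h"
  obtain x w where [simp]: "x \<in> Arr Q" "Dom Q x = co ?X" "Cod Q x = ob g" "pa x = f" "pb x = Zero P (zob P) (Cod P g)"
     "w \<in> Arr Q" "Dom Q w = ob g" "Cod Q w = bo ?W" "pa w = Zero P (Dom P g) (zob P)" "pb w = h"
     "y \<in> Arr P" "Dom P y = P.so ?X" "Cod P y = ?W" and wx: "w \<star> x = cn ?X ?W (Neg P y)"
    using assms(1) unfolding massey_rep_def by blast
  obtain x' w' where [simp]: "x' \<in> Arr Q" "Dom Q x' = co ?X" "Cod Q x' = ob g" "pa x' = f" "pb x' = Zero P (zob P) (Cod P g)"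
     "w' \<in> Arr Q" "Dom Q w' = ob g" "Cod Q w' = bo ?W" "pa w' = Zero P (Dom P g) (zob P)" "pb w' = h"
     "y' \<in> Arr P" "Dom P y' = P.so ?X" "Cod P y' = ?W" and wx': "w' \<star> x' = cn ?X ?W (Neg P y')"
    using assms(2) unfolding massey_rep_def by blast
  have nd: "null (Sub Q x' x)" and ne: "null (Sub Q w' w)" by (simp_all add: null_def)
  obtain s where s [simp]: "s \<in> Arr P" "Dom P s = P.so ?X" "Cod P s = Cod P g" and ds: "Sub Q x' x = el (cobang P ?X) g s"
    using null_is_el[of "cobang P ?X" g "Sub Q x' x"] nd by (auto simp: P.splittable_bang)
  obtain t where t [simp]: "t \<in> Arr P" "Dom P t = P.so (Cod P f)" "Cod P t = ?W" and et: "Sub Q w' w = el g (bang P ?W) t"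
    using null_is_el[of g "bang P ?W" "Sub Q w' w"] ne by (auto simp: P.splittable_bang)
  have wd: "w \<star> Sub Q x' x = cn ?X ?W (h \<odot> s)"
    using comp_el[of "cobang P ?X" g s w] by (simp add: ds cn_el)
  have ex: "Sub Q w' w \<star> x = cn ?X ?W (t \<odot> P.sh f)"
    using el_comp[of g "bang P ?W" t x] by (simp add: et cn_el)
  have ed: "Sub Q w' w \<star> Sub Q x' x = Zero Q (co ?X) (bo ?W)"
    using null_comp_null[OF nd ne] by simp
  have "w' \<star> x' = Add Q w (Sub Q w' w) \<star> Add Q x (Sub Q x' x)" by simp
  also have "\<dots> = Add Q (Add Q (w \<star> x) (Sub Q w' w \<star> x)) (Add Q (w \<star> Sub Q x' x) (Sub Q w' w \<star> Sub Q x' x))"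
    by (simp only: Q.comp_add Q.add_simps Q.sub_simps Q.comp_simps \<open>x \<in> Arr Q\<close> \<open>w \<in> Arr Q\<close> \<open>x' \<in> Arr Q\<close> \<open>w' \<in> Arr Q\<close>
      \<open>Dom Q x = co ?X\<close> \<open>Dom Q x' = co ?X\<close> \<open>Cod Q x = ob g\<close> \<open>Cod Q x' = ob g\<close>
      \<open>Dom Q w = ob g\<close> \<open>Dom Q w' = ob g\<close> \<open>Cod Q w = bo ?W\<close> \<open>Cod Q w' = bo ?W\<close>)
  also have "\<dots> = Add Q (Add Q (cn ?X ?W (Neg P y)) (cn ?X ?W (t \<odot> P.sh f))) (cn ?X ?W (h \<odot> s))"
    unfolding wx wd ex ed by simp
  also have "\<dots> = cn ?X ?W (Add P (Add P (Neg P y) (t \<odot> P.sh f)) (h \<odot> s))"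
    by (simp add: el_add cn_el)
  finally have "Neg P y' = Add P (Add P (Neg P y) (t \<odot> P.sh f)) (h \<odot> s)"
    unfolding wx' by (rule cn_inj) simp_all
  then have "Neg P (Neg P y') = Neg P (Add P (Add P (Neg P y) (t \<odot> P.sh f)) (h \<odot> s))" by (rule arg_cong)
  then have "y' = Add P (Sub P (h \<odot> Neg P s) (t \<odot> P.sh f)) y"
    by (simp add: P.neg_add P.comp_neg Sub_def P.add_ac)
  moreover have "Sub P (h \<odot> Neg P s) (t \<odot> P.sh f) \<in> toda_rel P f h" unfolding P.toda_rel_iff
    by (rule exI[of _ "Neg P s"], rule exI[of _ t]) simp
  ultimately have "y' \<in> toda_class P f h y" by (auto simp: P.toda_class_mem)
  then show ?thesis by (intro P.toda_class_eqI) (auto simp: Hom_def)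
qed

lemma massey_eq: "massey_rep h g f y \<Longrightarrow> massey P S h g f = toda_class P f h y"
  unfolding massey_unfold by (rule the_equality) (use massey_rep_unique in blast)+

text \<open>Equality of classes is not enough for the construction of the triangulation, which needs
  lifts whose composite is given exactly by \<open>-id\<close>. Changing the lifts by null arrows
  reaches every element of the class.\<close>

lemma massey_rep_shift:
  assumes "massey_rep h g f y" "y' \<in> toda_class P f h y"
  shows "massey_rep h g f y'"
proof -
  let ?X = "Dom P f" and ?W = "Cod P h"
  obtain x w where [simp]: "x \<in> Arr Q" "Dom Q x = co ?X" "Cod Q x = ob g" "pa x = f" "pb x = Zero P (zob P) (Cod P g)"
     "w \<in> Arr Q" "Dom Q w = ob g" "Cod Q w = bo ?W" "pa w = Zero P (Dom P g) (zob P)" "pb w = h"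
     "y \<in> Arr P" "Dom P y = P.so ?X" "Cod P y = ?W" and wx: "w \<star> x = cn ?X ?W (Neg P y)"
    using assms(1) unfolding massey_rep_def by blast
  obtain r where r: "r \<in> toda_rel P f h" "y' = Add P r y" using assms(2) P.toda_class_mem[of f h y' y] by auto
  then obtain s t where yy: "y' = Add P (Sub P (h \<odot> s) (t \<odot> P.sh f)) y"
    and [simp]: "s \<in> Arr P" "Dom P s = P.so ?X" "Cod P s = Dom P h" "t \<in> Arr P" "Dom P t = P.so (Cod P f)" "Cod P t = Cod P h"
    unfolding P.toda_rel_iff by blast
  \<comment> \<open>The composite represents \<open>-y\<close>, so it must change by
    \<open>-(h s - t f[1])\<close>: therefore \<open>-s\<close> is used for \<open>x\<close> and
    \<open>t\<close> for \<open>w\<close>.\<close>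
  define d e where "d = el (cobang P ?X) g (Neg P s)" and "e = el g (bang P ?W) t"
  have d [simp]: "d \<in> Arr Q" "Dom Q d = co ?X" "Cod Q d = ob g" "pa d = Zero P ?X (Dom P g)" "pb d = Zero P (zob P) (Cod P g)"
    and e [simp]: "e \<in> Arr Q" "Dom Q e = ob g" "Cod Q e = bo ?W" "pa e = Zero P (Dom P g) (zob P)" "pb e = Zero P (Cod P g) ?W"
    using el_simps[of "cobang P ?X" g "Neg P s"] pa_pb_el[of "cobang P ?X" g "Neg P s"]
      el_simps[of g "bang P ?W" t] pa_pb_el[of g "bang P ?W" t] by (simp_all add: d_def e_def)
  have wd: "w \<star> d = cn ?X ?W (h \<odot> Neg P s)"
    using comp_el[of "cobang P ?X" g "Neg P s" w] by (simp add: d_def cn_el)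
  have ex: "e \<star> x = cn ?X ?W (t \<odot> P.sh f)"
    using el_comp[of g "bang P ?W" t x] by (simp add: e_def cn_el)
  have ed: "e \<star> d = Zero Q (co ?X) (bo ?W)"
    using null_comp_null[of d e] by (simp add: null_def)
  have "Add Q w e \<star> Add Q x d = Add Q (Add Q (w \<star> x) (e \<star> x)) (Add Q (w \<star> d) (e \<star> d))"
    by (simp add: Q.comp_add)
  also have "\<dots> = cn ?X ?W (Add P (Add P (Neg P y) (t \<odot> P.sh f)) (h \<odot> Neg P s))"
    unfolding wx wd ex ed by (simp add: el_add cn_el el_simps)
  also have "Add P (Add P (Neg P y) (t \<odot> P.sh f)) (h \<odot> Neg P s) = Neg P y'"
    by (simp add: yy P.neg_add P.comp_neg Sub_def P.add_ac)
  finally have 1: "Add Q w e \<star> Add Q x d = cn ?X ?W (Neg P y')" .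
  have "y' \<in> Arr P" "Dom P y' = P.so ?X" "Cod P y' = ?W" by (simp_all add: yy)
  then show ?thesis unfolding massey_rep_def using 1
    by (intro exI[of _ "Add Q x d"] exI[of _ "Add Q w e"]) simp
qed

end

end

section \<open>From a triangulation to the adjunctions\<close>

text \<open>The domination unfolded for \<open>Triangles0\<close>. As \<open>j\<close> is compatible
  with the projections, only its third component is new information.\<close>

locale dominating_triangulation =
  pseudo_triangulated_category P S + T: triangulated_category P \<D>
  for P :: "('o, 'm) tcat" and S :: "('m, 'p, 'n, 'u) pstruct" and \<D> +
  fixes u v k :: "'m \<Rightarrow> 'm" and \<xi> :: "'m \<Rightarrow> 'm \<Rightarrow> 'u \<Rightarrow> 'm" and j :: "('p, 'n, 'm, 'm tm) ftor"
  assumes choice: "triangle_choice P \<D> u v k"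
    and xi_iso: "\<lbrakk>f \<in> Arr P; f' \<in> Arr P; split_arrow P f \<or> split_arrow P f'\<rbrakk> \<Longrightarrow>
        \<xi> f f' \<in> iso (BG (Ups S) f f') (BG (Theta P u v k) f f')"
    and xi_Phi: "\<lbrakk>f \<in> Arr P; f' \<in> Arr P; K \<in> carrier (BG (Toda P) f f')\<rbrakk> \<Longrightarrow>
        the_elem ((\<lambda>x. u f' \<cdot>\<^bsub>P\<^esub> x \<cdot>\<^bsub>P\<^esub> v f) ` K) = \<xi> f f' (Phi S f f' K)"
    and j_tau: "tau_ftor (Ptr S) (tri_cat P u v k) j"
    and j_ob: "X \<in> Ob (Ptr S) \<Longrightarrow> FO j X = FO (Prj S) X"
    and j_prj: "m \<in> Arr (Ptr S) \<Longrightarrow> (case FM j m of (f, f', a, b, c) \<Rightarrow> (f, f', a, b)) = FM (Prj S) m"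
    and j_Inc: "\<lbrakk>X \<in> Ob (Ptr S); Y \<in> Ob (Ptr S); x \<in> carrier (BG (Ups S) (FO (Prj S) X) (FO (Prj S) Y))\<rbrakk> \<Longrightarrow>
        FM j (Inc S X Y x) = (FO j X, FO j Y, Zero P (Dom P (FO j X)) (Dom P (FO j Y)),
          Zero P (Cod P (FO j X)) (Cod P (FO j Y)), \<xi> (FO (Prj S) X) (FO (Prj S) Y) x)"
begin

definition jc :: "'n \<Rightarrow> 'm" where "jc m = snd (snd (snd (snd (FM j m))))"

abbreviation "cone f \<equiv> Cod P (u f)"

lemma chosen: "f \<in> Arr P \<Longrightarrow> (f, u f, v f) \<in> \<D>"
  using choice by (simp add: triangle_choice_def)

lemma uv_simps [simp]:
  assumes "f \<in> Arr P"
  shows "u f \<in> Arr P" "Dom P (u f) = Cod P f" "v f \<in> Arr P" "Dom P (v f) = cone f"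
    "Cod P (v f) = P.so (Dom P f)"
  using T.distinguishedD[OF chosen[OF assms]] by auto

lemma uv_zero [simp]:
  assumes "f \<in> Arr P"
  shows "u f \<odot> f = Zero P (Dom P f) (cone f)" "v f \<odot> u f = Zero P (Cod P f) (P.so (Dom P f))"
    "P.sh f \<odot> v f = Zero P (cone f) (P.so (Cod P f))"
  using T.composite_zero[OF chosen[OF assms]] T.composite_zero'[OF chosen[OF assms]] assms by auto

lemma j_eq: "m \<in> Arr Q \<Longrightarrow> FM j m = (ar (Dom Q m), ar (Cod Q m), pa m, pb m, jc m)"
  using j_prj[of m] prj_eq(1)[of m] by (cases "FM j m") (auto simp: jc_def)

lemma j_ftor: "is_ftor Q (tri_cat P u v k) j"
  using j_tau by (simp add: tau_ftor_def additive_ftor_def)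

lemma jc_triangle_map:
  assumes "m \<in> Arr Q"
  shows "triangle_map P (ar (Dom Q m), u (ar (Dom Q m)), v (ar (Dom Q m)))
    (ar (Cod Q m), u (ar (Cod Q m)), v (ar (Cod Q m))) (pa m) (pb m) (jc m)"
  using Q.ftorD(2)[OF j_ftor assms] assms by (simp add: j_eq tri_cat_def)

lemma jc_simps [simp]:
  assumes "m \<in> Arr Q"
  shows "jc m \<in> Arr P" "Dom P (jc m) = cone (ar (Dom Q m))" "Cod P (jc m) = cone (ar (Cod Q m))"
  using P.triangle_mapD[OF jc_triangle_map[OF assms]] assms by auto

lemma jc_u: "m \<in> Arr Q \<Longrightarrow> jc m \<odot> u (ar (Dom Q m)) = u (ar (Cod Q m)) \<odot> pb m"
  and jc_v: "m \<in> Arr Q \<Longrightarrow> P.sh (pa m) \<odot> v (ar (Dom Q m)) = v (ar (Cod Q m)) \<odot> jc m"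
  using P.triangle_mapD[OF jc_triangle_map[of m]] by auto

lemma jc_comp [simp]: "\<lbrakk>m \<in> Arr Q; n \<in> Arr Q; Dom Q n = Cod Q m\<rbrakk> \<Longrightarrow> jc (n \<star> m) = jc n \<odot> jc m"
  using Q.ftorD(6)[OF j_ftor, of m n] by (simp add: j_eq tri_cat_def)

lemma jc_ide [simp]: "X \<in> Ob Q \<Longrightarrow> jc (Ide Q X) = Ide P (cone (ar X))"
  using Q.ftorD(5)[OF j_ftor, of X] by (simp add: j_eq tri_cat_def j_ob)

lemma jc_add [simp]:
  assumes "m \<in> Arr Q" "n \<in> Arr Q" "Dom Q n = Dom Q m" "Cod Q n = Cod Q m"
  shows "jc (Add Q m n) = Add P (jc m) (jc n)"
proof -
  have "FM j \<in> hom (homgrp Q (Dom Q m) (Cod Q m)) (homgrp (tri_cat P u v k) (FO j (Dom Q m)) (FO j (Cod Q m)))"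
    using j_tau assms by (simp add: tau_ftor_def additive_ftor_def)
  then have "FM j (Add Q m n) = Add (tri_cat P u v k) (FM j m) (FM j n)"
    using assms by (auto simp: hom_def Hom_def homgrp_def)
  then show ?thesis using assms by (simp add: j_eq tri_cat_def)
qed

lemma jc_zero [simp]: "X \<in> Ob Q \<Longrightarrow> Y \<in> Ob Q \<Longrightarrow> jc (Zero Q X Y) = Zero P (cone (ar X)) (cone (ar Y))"
  using P.zero_unique[of "jc (Zero Q X Y)"] by (simp flip: jc_add)

lemma jc_neg [simp]: "m \<in> Arr Q \<Longrightarrow> jc (Neg Q m) = Neg P (jc m)"
  by (rule P.neg_unique) (use Q.neg_add_self[of m] in \<open>simp_all flip: jc_add\<close>)

lemma jc_sub [simp]: "\<lbrakk>m \<in> Arr Q; n \<in> Arr Q; Dom Q n = Dom Q m; Cod Q n = Cod Q m\<rbrakk>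
    \<Longrightarrow> jc (Sub Q m n) = Sub P (jc m) (jc n)"
  by (simp add: Sub_def)

lemma jc_Inc: "\<lbrakk>X \<in> Ob Q; Y \<in> Ob Q; x \<in> carrier (BG (Ups S) (ar X) (ar Y))\<rbrakk> \<Longrightarrow>
    jc (Inc S X Y x) = \<xi> (ar X) (ar Y) x"
  using j_Inc[of X Y x] by (simp add: jc_def)

text \<open>The equation \<open>\<varphi>\<^sub>1 = \<xi> \<varphi>\<close> in terms of
  representatives.\<close>

lemma jc_el:
  assumes f [simp]: "f \<in> Arr P" "f' \<in> Arr P" and x [simp]: "x \<in> Arr P" "Dom P x = P.so (Dom P f)" "Cod P x = Cod P f'"
  shows "jc (el f f' x) = u f' \<odot> x \<odot> v f"
proof -
  have xH: "x \<in> Hom P (P.so (Dom P f)) (Cod P f')" by (simp add: Hom_def)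
  let ?K = "toda_class P f f' x"
  have "jc (el f f' x) = \<xi> f f' (Phi S f f' ?K)"
    unfolding el_def using jc_Inc[of "ob f" "ob f'"] Phi_carrier[OF f x] by simp
  also have "\<dots> = the_elem ((\<lambda>x. u f' \<odot> x \<odot> v f) ` ?K)"
    by (rule xi_Phi[symmetric, OF f P.toda_class_carrier[OF f xH]])
  also have "(\<lambda>x. u f' \<odot> x \<odot> v f) ` ?K = {u f' \<odot> x \<odot> v f}"
    by (rule P.toda_class_image[OF f xH]) simp_all
  finally show ?thesis by simp
qed

text \<open>The difference is null and comes from an element of \<open>\<Upsilon>(f,f')\<close> that
  \<open>\<xi>\<close> kills; at split arrows \<open>\<xi>\<close> is injective.\<close>

lemma jc_inj:
  assumes m: "m \<in> Arr Q" "n \<in> Arr Q" "Dom Q m = ob f" "Cod Q m = ob f'" "Dom Q n = ob f" "Cod Q n = ob f'"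
    and e: "pa m = pa n" "pb m = pb n" "jc m = jc n"
    and f [simp]: "f \<in> Arr P" "f' \<in> Arr P" and s: "split_arrow P f \<or> split_arrow P f'"
  shows "m = n"
proof -
  let ?G = "BG (Ups S) f f'"
  have "null (Sub Q m n)" using m e by (simp add: null_def)
  then obtain x where x: "x \<in> carrier ?G" "Sub Q m n = Inc S (ob f) (ob f') x"
    by (rule null_is_Inc[OF f]) (use m in simp_all)
  have "comm_group ?G" using structureD(8) by (simp add: tau_bifunctor_def bifunctor_def)
  then interpret U: comm_group ?G .
  have "\<xi> f f' \<one>\<^bsub>?G\<^esub> = Zero P (cone f) (cone f')"
    using jc_Inc[of "ob f" "ob f'" "\<one>\<^bsub>?G\<^esub>"] Inc_props(5)[of "ob f" "ob f'"] by simp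
  moreover have "\<xi> f f' x = Zero P (cone f) (cone f')"
    using jc_Inc[of "ob f" "ob f'" x] x(1) m e by (simp flip: x(2))
  ultimately have "\<xi> f f' x = \<xi> f f' \<one>\<^bsub>?G\<^esub>" by simp
  moreover have "inj_on (\<xi> f f') (carrier ?G)" using xi_iso[OF f s] by (simp add: iso_def bij_betw_def)
  ultimately have "x = \<one>\<^bsub>?G\<^esub>" using x(1) U.one_closed by (blast dest: inj_onD)
  then have "Sub Q m n = Zero Q (ob f) (ob f')" using x Inc_props(5)[of "ob f" "ob f'"] by simp
  then show ?thesis by (rule Q.eq_if_sub_zero) (use m in simp_all)
qed

text \<open>For any lift \<open>m\<close> of the square, \<open>c - jc m\<close> is killed by
  \<open>u f\<close> on the right and by \<open>v f'\<close> on the left. It therefore lies in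
  \<open>\<Theta>(f,f')\<close>, which \<open>\<xi>\<close> reaches at split arrows, and the
  preimage corrects \<open>m\<close>.\<close>

lemma jc_surj:
  assumes t: "triangle_map P (f, u f, v f) (f', u f', v f') a b c"
    and f [simp]: "f \<in> Arr P" "f' \<in> Arr P" and s: "split_arrow P f \<or> split_arrow P f'"
  obtains m where "m \<in> Arr Q" "Dom Q m = ob f" "Cod Q m = ob f'" "pa m = a" "pb m = b" "jc m = c"
proof -
  note t = P.triangle_mapD[OF t]
  note [simp] = t(1-9)
  obtain m where m [simp]: "m \<in> Arr Q" "Dom Q m = ob f" "Cod Q m = ob f'" "pa m = a" "pb m = b"
    using lift_exists[of f f' a b] t(10) by auto
  let ?G = "BG (Ups S) f f'"
  have "Sub P c (jc m) \<odot> u f = Zero P (Cod P f) (cone f')"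
    using jc_u[of m] t(11) by (simp add: P.comp_sub)
  moreover have "v f' \<odot> Sub P c (jc m) = Zero P (cone f) (P.so (Dom P f'))"
    using jc_v[of m] t(12) by (simp add: P.comp_sub)
  ultimately have "Sub P c (jc m) \<in> carrier (BG (Theta P u v k) f f')"
    by (simp add: Theta_def Hom_def)
  moreover have "\<xi> f f' ` carrier ?G = carrier (BG (Theta P u v k) f f')"
    using xi_iso[OF f s] by (simp add: iso_def bij_betw_def)
  ultimately obtain x where x: "x \<in> carrier ?G" "\<xi> f f' x = Sub P c (jc m)"
    by (metis imageE)
  have i: "null (Inc S (ob f) (ob f') x)" "Dom Q (Inc S (ob f) (ob f') x) = ob f" "Cod Q (Inc S (ob f) (ob f') x) = ob f'"
    using Inc_props(1)[of "ob f" "ob f'" x] x by auto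
  have "jc (Inc S (ob f) (ob f') x) = Sub P c (jc m)" using jc_Inc[of "ob f" "ob f'" x] x by simp
  then show thesis
    by (intro that[of "Add Q m (Inc S (ob f) (ob f') x)"]) (use i in \<open>simp_all add: null_def\<close>)
qed

text \<open>Compares the triangle on \<open>0 -> X\<close> with second map the identity to the
  chosen one; the third component of the comparison is \<open>u\<close> itself.\<close>

lemma u_bang_iso: assumes [simp]: "X \<in> Ob P" shows "iso_arrow P (u (bang P X))"
  by (rule T.third_component_iso[OF T.zero_ide[OF assms, folded bang_def] chosen])
    (auto intro!: P.triangle_mapI)

lemma v_cobang_iso: assumes [simp]: "X \<in> Ob P" shows "iso_arrow P (v (cobang P X))"
  by (rule T.third_component_iso[OF chosen T.rotate_zero_ide[OF assms, folded cobang_def]])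
    (auto intro!: P.triangle_mapI P.arr_to_zob)

section \<open>The left adjoint and its unit\<close>

definition L :: "('p, 'n, 'o, 'm) ftor" where
  "L = \<lparr>FO = (\<lambda>X. cone (ar X)), FM = jc\<rparr>"

lemma L_simps [simp]: "FO L X = cone (ar X)" "FM L m = jc m"
  by (simp_all add: L_def)

text \<open>The cone of \<open>!_C\<close>, with \<open>C\<close> the cone of \<open>f\<close>, is
  identified with \<open>C\<close> by the isomorphism \<open>u (bang P C)\<close>. Under this
  identification the unit has the identity as third component; it exists and is unique because the
  target is split.\<close>

definition unit :: "'p \<Rightarrow> 'n" where
  "unit X = (SOME m. m \<in> Arr Q \<and> Dom Q m = X \<and> Cod Q m = bo (cone (ar X)) \<and>
     pb m = u (ar X) \<and> jc m = u (bang P (cone (ar X))))"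

lemma unit_simps [simp]:
  assumes X [simp]: "X \<in> Ob Q"
  shows "unit X \<in> Arr Q" "Dom Q (unit X) = X" "Cod Q (unit X) = bo (cone (ar X))"
     "pb (unit X) = u (ar X)" "jc (unit X) = u (bang P (cone (ar X)))"
proof -
  define f B where "f = ar X" and "B = bang P (cone f)"
  have f [simp]: "f \<in> Arr P" "B \<in> Arr P" "Dom P B = zob P" "Cod P B = cone f" "ob f = X"
    by (simp_all add: f_def B_def)
  have s: "split_arrow P f \<or> split_arrow P B" by (simp add: B_def P.split_arrow_bang)
  have t: "triangle_map P (f, u f, v f) (B, u B, v B) (Zero P (Dom P f) (zob P)) (u f) (u B)"
    by (rule P.triangle_mapI) (simp_all add: P.ide_zob)
  obtain m where "m \<in> Arr Q" "Dom Q m = ob f" "Cod Q m = ob B"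
     "pa m = Zero P (Dom P f) (zob P)" "pb m = u f" "jc m = u B"
    by (rule jc_surj[OF t f(1,2) s])
  then have "\<exists>m. m \<in> Arr Q \<and> Dom Q m = X \<and> Cod Q m = bo (cone (ar X)) \<and>
     pb m = u (ar X) \<and> jc m = u (bang P (cone (ar X)))" unfolding f(5) unfolding B_def f_def by blast
  from someI_ex[OF this] show "unit X \<in> Arr Q" "Dom Q (unit X) = X" "Cod Q (unit X) = bo (cone (ar X))"
     "pb (unit X) = u (ar X)" "jc (unit X) = u (bang P (cone (ar X)))" by (simp_all add: unit_def)
qed

lemma jc_inj_bang:
  assumes "m \<in> Arr Q" "n \<in> Arr Q" "Dom Q m = Dom Q n" "Cod Q m = bo Y" "Cod Q n = bo Y" "Y \<in> Ob P"
    "pb m = pb n" "jc m = jc n"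
  shows "m = n"
proof (rule jc_inj[of m n "ar (Dom Q m)" "bang P Y"])
  show "pa m = pa n"
    using P.arr_to_zob(1)[of "pa m" "Dom P (ar (Dom Q n))"] P.arr_to_zob(1)[of "pa n" "Dom P (ar (Dom Q n))"] assms by simp
qed (use assms in \<open>simp_all add: P.split_arrow_bang\<close>)

lemma jc_bm: "g \<in> Arr P \<Longrightarrow> jc (bm g) \<odot> u (bang P (Dom P g)) = u (bang P (Cod P g)) \<odot> g"
  using jc_u[of "bm g"] by simp

lemma unit_natural: "m \<in> Arr Q \<Longrightarrow> unit (Cod Q m) \<star> m = bm (jc m) \<star> unit (Dom Q m)"
  by (rule jc_inj_bang[of _ _ "cone (ar (Cod Q m))"]) (use jc_bm[of "jc m"] in \<open>simp_all add: jc_u\<close>)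

text \<open>An arrow from \<open>X\<close> to \<open>!_Y\<close> is determined by its third
  component and by \<open>pb\<close>, and \<open>pb\<close> is recovered from the third component
  since \<open>u (bang P Y)\<close> is invertible. So \<open>h\<close> has to be the third component
  of \<open>g\<close> read in \<open>Y\<close>.\<close>

lemma unit_universal:
  assumes X [simp]: "X \<in> Ob Q" and Y [simp]: "Y \<in> Ob P" and g: "g \<in> Arr Q" "Dom Q g = X" "Cod Q g = bo Y"
  shows "\<exists>!h. h \<in> Hom P (cone (ar X)) Y \<and> bm h \<star> unit X = g"
proof -
  note [simp] = g u_bang_iso
  define h where "h = Inv P (u (bang P Y)) \<odot> jc g"
  have h [simp]: "h \<in> Arr P" "Dom P h = cone (ar X)" "Cod P h = Y" by (simp_all add: h_def)
  have uh: "u (bang P Y) \<odot> h = jc g" by (simp add: h_def)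
  show ?thesis
  proof (rule ex1I[of _ h], rule conjI)
    show "h \<in> Hom P (cone (ar X)) Y" by (simp add: Hom_def)
    show "bm h \<star> unit X = g"
      by (rule jc_inj_bang[of _ _ Y])
        (use jc_bm[of h] jc_u[of g] in \<open>simp_all add: uh, simp_all add: h_def P.assoc\<close>)
  next
    fix h' assume h': "h' \<in> Hom P (cone (ar X)) Y \<and> bm h' \<star> unit X = g"
    then have a [simp]: "h' \<in> Arr P" "Dom P h' = cone (ar X)" "Cod P h' = Y" by (auto simp: Hom_def)
    have "jc g = jc (bm h' \<star> unit X)" using h' by simp
    also have "\<dots> = u (bang P Y) \<odot> h'" using jc_bm[of h'] by simp
    finally have "h' = Inv P (u (bang P Y)) \<odot> jc g" by simp
    then show "h' = h" by (simp add: h_def)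
  qed
qed

lemma L_ftor: "is_ftor Q P L"
  by (auto simp: is_ftor_def Hom_def)

lemma left_adjunction: "adjunction Q P L (Bang P S) unit"
  unfolding adjunction_def
proof (intro conjI ballI)
  show "nat_trans Q Q id_ftor (comp_ftor (Bang P S) L) unit"
    by (auto simp: nat_trans_def id_ftor_def comp_ftor_def Hom_def unit_natural)
  fix X Y g assume "X \<in> Ob Q" "Y \<in> Ob P" "g \<in> Hom Q X (FO (Bang P S) Y)"
  then show "\<exists>!h. h \<in> Hom P (FO L X) Y \<and> FM (Bang P S) h \<star> unit X = g"
    using unit_universal[of X Y g] by (simp add: Hom_def)
qed (rule L_ftor Bang_ftor)+

lemma adj_u_eq: assumes [simp]: "f \<in> Arr P" shows "adj_u P S L unit f = u f"
  unfolding adj_u_def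
proof (rule the_equality)
  have "bm (u f) = unit (ob f) \<star> ci f" by (rule eq_from_bang, simp) simp_all
  then show "u f \<in> Hom P (Cod P f) (FO L (ob f)) \<and> bm (u f) = unit (ob f) \<star> ci f" by (simp add: Hom_def)
  then show "u' = u f" if "u' \<in> Hom P (Cod P f) (FO L (ob f)) \<and> bm u' = unit (ob f) \<star> ci f" for u'
    using that by (intro bm_inj) (auto simp: Hom_def)
qed

text \<open>Both arrows to \<open>!_{A[1]}\<close> have second component zero, as
  \<open>v_f u_f = 0\<close>, and the same third component, \<open>v_f\<close> followed by the
  isomorphism from \<open>A[1]\<close> to the cone of \<open>!_{A[1]}\<close>.\<close>

lemma adj_v_eq: assumes [simp]: "f \<in> Arr P" shows "adj_v P S L unit f = v f"
  unfolding adj_v_def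
proof (rule the_equality)
  let ?B = "bang P (P.so (Dom P f))"
  have c: "cj f = el f ?B (Ide P (P.so (Dom P f)))"
    using bm_cj[of f "Ide P (P.so (Dom P f))"] by simp
  have "cj f = bm (v f) \<star> unit (ob f)"
    by (rule jc_inj_bang[of _ _ "P.so (Dom P f)"])
      (use jc_bm[of "v f"] pa_pb_el[of f ?B "Ide P (P.so (Dom P f))"] jc_el[of f ?B "Ide P (P.so (Dom P f))"]
        in \<open>simp_all, simp_all add: c\<close>)
  then show *: "v f \<in> Hom P (FO L (ob f)) (P.so (Dom P f)) \<and> cj f = bm (v f) \<star> unit (ob f)" by (simp add: Hom_def)
  show "v' = v f" if "v' \<in> Hom P (FO L (ob f)) (P.so (Dom P f)) \<and> cj f = bm v' \<star> unit (ob f)" for v'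
  proof -
    have "\<exists>!h. h \<in> Hom P (cone f) (P.so (Dom P f)) \<and> bm h \<star> unit (ob f) = cj f"
      using unit_universal[of "ob f" "P.so (Dom P f)" "cj f"] by simp
    moreover have "v f \<in> Hom P (cone f) (P.so (Dom P f)) \<and> bm (v f) \<star> unit (ob f) = cj f"
      "v' \<in> Hom P (cone f) (P.so (Dom P f)) \<and> bm v' \<star> unit (ob f) = cj f"
      using * that by simp_all
    ultimately show ?thesis by blast
  qed
qed

text \<open>The lifts \<open>x\<close> and \<open>w\<close> are built as maps of triangles from
  comparisons of the chosen triangle on \<open>u_f\<close> with the rotated one; their composite is
  given by \<open>-(c' c)\<close>, and \<open>c' c\<close> is the identity up to
  indeterminacy.\<close>

lemma massey_condition:
  assumes f [simp]: "f \<in> Arr P"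
  shows "massey P S (v f) (u f) f = massey_class P (v f) (u f) f (Ide P (P.so (Dom P f)))"
proof -
  define A where "A = Dom P f"
  define g where "g = u f"
  define cA bA where "cA = cobang P A" and "bA = bang P (P.so A)"
  have A [simp]: "A \<in> Ob P" "Dom P f = A" by (auto simp: A_def)
  have g [simp]: "g \<in> Arr P" "Dom P g = Cod P f" "Cod P g = cone f" by (simp_all add: g_def)
  have B [simp]: "cA \<in> Arr P" "Dom P cA = A" "Cod P cA = zob P" "bA \<in> Arr P" "Dom P bA = zob P" "Cod P bA = P.so A"
    "split_arrow P cA" "split_arrow P bA"
    by (simp_all add: cA_def bA_def P.split_arrow_bang)
  note t = T.TR3[OF chosen[OF f], folded g_def]
  have id: "Ide P (Cod P f) \<in> Hom P (Dom P g) (Dom P g)" "Ide P (cone f) \<in> Hom P (Cod P g) (Cod P g)"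
    by (auto simp: Hom_def)
  \<comment> \<open>Weak functoriality gives comparisons \<open>c\<close> and \<open>c'\<close> in
    both directions, not known to be inverse to each other.\<close>
  obtain c where "triangle_map P (g, v f, Neg P (P.sh f)) (g, u g, v g) (Ide P (Cod P f)) (Ide P (cone f)) c"
    using T.TR5[OF t chosen[OF g(1)] id] by auto
  note c = P.triangle_mapD[OF this]
  obtain c' where "triangle_map P (g, u g, v g) (g, v f, Neg P (P.sh f)) (Ide P (Cod P f)) (Ide P (cone f)) c'"
    using T.TR5[OF chosen[OF g(1)] t id] by auto
  note c' = P.triangle_mapD[OF this]
  have [simp]: "c \<in> Arr P" "Dom P c = P.so A" "Cod P c = cone g" "c' \<in> Arr P" "Dom P c' = cone g" "Cod P c' = P.so A"
    using c c' by simp_all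
  have cv: "c \<odot> v f = u g" "v g \<odot> c = Neg P (P.sh f)" "c' \<odot> u g = v f" "Neg P (P.sh f) \<odot> c' = v g"
    using c c' by simp_all
  \<comment> \<open>The rotated triangle has third map \<open>-f[1]\<close>, so
    \<open>v_g c = -f[1]\<close>; a map with first component \<open>f\<close> needs
    \<open>-c\<close>. This is the sign absorbed by the normalization of the Massey product.\<close>
  have "triangle_map P (cA, u cA, v cA) (g, u g, v g) f (Zero P (zob P) (cone f)) (Neg P (c \<odot> v cA))"
  proof (rule P.triangle_mapI)
    show "Neg P (c \<odot> v cA) \<odot> u cA = u g \<odot> Zero P (zob P) (cone f)" by (simp add: P.comp_neg P.assoc)
    show "P.sh f \<odot> v cA = v g \<odot> Neg P (c \<odot> v cA)"
      using P.comp_reduce[OF cv(2), of "v cA"] by (simp add: P.comp_neg)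
    show "Zero P (zob P) (cone f) \<odot> cA = g \<odot> f" by (simp add: g_def)
  qed simp_all
  then obtain x where x [simp]: "x \<in> Arr Q" "Dom Q x = ob cA" "Cod Q x = ob g" "pa x = f"
    "pb x = Zero P (zob P) (cone f)" "jc x = Neg P (c \<odot> v cA)"
    by (rule jc_surj) simp_all
  have "triangle_map P (g, u g, v g) (bA, u bA, v bA) (Zero P (Cod P f) (zob P)) (v f) (u bA \<odot> c')"
  proof (rule P.triangle_mapI)
    show "v f \<odot> g = bA \<odot> Zero P (Cod P f) (zob P)" by (simp add: g_def)
    show "(u bA \<odot> c') \<odot> u g = u bA \<odot> v f" by (simp add: P.assoc cv)
    show "P.sh (Zero P (Cod P f) (zob P)) \<odot> v g = v bA \<odot> (u bA \<odot> c')"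
      using P.comp_reduce[OF uv_zero(2)[of bA], of c'] by simp
  qed simp_all
  then obtain w where w [simp]: "w \<in> Arr Q" "Dom Q w = ob g" "Cod Q w = ob bA" "pa w = Zero P (Cod P f) (zob P)"
    "pb w = v f" "jc w = u bA \<odot> c'"
    by (rule jc_surj) simp_all
  have e [simp]: "el cA bA (Neg P (c' \<odot> c)) \<in> Arr Q" "Dom Q (el cA bA (Neg P (c' \<odot> c))) = ob cA"
    "Cod Q (el cA bA (Neg P (c' \<odot> c))) = ob bA"
    "pb (el cA bA (Neg P (c' \<odot> c))) = Zero P (zob P) (P.so A)"
    "jc (el cA bA (Neg P (c' \<odot> c))) = u bA \<odot> Neg P (c' \<odot> c) \<odot> v cA"
    using el_simps[of cA bA "Neg P (c' \<odot> c)"] pa_pb_el[of cA bA "Neg P (c' \<odot> c)"] jc_el[of cA bA "Neg P (c' \<odot> c)"]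
    by simp_all
  have "w \<star> x = el cA bA (Neg P (c' \<odot> c))"
    by (rule jc_inj_bang[of _ _ "P.so A"]) (simp_all add: P.comp_neg P.assoc, simp_all add: bA_def)
  then have "massey_rep (v f) g f (c' \<odot> c)" unfolding massey_rep_def
    by (intro exI[of _ x] exI[of _ w]) (simp add: cn_el cA_def bA_def)
  then have 1: "massey P S (v f) g f = toda_class P f (v f) (c' \<odot> c)" by (intro massey_eq) simp_all
  \<comment> \<open>Since \<open>c' c v_f = c' u_g = v_f\<close>, the deviation from the identity
    kills \<open>v_f\<close> and hence factors through \<open>f[1]\<close>, which puts it into the
    indeterminacy.\<close>
  define e where "e = Sub P (c' \<odot> c) (Ide P (P.so A))"
  have e [simp]: "e \<in> Arr P" "Dom P e = P.so A" "Cod P e = P.so A" by (simp_all add: e_def)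
  have "e \<odot> v f = Zero P (Dom P (v f)) (Cod P e)" by (simp add: e_def P.comp_sub P.assoc cv)
  then obtain y where y: "y \<in> Arr P" "Dom P y = P.so (Cod P f)" "Cod P y = P.so A" "e = y \<odot> P.sh f"
    using T.extend_fourth[OF chosen[OF f] e(1)] e A(2) by metis
  have "e \<in> toda_rel P f (v f)" unfolding P.toda_rel_iff
    by (rule exI[of _ "Zero P (P.so A) (cone f)"], rule exI[of _ "Neg P y"]) (use y in \<open>simp add: P.comp_neg\<close>)
  moreover have "c' \<odot> c = Add P e (Ide P (P.so A))" by (simp add: e_def)
  ultimately have "c' \<odot> c \<in> toda_class P f (v f) (Ide P (P.so A))"
    using P.toda_class_mem[of f "v f" "c' \<odot> c" "Ide P (P.so A)"] by auto
  then have "toda_class P f (v f) (c' \<odot> c) = toda_class P f (v f) (Ide P (P.so A))"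
    by (intro P.toda_class_eqI) (auto simp: Hom_def)
  then show ?thesis using 1 by (simp add: P.massey_class_eq_toda_class g_def)
qed

text \<open>Arrows from \<open>X -> 0\<close> to \<open>[f]\<close> are determined by their third
  component \<open>K X -> C_f\<close>, and every map \<open>z\<close> between these objects occurs:
  the first component is forced by \<open>a[1] = v_f z v_X^{-1}\<close>. As \<open>K X\<close> is
  isomorphic to \<open>X[1]\<close>, applying \<open>[-1]\<close> turns \<open>z\<close> into an
  arrow from \<open>X\<close> to \<open>C_f[-1]\<close>.\<close>

lemma right_adjunction:
  assumes M: "inverse_translation P M"
  shows "\<exists>\<eta>. adjunction P Q (Cobang P S) (comp_ftor M L) \<eta>"
proof -
  have MF: "is_ftor P P M" and SF: "is_ftor P P (shift_ftor P)"
    and MS: "nat_isomorphic P P (comp_ftor M (shift_ftor P)) id_ftor"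
    and SM: "nat_isomorphic P P (comp_ftor (shift_ftor P) M) id_ftor"
    using M P.shift_additive by (auto simp: inverse_translation_def additive_ftor_def)
  note [simp] = P.ftorD[OF MF]
  obtain e where e0: "\<And>X. X \<in> Ob P \<Longrightarrow> iso_arrow P (e X)"
    "\<And>X. X \<in> Ob P \<Longrightarrow> Dom P (e X) = FO M (FO (shift_ftor P) X)"
    "\<And>X. X \<in> Ob P \<Longrightarrow> Cod P (e X) = X"
    "\<And>f. f \<in> Arr P \<Longrightarrow> e (Cod P f) \<odot> FM M (FM (shift_ftor P) f) = f \<odot> e (Dom P f)"
    using MS by (rule P.nat_isomorphic_idD) blast
  have e [simp]: "iso_arrow P (e X)" "Dom P (e X) = FO M (P.so X)" "Cod P (e X) = X" "e X \<in> Arr P"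
    if "X \<in> Ob P" for X
    using e0(1-3)[OF that] P.iso_arr[OF e0(1)[OF that]] by (simp_all add: shift_ftor_def)
  have e_nat: "e (Cod P f) \<odot> FM M (P.sh f) = f \<odot> e (Dom P f)" if "f \<in> Arr P" for f
    using e0(4)[OF that] by (simp add: shift_ftor_def)
  define vX where "vX X = v (cobang P X)" for X
  define K where "K X = cone (cobang P X)" for X
  have vX [simp]: "iso_arrow P (vX X)" "vX X \<in> Arr P" "Dom P (vX X) = K X" "Cod P (vX X) = P.so X" "K X \<in> Ob P"
    if "X \<in> Ob P" for X
    using that by (simp_all add: vX_def K_def v_cobang_iso)
  \<comment> \<open>The unit composes the inverses of \<open>X[1][-1] -> X\<close> and of
    \<open>[-1]\<close> applied to \<open>v_X\<close>. It is invertible, with inverse the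
    \<open>\<rho>\<close> below.\<close>
  define \<eta> where "\<eta> X = FM M (Inv P (vX X)) \<odot> Inv P (e X)" for X
  have \<eta> [simp]: "\<eta> X \<in> Arr P" "Dom P (\<eta> X) = X" "Cod P (\<eta> X) = FO M (K X)" if "X \<in> Ob P" for X
    using that by (simp_all add: \<eta>_def)
  define \<rho> where "\<rho> X = e X \<odot> FM M (vX X)" for X
  have \<rho> [simp]: "\<rho> X \<in> Arr P" "Dom P (\<rho> X) = FO M (K X)" "Cod P (\<rho> X) = X" if "X \<in> Ob P" for X
    using that by (simp_all add: \<rho>_def)
  have Mv: "FM M (Inv P (vX X)) \<odot> FM M (vX X) = Ide P (FO M (K X))"
    "FM M (vX X) \<odot> FM M (Inv P (vX X)) = Ide P (FO M (P.so X))" if X: "X \<in> Ob P" for X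
    using X P.ftorD(6)[OF MF, of "vX X" "Inv P (vX X)"] P.ftorD(6)[OF MF, of "Inv P (vX X)" "vX X"]
    by (simp_all flip: P.ftorD(6)[OF MF])
  have \<rho>\<eta>: "\<rho> X \<odot> \<eta> X = Ide P X" if X: "X \<in> Ob P" for X
  proof -
    have "FM M (vX X) \<odot> FM M (Inv P (vX X)) \<odot> Inv P (e X) = Inv P (e X)"
      using P.comp_reduce[OF Mv(2)[OF X], of "Inv P (e X)"] X by simp
    then show ?thesis using X by (simp add: \<rho>_def \<eta>_def P.assoc)
  qed
  have \<eta>\<rho>: "\<eta> X \<odot> \<rho> X = Ide P (FO M (K X))" if X: "X \<in> Ob P" for X
    using X Mv[OF X] by (simp add: \<rho>_def \<eta>_def P.assoc)
  have \<eta>_natural: "\<eta> (Cod P f) \<odot> f = FM M (jc (cm f)) \<odot> \<eta> (Dom P f)" if f [simp]: "f \<in> Arr P" for f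
  proof -
    let ?X = "Dom P f" and ?Y = "Cod P f"
    have c [simp]: "jc (cm f) \<in> Arr P" "Dom P (jc (cm f)) = K ?X" "Cod P (jc (cm f)) = K ?Y"
      by (simp_all add: K_def)
    have "P.sh f \<odot> vX ?X = vX ?Y \<odot> jc (cm f)" using jc_v[of "cm f"] by (simp add: vX_def)
    then have "FM M (P.sh f) \<odot> FM M (vX ?X) = FM M (vX ?Y) \<odot> FM M (jc (cm f))"
      by (simp flip: P.ftorD(6)[OF MF])
    then have "\<rho> ?Y \<odot> FM M (jc (cm f)) = (e ?Y \<odot> FM M (P.sh f)) \<odot> FM M (vX ?X)"
      by (simp add: \<rho>_def P.assoc)
    also have "\<dots> = f \<odot> \<rho> ?X" by (simp only: e_nat[OF f]) (simp add: \<rho>_def P.assoc)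
    finally have 1: "\<rho> ?Y \<odot> FM M (jc (cm f)) = f \<odot> \<rho> ?X" .
    have "FM M (jc (cm f)) \<odot> \<eta> ?X = \<eta> ?Y \<odot> (\<rho> ?Y \<odot> FM M (jc (cm f))) \<odot> \<eta> ?X"
      using P.comp_reduce[OF \<eta>\<rho>[of ?Y], of "FM M (jc (cm f)) \<odot> \<eta> ?X"] by (simp add: P.assoc)
    also have "\<dots> = \<eta> ?Y \<odot> f" unfolding 1 by (simp add: P.assoc \<rho>\<eta>)
    finally show ?thesis by simp
  qed
  have universal: "\<exists>!h. h \<in> Hom Q (co X) Y \<and> FM M (jc h) \<odot> \<eta> X = g"
    if X [simp]: "X \<in> Ob P" and Y [simp]: "Y \<in> Ob Q" and g [simp]: "g \<in> Arr P" "Dom P g = X" "Cod P g = FO M (cone (ar Y))"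
    for X Y g
  proof -
    define f c where "f = ar Y" and "c = cobang P X"
    have f [simp]: "f \<in> Arr P" "ob f = Y" and c [simp]: "c \<in> Arr P" "Dom P c = X" "Cod P c = zob P" "split_arrow P c"
      by (simp_all add: f_def c_def P.split_arrow_bang)
    have aY [simp]: "ar Y = f" by (simp add: f_def)
    have vc [simp]: "v c = vX X" "cone c = K X" by (simp_all add: vX_def K_def c_def)
    obtain z where z [simp]: "z \<in> Arr P" "Dom P z = K X" "Cod P z = cone f" and zg: "FM M z = g \<odot> \<rho> X"
      by (rule P.quasi_inverse_full[OF MF SF SM MS, of "K X" "cone f" "g \<odot> \<rho> X"]) simp_all
    obtain a where a [simp]: "a \<in> Arr P" "Dom P a = X" "Cod P a = Dom P f" and sa: "P.sh a = v f \<odot> z \<odot> Inv P (vX X)"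
      by (rule P.sh_full[of "v f \<odot> z \<odot> Inv P (vX X)" X "Dom P f"]) simp_all
    \<comment> \<open>The square demands \<open>f a = 0\<close>. It is verified after translation,
      where it follows from \<open>f[1] v_f = 0\<close>.\<close>
    have "P.sh (f \<odot> a) = P.sh (Zero P X (Cod P f))"
      using P.comp_reduce[OF uv_zero(3)[of f], of "z \<odot> Inv P (vX X)"] by (simp add: sa)
    then have fa: "f \<odot> a = Zero P X (Cod P f)" by (rule P.sh_faithful) simp_all
    have "triangle_map P (c, u c, v c) (f, u f, v f) a (Zero P (zob P) (Cod P f)) z"
    proof (rule P.triangle_mapI)
      show "z \<odot> u c = u f \<odot> Zero P (zob P) (Cod P f)"
        using P.arr_to_zob(2)[of "z \<odot> u c" "cone f"] by simp
    qed (simp_all add: fa sa P.assoc)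
    then obtain h where h [simp]: "h \<in> Arr Q" "Dom Q h = ob c" "Cod Q h = ob f" "jc h = z"
      by (rule jc_surj) simp_all
    show ?thesis
    proof (rule ex1I[of _ h], rule conjI)
      show "h \<in> Hom Q (co X) Y" by (simp add: Hom_def, simp add: c_def)
      show "FM M (jc h) \<odot> \<eta> X = g" by (simp add: zg P.assoc \<rho>\<eta>)
      fix h' assume h': "h' \<in> Hom Q (co X) Y \<and> FM M (jc h') \<odot> \<eta> X = g"
      then have hh [simp]: "h' \<in> Arr Q" "Dom Q h' = ob c" "Cod Q h' = ob f" by (auto simp: Hom_def c_def)
      have "FM M (jc h') = (FM M (jc h') \<odot> \<eta> X) \<odot> \<rho> X" by (simp add: P.assoc \<eta>\<rho>)
      also have "\<dots> = FM M (jc h)" using h' by (simp add: zg)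
      finally have j: "jc h' = jc h"
        by (rule P.quasi_inverse_faithful[OF SM, rotated -1]) simp_all
      \<comment> \<open>The third component determines the first, because \<open>v_X\<close> is
        invertible and the translation is faithful.\<close>
      have "P.sh (pa h') \<odot> vX X = P.sh (pa h) \<odot> vX X" using jc_v[of h] jc_v[of h'] j by simp
      then have "(P.sh (pa h') \<odot> vX X) \<odot> Inv P (vX X) = (P.sh (pa h) \<odot> vX X) \<odot> Inv P (vX X)" by simp
      then have "P.sh (pa h') = P.sh (pa h)" by (simp add: P.assoc)
      then have "pa h' = pa h" by (rule P.sh_faithful) simp_all
      moreover have "pb h' = pb h"
        using P.arr_to_zob(2)[of "pb h'" "Cod P f"] P.arr_to_zob(2)[of "pb h" "Cod P f"] by simp
      ultimately show "h' = h" using j by (intro jc_inj[of h' h c f]) simp_all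
    qed
  qed
  have "is_ftor Q P (comp_ftor M L)" by (auto simp: is_ftor_def comp_ftor_def Hom_def)
  moreover have "nat_trans P P id_ftor (comp_ftor (comp_ftor M L) (Cobang P S)) \<eta>"
    by (auto simp: nat_trans_def id_ftor_def comp_ftor_def Hom_def \<eta>_natural K_def[symmetric])
  ultimately have "adjunction P Q (Cobang P S) (comp_ftor M L) \<eta>"
    unfolding adjunction_def using Bang_ftor(2) universal by (auto simp: comp_ftor_def Hom_def)
  then show ?thesis by blast
qed

end

section \<open>From the left adjunction to a triangulation\<close>

locale adjoint_structure = pseudo_triangulated_category P S
  for P :: "('o, 'm) tcat" and S :: "('m, 'p, 'n, 'u) pstruct" +
  fixes L :: "('p, 'n, 'o, 'm) ftor" and w :: "'p \<Rightarrow> 'n"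
  assumes adjunct: "adjunction (Ptr S) P L (Bang P S) w"
    and massey_id: "f \<in> Arr P \<Longrightarrow> massey P S (adj_v P S L w f) (adj_u P S L w f) f =
      massey_class P (adj_v P S L w f) (adj_u P S L w f) f (Ide P (ShO P (Dom P f)))"
begin

abbreviation "cone f \<equiv> FO L (ob f)"
abbreviation "lm m \<equiv> FM L m"
abbreviation "u \<equiv> adj_u P S L w"
abbreviation "v \<equiv> adj_v P S L w"

lemma L_ftor: "is_ftor Q P L" using adjunct by (simp add: adjunction_def)

lemmas [simp] = Q.ftorD[OF L_ftor]

lemma w_simps [simp]: "X \<in> Ob Q \<Longrightarrow> w X \<in> Arr Q" "X \<in> Ob Q \<Longrightarrow> Dom Q (w X) = X"
  "X \<in> Ob Q \<Longrightarrow> Cod Q (w X) = bo (FO L X)"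
  using adjunct by (auto simp: adjunction_def nat_trans_def id_ftor_def comp_ftor_def Hom_def)

lemma w_natural: "m \<in> Arr Q \<Longrightarrow> w (Cod Q m) \<star> m = bm (lm m) \<star> w (Dom Q m)"
  using adjunct by (auto simp: adjunction_def nat_trans_def id_ftor_def comp_ftor_def)

lemma universal:
  assumes "g \<in> Arr Q" "Cod Q g = bo Y" "Y \<in> Ob P"
  obtains h where "h \<in> Arr P" "Dom P h = FO L (Dom Q g)" "Cod P h = Y" "g = bm h \<star> w (Dom Q g)"
proof -
  have "\<forall>X\<in>Ob Q. \<forall>Y\<in>Ob P. \<forall>g\<in>Hom Q X (FO (Bang P S) Y).
        \<exists>!h. h \<in> Hom P (FO L X) Y \<and> FM (Bang P S) h \<star> w X = g"
    using adjunct unfolding adjunction_def by blast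
  from this[rule_format, of "Dom Q g" Y g] assms
  obtain h where "h \<in> Hom P (FO L (Dom Q g)) Y \<and> bm h \<star> w (Dom Q g) = g" by (auto simp: Hom_def)
  then show thesis using that[of h] by (auto simp: Hom_def)
qed

lemma w_cancel:
  assumes "bm h \<star> w X = bm h' \<star> w X" "X \<in> Ob Q" "h \<in> Arr P" "h' \<in> Arr P" "Dom P h = FO L X" "Dom P h' = FO L X"
    "Cod P h = Cod P h'"
  shows "h = h'"
proof -
  have "\<forall>X\<in>Ob Q. \<forall>Y\<in>Ob P. \<forall>g\<in>Hom Q X (FO (Bang P S) Y).
        \<exists>!h. h \<in> Hom P (FO L X) Y \<and> FM (Bang P S) h \<star> w X = g"
    using adjunct unfolding adjunction_def by blast
  from this[rule_format, of X "Cod P h'" "bm h \<star> w X"] assms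
  have "\<exists>!k. k \<in> Hom P (FO L X) (Cod P h') \<and> FM (Bang P S) k \<star> w X = bm h \<star> w X"
    by (simp add: Hom_def)
  moreover have "h \<in> Hom P (FO L X) (Cod P h')" "h' \<in> Hom P (FO L X) (Cod P h')" using assms by (auto simp: Hom_def)
  ultimately show ?thesis using assms(1) by metis
qed

text \<open>Arrows out of \<open>!_B\<close> are determined by their second component, so
  \<open>w i_f\<close> is \<open>!_b\<close> for exactly one \<open>b\<close>.\<close>

lemma u_props:
  assumes f [simp]: "f \<in> Arr P"
  shows "u f \<in> Arr P \<and> Dom P (u f) = Cod P f \<and> Cod P (u f) = cone f \<and> bm (u f) = w (ob f) \<star> ci f"
proof -
  let ?m = "w (ob f) \<star> ci f"
  have m: "?m = bm (pb ?m)" by (rule eq_from_bang[of _ "Cod P f"]) simp_all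
  have "u f = pb ?m" unfolding adj_u_def
  proof (rule the_equality)
    show "pb ?m \<in> Hom P (Cod P f) (cone f) \<and> bm (pb ?m) = ?m" unfolding m[symmetric] by (simp add: Hom_def)
    show "u' = pb ?m" if "u' \<in> Hom P (Cod P f) (cone f) \<and> bm u' = ?m" for u'
      using bm_simps(5)[of u'] that by (simp add: Hom_def del: bm_simps)
  qed
  then show ?thesis using m by simp
qed

lemma u_simps [simp]:
  "f \<in> Arr P \<Longrightarrow> u f \<in> Arr P" "f \<in> Arr P \<Longrightarrow> Dom P (u f) = Cod P f" "f \<in> Arr P \<Longrightarrow> Cod P (u f) = cone f"
  using u_props by auto

lemma bm_u: "f \<in> Arr P \<Longrightarrow> bm (u f) = w (ob f) \<star> ci f"
  using u_props by auto

lemma pb_w [simp]: "f \<in> Arr P \<Longrightarrow> pb (w (ob f)) = u f"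
  using arg_cong[OF bm_u, of f pb] by simp

lemma v_props:
  assumes f [simp]: "f \<in> Arr P"
  shows "v f \<in> Arr P \<and> Dom P (v f) = cone f \<and> Cod P (v f) = P.so (Dom P f) \<and> cj f = bm (v f) \<star> w (ob f)"
proof -
  obtain h where h: "h \<in> Arr P" "Dom P h = cone f" "Cod P h = P.so (Dom P f)" "cj f = bm h \<star> w (ob f)"
    by (rule universal[of "cj f" "P.so (Dom P f)"]) simp_all
  have "v f = h" unfolding adj_v_def
  proof (rule the_equality)
    show "h \<in> Hom P (cone f) (P.so (Dom P f)) \<and> cj f = bm h \<star> w (ob f)" using h by (simp add: Hom_def)
    show "h' = h" if "h' \<in> Hom P (cone f) (P.so (Dom P f)) \<and> cj f = bm h' \<star> w (ob f)" for h'
      by (rule w_cancel[of h' "ob f" h]) (use h that in \<open>auto simp: Hom_def\<close>)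
  qed
  then show ?thesis using h by simp
qed

lemma v_simps [simp]:
  "f \<in> Arr P \<Longrightarrow> v f \<in> Arr P" "f \<in> Arr P \<Longrightarrow> Dom P (v f) = cone f"
  "f \<in> Arr P \<Longrightarrow> Cod P (v f) = P.so (Dom P f)"
  using v_props by auto

lemma bm_v: "f \<in> Arr P \<Longrightarrow> bm (v f) \<star> w (ob f) = cj f"
  using v_props by auto

lemma pa_pb_cj:
  assumes "f \<in> Arr P" shows "pb (cj f) = Zero P (Cod P f) (P.so (Dom P f))"
  using bm_cj[of f "Ide P (P.so (Dom P f))"] pa_pb_el[of f "bang P (P.so (Dom P f))" "Ide P (P.so (Dom P f))"] assms
  by simp

text \<open>The first equation is the commuting square over \<open>w\<close>, the second holds
  because \<open>p\<close> kills \<open>j_f\<close>, and the third is the vanishing of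
  \<open>!_{f[1]} j_f\<close> read through the adjunction.\<close>

lemma uv_zero [simp]:
  assumes f [simp]: "f \<in> Arr P"
  shows "u f \<odot> f = Zero P (Dom P f) (cone f)" "v f \<odot> u f = Zero P (Cod P f) (P.so (Dom P f))"
    "P.sh f \<odot> v f = Zero P (cone f) (P.so (Cod P f))"
proof -
  show "u f \<odot> f = Zero P (Dom P f) (cone f)" using square[of "w (ob f)"] by (simp add: bang_def)
  show "v f \<odot> u f = Zero P (Cod P f) (P.so (Dom P f))"
    using arg_cong[OF bm_v[OF f], of pb] pa_pb_cj[OF f] by simp
  have "bm (P.sh f \<odot> v f) \<star> w (ob f) = bm (P.sh f) \<star> cj f" by (simp add: Q.assoc bm_v)
  also have "\<dots> = bm (Zero P (cone f) (P.so (Cod P f))) \<star> w (ob f)" by (simp add: sh_comp_cj)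
  finally show "P.sh f \<odot> v f = Zero P (cone f) (P.so (Cod P f))" by (rule w_cancel) simp_all
qed

text \<open>The condition \<open>b f = 0\<close> says that \<open>(0,b)\<close> is an arrow from
  \<open>f\<close> to \<open>0 -> Y\<close>; a lift to \<open>Ptr\<close> factors through the
  unit.\<close>

lemma factor_through_u:
  assumes f [simp]: "f \<in> Arr P" and b [simp]: "b \<in> Arr P" "Dom P b = Cod P f"
    and z: "b \<odot> f = Zero P (Dom P f) (Cod P b)"
  obtains e where "e \<in> Arr P" "Dom P e = cone f" "Cod P e = Cod P b" "b = e \<odot> u f"
proof -
  obtain m where m [simp]: "m \<in> Arr Q" "Dom Q m = ob f" "Cod Q m = bo (Cod P b)" and pb: "pb m = b"
    by (rule lift_exists[of f "bang P (Cod P b)" "Zero P (Dom P f) (zob P)" b]) (simp_all add: z)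
  obtain h where h: "h \<in> Arr P" "Dom P h = cone f" "Cod P h = Cod P b" "m = bm h \<star> w (ob f)"
    using universal[of m "Cod P b"] m by (metis P.dom_cod_ob(2) b(1))
  have "pb (bm h \<star> w (ob f)) = b" using h(4) pb by simp
  then have "b = h \<odot> u f" using h(1-3) by simp
  then show thesis using that h by blast
qed

text \<open>If \<open>e u_f = 0\<close>, the adjunct of \<open>e\<close> is null, and null arrows to
  \<open>!_Y\<close> factor through \<open>j_f\<close>.\<close>

lemma factor_through_v:
  assumes f [simp]: "f \<in> Arr P" and e [simp]: "e \<in> Arr P" "Dom P e = cone f"
    and z: "e \<odot> u f = Zero P (Cod P f) (Cod P e)"
  obtains t where "t \<in> Arr P" "Dom P t = P.so (Dom P f)" "Cod P t = Cod P e" "e = t \<odot> v f"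
proof -
  let ?m = "bm e \<star> w (ob f)"
  have "null ?m" unfolding null_def using z P.arr_to_zob(1)[of "pa ?m" "Dom P f"] by simp
  then show thesis
  proof (rule null_is_el[of f "bang P (Cod P e)", rotated 3])
    fix t assume t: "t \<in> Arr P" "Dom P t = P.so (Dom P f)" "Cod P t = Cod P (bang P (Cod P e))"
      "?m = el f (bang P (Cod P e)) t"
    then have t' [simp]: "t \<in> Arr P" "Dom P t = P.so (Dom P f)" "Cod P t = Cod P e" by simp_all
    have "?m = bm (t \<odot> v f) \<star> w (ob f)" using t(4) bm_cj[of f t] by (simp add: Q.assoc bm_v)
    then have "e = t \<odot> v f" by (rule w_cancel) simp_all
    then show thesis using that t' by blast
  qed (simp_all add: P.splittable_bang)
qed

text \<open>The square with \<open>u\<close> is naturality of the unit under \<open>p\<close>; the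
  square with \<open>v\<close> is naturality of \<open>j_f\<close>, compared after composition with
  the unit.\<close>

lemma lm_triangle_map:
  assumes m [simp]: "m \<in> Arr Q" "Dom Q m = ob f" "Cod Q m = ob f'" "f \<in> Arr P" "f' \<in> Arr P"
  shows "triangle_map P (f, u f, v f) (f', u f', v f') (pa m) (pb m) (lm m)"
proof (rule P.triangle_mapI)
  show "pb m \<odot> f = f' \<odot> pa m" using square[of m] by simp
  show "lm m \<odot> u f = u f' \<odot> pb m" using arg_cong[OF w_natural[of m], of pb] by simp
  have "bm (P.sh (pa m) \<odot> v f) \<star> w (ob f) = cj f' \<star> m"
    using cj_natural[of m f f'] by (simp add: Q.assoc bm_v)
  also have "\<dots> = bm (v f') \<star> w (ob f') \<star> m" by (simp flip: bm_v add: Q.assoc)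
  also have "\<dots> = bm (v f' \<odot> lm m) \<star> w (ob f)" using w_natural[of m] by (simp add: Q.assoc)
  finally show "P.sh (pa m) \<odot> v f = v f' \<odot> lm m" by (rule w_cancel) simp_all
qed simp_all

lemma lm_add [simp]:
  assumes [simp]: "m \<in> Arr Q" "n \<in> Arr Q" "Dom Q n = Dom Q m" "Cod Q n = Cod Q m"
  shows "lm (Add Q m n) = Add P (lm m) (lm n)"
proof (rule w_cancel[of _ "Dom Q m"])
  show "bm (lm (Add Q m n)) \<star> w (Dom Q m) = bm (Add P (lm m) (lm n)) \<star> w (Dom Q m)"
    using w_natural[of "Add Q m n"] w_natural[of m] w_natural[of n]
    by (simp add: bm_add Q.comp_add)
qed simp_all

text \<open>Shows that \<open>L\<close> turns \<open>\<varphi>\<close> into the map from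
  \<open>\<Delta>\<close> to \<open>\<Theta>\<close> of the triangulation to be built.\<close>

lemma lm_el:
  assumes f [simp]: "f \<in> Arr P" "f' \<in> Arr P" and x [simp]: "x \<in> Arr P" "Dom P x = P.so (Dom P f)" "Cod P x = Cod P f'"
  shows "lm (el f f' x) = u f' \<odot> x \<odot> v f"
proof (rule w_cancel[of _ "ob f"])
  note [simp] = el_simps[OF f x]
  have "bm (lm (el f f' x)) \<star> w (ob f) = w (ob f') \<star> el f f' x" using w_natural[of "el f f' x"] by simp
  also have "\<dots> = el f (bang P (cone f')) (u f' \<odot> x)" using comp_el[OF f x, of "w (ob f')"] by simp
  also have "\<dots> = bm (u f' \<odot> x) \<star> cj f" using bm_cj[of f "u f' \<odot> x"] by simp
  also have "\<dots> = bm (u f' \<odot> x \<odot> v f) \<star> w (ob f)" by (simp add: Q.assoc bm_v[symmetric])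
  finally show "bm (lm (el f f' x)) \<star> w (ob f) = bm (u f' \<odot> x \<odot> v f) \<star> w (ob f)" .
  show "lm (el f f' x) \<in> Arr P" "Dom P (lm (el f f' x)) = cone f" "Cod P (lm (el f f' x)) = Cod P (u f' \<odot> x \<odot> v f)"
    by simp_all
qed simp_all

text \<open>For an identity both \<open>u\<close> and \<open>v\<close> vanish. As
  \<open>u = 0\<close>, the identity of the cone factors through \<open>v = 0\<close>.\<close>

lemma cone_ide_zero:
  assumes X [simp]: "X \<in> Ob P" shows "zero_object P (cone (Ide P X))"
proof (rule P.zero_objectI)
  let ?f = "Ide P X" and ?C = "cone (Ide P X)"
  have "u ?f = Zero P X ?C" using uv_zero(1)[of ?f] by simp
  then have z: "Ide P ?C \<odot> u ?f = Zero P (Cod P ?f) (Cod P (Ide P ?C))" by simp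
  have v: "v ?f = Zero P ?C (P.so X)" using uv_zero(3)[of ?f] by simp
  show "Ide P ?C = Zero P ?C ?C"
  proof (rule factor_through_v[OF _ _ _ z])
    fix t assume t: "t \<in> Arr P" "Dom P t = P.so (Dom P ?f)" "Cod P t = Cod P (Ide P ?C)" "Ide P ?C = t \<odot> v ?f"
    have "t \<odot> v ?f = Zero P ?C ?C" unfolding v using t(1-3) by simp
    then show ?thesis using t(4) by (rule trans[rotated])
  qed simp_all
qed simp

text \<open>Arrows from \<open>A -> 0\<close> to \<open>!_Y\<close> are the arrows
  \<open>A[1] -> Y\<close>, so \<open>A[1]\<close> has the universal property of the cone; the unit
  corresponds to the inverse \<open>z\<close> of \<open>v\<close>.\<close>

lemma v_cobang_iso:
  assumes A [simp]: "A \<in> Ob P" shows "iso_arrow P (v (cobang P A))"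
proof -
  let ?f = "cobang P A" and ?I = "Ide P (P.so A)"
  have cj: "cj ?f = cn A (P.so A) ?I" by (simp add: cj_eq ck_cobang)
  obtain z where z [simp]: "z \<in> Arr P" "Dom P z = P.so A" "Cod P z = cone ?f" and wz: "w (ob ?f) = cn A (cone ?f) z"
    by (rule cn_surj[of "w (ob ?f)" A "cone ?f"]) simp_all
  have "cn A (P.so A) (v ?f \<odot> z) = cn A (P.so A) ?I"
    using bm_v[of ?f] bm_cn[of A z "v ?f"] by (simp add: wz cj)
  then have 1: "v ?f \<odot> z = ?I" by (rule cn_inj) simp_all
  have "bm (z \<odot> v ?f) \<star> w (ob ?f) = bm z \<star> cn A (P.so A) ?I" by (simp add: Q.assoc bm_v cj)
  also have "\<dots> = bm (Ide P (cone ?f)) \<star> w (ob ?f)" using bm_cn[of A ?I z] by (simp flip: wz)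
  finally have "z \<odot> v ?f = Ide P (cone ?f)" by (rule w_cancel) simp_all
  then show ?thesis using 1 unfolding iso_arrow_def
    by (intro exI[of _ z] P.inverse_arrowsI) simp_all
qed

lemma triangle_uv [simp]: "f \<in> Arr P \<Longrightarrow> triangle P (f, u f, v f)"
  by (simp add: triangle_def)

text \<open>
  The representatives \<open>x\<close> and \<open>w'\<close> of the Massey product \<open>{v\<^sub>f, u\<^sub>f, f} = id\<close> give, by adjunction,
  maps between \<open>A[1]\<close> and the cone of \<open>u\<^sub>f\<close> whose composite is \<open>id\<close>.
\<close>

lemma massey_retraction:
  assumes f [simp]: "f \<in> Arr P"
  obtains c c' where "c \<in> Arr P" "Dom P c = P.so (Dom P f)" "Cod P c = cone (u f)"
    "c' \<in> Arr P" "Dom P c' = cone (u f)" "Cod P c' = P.so (Dom P f)"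
    "c' \<odot> c = Ide P (P.so (Dom P f))" "c' \<odot> u (u f) = v f" "v (u f) \<odot> c = Neg P (P.sh f)"
proof -
  define A where "A = Dom P f"
  define g where "g = u f"
  define z where "z = cobang P A"
  have A [simp]: "A \<in> Ob P" "Dom P f = A" by (auto simp: A_def)
  have g [simp]: "g \<in> Arr P" "Dom P g = Cod P f" "Cod P g = cone f" "u f = g" by (simp_all add: g_def)
  have z [simp]: "z \<in> Arr P" "Dom P z = A" "Cod P z = zob P" "cobang P A = z" by (simp_all add: z_def)
  have vz [simp]: "iso_arrow P (v z)" using v_cobang_iso[of A] by simp
  let ?I = "Ide P (P.so A)"
  have gf: "g \<odot> f = Zero P (Dom P f) (Cod P g)" "v f \<odot> g = Zero P (Dom P g) (Cod P (v f))"
    using uv_zero[of f] by simp_all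
  obtain y where y: "massey_rep (v f) g f y" by (rule massey_rep_exists[OF _ _ _ _ _ gf]) simp_all
  have "toda_class P f (v f) y = toda_class P f (v f) ?I"
    using massey_eq[OF _ _ _ _ _ y] massey_id[of f] by (simp add: P.massey_class_eq_toda_class)
  moreover have "?I \<in> toda_class P f (v f) ?I" by (rule P.toda_class_self) (simp_all add: Hom_def)
  ultimately have "?I \<in> toda_class P f (v f) y" by simp
  \<comment> \<open>From the class to a representative: lifts with composite exactly
    \<open>-id\<close>.\<close>
  then have "massey_rep (v f) g f ?I" by (rule massey_rep_shift[rotated -1]) (simp_all add: y)
  then obtain x w' where x [simp]: "x \<in> Arr Q" "Dom Q x = ob z" "Cod Q x = ob g" "pa x = f"
    and w' [simp]: "w' \<in> Arr Q" "Dom Q w' = ob g" "Cod Q w' = bo (P.so A)" "pb w' = v f"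
    and wx: "w' \<star> x = cn A (P.so A) (Neg P ?I)"
    unfolding massey_rep_def by auto
  obtain c' where c' [simp]: "c' \<in> Arr P" "Dom P c' = cone g" "Cod P c' = P.so A" and w'e: "w' = bm c' \<star> w (ob g)"
    using universal[of w' "P.so A"] w' A(1) P.so_ob by metis
  have 1: "c' \<odot> u g = v f" using w'(4) by (simp add: w'e)
  have "bm (c' \<odot> lm x) \<star> w (ob z) = w' \<star> x" using w_natural[of x] by (simp add: Q.assoc w'e)
  also have "\<dots> = bm (Neg P ?I) \<star> cn A (P.so A) ?I" using bm_cn[of A ?I "Neg P ?I"] by (simp add: wx)
  also have "cn A (P.so A) ?I = bm (v z) \<star> w (ob z)" using ck_cobang[of A] by (simp add: bm_v cj_eq)
  also have "bm (Neg P ?I) \<star> bm (v z) \<star> w (ob z) = bm (Neg P (v z)) \<star> w (ob z)"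
    using bm_comp[of "v z" "Neg P ?I"] by (simp add: P.comp_neg Q.assoc del: bm_comp flip: Q.assoc)
  finally have 2: "c' \<odot> lm x = Neg P (v z)" by (rule w_cancel) simp_all
  have 3: "P.sh f \<odot> v z = v g \<odot> lm x"
    using P.triangle_mapD(12)[OF lm_triangle_map[of x z g]] by simp
  \<comment> \<open>Undoes the sign in \<open>c' L(x) = -v_z\<close> and replaces the cone of
    \<open>A -> 0\<close> by \<open>A[1]\<close>.\<close>
  let ?c = "Neg P (lm x \<odot> Inv P (v z))"
  have "c' \<odot> ?c = ?I"
    using P.comp_reduce[OF 2, of "Inv P (v z)"] by (simp add: P.comp_neg)
  moreover have "v g \<odot> ?c = Neg P (P.sh f)"
    using P.comp_reduce[OF 3[symmetric], of "Inv P (v z)"] by (simp add: P.comp_neg P.assoc)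
  ultimately show thesis using that[of ?c c'] 1 by simp
qed

text \<open>The Massey product gives \<open>c'\<close> together with a right inverse
  \<open>c\<close>. What remains is the compatibility of \<open>c'\<close> with the third maps and a
  left inverse, both by exactness of \<open>Hom(-,Y)\<close> alone.\<close>

lemma rotation_iso:
  assumes f [simp]: "f \<in> Arr P"
  obtains c where "iso_arrow P c"
    "triangle_map P (u f, u (u f), v (u f)) (u f, v f, Neg P (P.sh f)) (Ide P (Cod P f)) (Ide P (cone f)) c"
proof -
  define A g where "A = Dom P f" and "g = u f"
  have A [simp]: "A \<in> Ob P" "Dom P f = A" by (auto simp: A_def)
  have g [simp]: "g \<in> Arr P" "Dom P g = Cod P f" "Cod P g = cone f" by (simp_all add: g_def)
  obtain c c' where c [simp]: "c \<in> Arr P" "Dom P c = P.so A" "Cod P c = cone g"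
    and c' [simp]: "c' \<in> Arr P" "Dom P c' = cone g" "Cod P c' = P.so A"
    and cc: "c' \<odot> c = Ide P (P.so A)" and cu: "c' \<odot> u g = v f" and vc: "v g \<odot> c = Neg P (P.sh f)"
    using massey_retraction[OF f] unfolding A_def g_def by metis
  \<comment> \<open>The defect in the square of the third maps \<open>v_g\<close> and
    \<open>-f[1]\<close>. It kills \<open>u_g\<close>, so \<open>d = r v_g\<close>; as
    \<open>d c = 0\<close>, also \<open>r f[1] = 0\<close>. Desuspended, \<open>r\<close> factors
    through \<open>g = u_f\<close>, so that \<open>d\<close> is a multiple of
    \<open>g[1] v_g = 0\<close>.\<close>
  define d where "d = Add P (v g) (P.sh f \<odot> c')"
  have d [simp]: "d \<in> Arr P" "Dom P d = cone g" "Cod P d = P.so (Cod P f)" by (simp_all add: d_def)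
  have "d \<odot> u g = Zero P (Cod P g) (Cod P d)"
    by (simp add: d_def P.comp_add P.assoc cu)
  then obtain r where r [simp]: "r \<in> Arr P" "Dom P r = P.so (Cod P f)" "Cod P r = P.so (Cod P f)" and dr: "d = r \<odot> v g"
    using factor_through_v[of g d] d g by metis
  obtain s where s [simp]: "s \<in> Arr P" "Dom P s = Cod P f" "Cod P s = Cod P f" and rs: "P.sh s = r"
    by (rule P.sh_full[of r "Cod P f" "Cod P f"]) simp_all
  have "d \<odot> c = Zero P (P.so A) (P.so (Cod P f))"
    using P.neg_add_self[of "P.sh f"] by (simp add: d_def P.comp_add P.assoc cc vc)
  then have "r \<odot> P.sh f = Zero P (P.so A) (P.so (Cod P f))"
    using P.neg_neg[of "r \<odot> P.sh f"] by (simp add: dr P.assoc vc P.comp_neg del: P.neg_neg)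
  then have "P.sh (s \<odot> f) = P.sh (Zero P A (Cod P f))" by (simp add: rs)
  then have "s \<odot> f = Zero P A (Cod P f)" by (rule P.sh_faithful) simp_all
  then obtain t where t: "t \<in> Arr P" "Dom P t = cone f" "Cod P t = Cod P f" "s = t \<odot> g"
    using factor_through_u[of f s] s f A unfolding g_def by metis
  have "d = P.sh t \<odot> P.sh g \<odot> v g" using t(1-3) by (simp add: dr P.assoc t(4) flip: rs)
  then have d0: "d = Zero P (cone g) (P.so (Cod P f))" using t(1-3) by simp
  have vg: "v g = Neg P (P.sh f \<odot> c')"
    using d0 unfolding d_def by (intro P.neg_unique) simp_all
  \<comment> \<open>For the left inverse: \<open>u_g = y v_f\<close>, and \<open>1 - y c'\<close>
    kills \<open>u_g\<close>, so it is \<open>q v_g = -q f[1] c'\<close>. Hence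
    \<open>(y - q f[1]) c' = 1\<close>.\<close>
  have "u g \<odot> u f = Zero P (Cod P f) (Cod P (u g))" using uv_zero(1)[of g] by (simp add: g_def)
  then obtain y where y [simp]: "y \<in> Arr P" "Dom P y = P.so A" "Cod P y = cone g" and uy: "u g = y \<odot> v f"
    using factor_through_v[of f "u g"] g A f u_simps by metis
  define e where "e = Sub P (Ide P (cone g)) (y \<odot> c')"
  have e [simp]: "e \<in> Arr P" "Dom P e = cone g" "Cod P e = cone g" by (simp_all add: e_def)
  have "e \<odot> u g = Zero P (Cod P g) (Cod P e)" by (simp add: e_def P.comp_sub P.assoc cu flip: uy)
  then obtain q where q [simp]: "q \<in> Arr P" "Dom P q = P.so (Cod P f)" "Cod P q = cone g" and eq: "e = q \<odot> v g"
    using factor_through_v[of g e] e g by metis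
  have "Ide P (cone g) = Add P e (y \<odot> c')" by (simp add: e_def)
  also have "\<dots> = Add P (y \<odot> c') e" by (rule P.add_comm) simp_all
  also have "\<dots> = Sub P y (q \<odot> P.sh f) \<odot> c'"
    by (simp add: eq vg Sub_def P.comp_add P.comp_neg P.assoc)
  finally have "Sub P y (q \<odot> P.sh f) \<odot> c' = Ide P (cone g)" by simp
  then have "iso_arrow P c'"
    by (intro P.iso_arrowI_left_right[of c' "Sub P y (q \<odot> P.sh f)" c]) (simp_all add: cc)
  moreover have "triangle_map P (g, u g, v g) (g, v f, Neg P (P.sh f)) (Ide P (Cod P f)) (Ide P (cone f)) c'"
    by (rule P.triangle_mapI) (simp_all add: cu vg P.comp_neg)
  ultimately show thesis using that unfolding g_def by blast
qed

section \<open>The triangulation\<close>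

definition distinguished :: "('m \<times> 'm \<times> 'm) set" where
  "distinguished = {t. triangle P t \<and> (\<exists>f\<in>Arr P. \<exists>a b c. iso_arrow P a \<and> iso_arrow P b \<and> iso_arrow P c \<and>
     triangle_map P (f, u f, v f) t a b c)}"

lemma distinguishedI:
  "\<lbrakk>triangle P t; f \<in> Arr P; iso_arrow P a; iso_arrow P b; iso_arrow P c; triangle_map P (f, u f, v f) t a b c\<rbrakk>
    \<Longrightarrow> t \<in> distinguished"
  by (auto simp: distinguished_def)

lemma distinguishedE:
  assumes "t \<in> distinguished"
  obtains f a b c where "triangle P t" "f \<in> Arr P" "iso_arrow P a" "iso_arrow P b" "iso_arrow P c"
    "triangle_map P (f, u f, v f) t a b c"
  using assms by (auto simp: distinguished_def)

lemma distinguished_uv: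
  assumes f [simp]: "f \<in> Arr P" shows "(f, u f, v f) \<in> distinguished"
  by (rule distinguishedI[OF _ f, of _ "Ide P (Dom P f)" "Ide P (Cod P f)" "Ide P (cone f)"])
    (auto intro!: P.triangle_mapI)

lemma distinguished_iso:
  assumes "t \<in> distinguished" "triangle P t'" "triangle_map P t t' a b c"
    "iso_arrow P a" "iso_arrow P b" "iso_arrow P c"
  shows "t' \<in> distinguished"
proof -
  obtain f a' b' c' where t: "triangle P t" "f \<in> Arr P" "iso_arrow P a'" "iso_arrow P b'" "iso_arrow P c'"
    "triangle_map P (f, u f, v f) t a' b' c'" using assms(1) by (rule distinguishedE)
  have m: "triangle_map P (f, u f, v f) t' (a \<odot> a') (b \<odot> b') (c \<odot> c')"
    by (rule P.triangle_map_comp[OF t(6) assms(3)]) (use t assms in auto)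
  obtain g h k g' h' k' where e: "t = (g, h, k)" "t' = (g', h', k')" by (metis prod.exhaust)
  have "Dom P a = Cod P a'" "Dom P b = Cod P b'" "Dom P c = Cod P c'"
    using P.triangle_mapD(1-9)[OF assms(3)[unfolded e]] P.triangle_mapD(1-9)[OF t(6)[unfolded e]] by simp_all
  then show ?thesis
    using distinguishedI[OF assms(2) t(2) _ _ _ m] P.iso_comp t assms by blast
qed

lemma distinguished_id:
  assumes X [simp]: "X \<in> Ob P"
  shows "(Ide P X, Zero P X (zob P), Zero P (zob P) (P.so X)) \<in> distinguished"
proof -
  let ?f = "Ide P X" and ?C = "cone (Ide P X)"
  have i: "iso_arrow P (Zero P ?C (zob P))" unfolding iso_arrow_def
    using P.zero_object_arr(1)[OF cone_ide_zero[OF X], of "Ide P ?C"]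
    by (intro exI[of _ "Zero P (zob P) ?C"] P.inverse_arrowsI) (simp_all add: P.ide_zob)
  have v: "v ?f = Zero P ?C (P.so X)"
    using P.zero_object_arr(1)[OF cone_ide_zero[OF X], of "v ?f"] by simp
  have m: "triangle_map P (?f, u ?f, v ?f) (?f, Zero P X (zob P), Zero P (zob P) (P.so X)) ?f ?f (Zero P ?C (zob P))"
    by (rule P.triangle_mapI) (simp_all add: v)
  show ?thesis
    by (rule distinguishedI[OF _ _ _ _ i m]) (simp_all add: triangle_def)
qed

text \<open>An isomorphism \<open>(a,b,c)\<close> rotates to \<open>(b,c,a[1])\<close>, which
  reduces the claim to the sequence of \<open>f'\<close> and hence to
  \<open>rotation_iso\<close>.\<close>

lemma distinguished_rotate:
  assumes "(f, g, h) \<in> distinguished" shows "(g, h, Neg P (P.sh f)) \<in> distinguished"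
proof -
  obtain f' a b c where t: "triangle P (f, g, h)" and f' [simp]: "f' \<in> Arr P"
    and iso [simp]: "iso_arrow P a" "iso_arrow P b" "iso_arrow P c"
    and m: "triangle_map P (f', u f', v f') (f, g, h) a b c" using assms by (rule distinguishedE)
  note m = P.triangle_mapD[OF m]
  note [simp] = m(1-9) P.triangleD[OF t]
  obtain c' where c': "iso_arrow P c'"
    "triangle_map P (u f', u (u f'), v (u f')) (u f', v f', Neg P (P.sh f')) (Ide P (Cod P f')) (Ide P (cone f')) c'"
    by (rule rotation_iso[OF f'])
  have 1: "(u f', v f', Neg P (P.sh f')) \<in> distinguished"
    by (rule distinguishedI[OF _ _ _ _ c']) (simp_all add: triangle_def)
  have "P.sh b \<odot> P.sh f' = P.sh f \<odot> P.sh a" using m(10) by (simp flip: P.sh_comp)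
  then have 2: "triangle_map P (u f', v f', Neg P (P.sh f')) (g, h, Neg P (P.sh f)) b c (P.sh a)"
    using m(11,12) by (intro P.triangle_mapI) (simp_all add: P.comp_neg)
  show ?thesis
    by (rule distinguished_iso[OF 1 _ 2]) (simp_all add: triangle_def P.sh_iso)
qed

text \<open>Conjugated by the given isomorphisms, the square becomes one between \<open>f1\<close>
  and \<open>f2\<close>; it lifts to \<open>Ptr\<close> by fullness of \<open>p\<close>, and
  \<open>L\<close> of the lift is the third component.\<close>

lemma distinguished_map:
  assumes t: "(f, g, h) \<in> distinguished" "(f', g', h') \<in> distinguished"
    and a [simp]: "a \<in> Arr P" "Dom P a = Dom P f" "Cod P a = Dom P f'"
    and b [simp]: "b \<in> Arr P" "Dom P b = Cod P f" "Cod P b = Cod P f'" and sq: "b \<odot> f = f' \<odot> a"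
  shows "\<exists>c. triangle_map P (f, g, h) (f', g', h') a b c"
proof -
  obtain f1 a1 b1 c1 where t1: "triangle P (f, g, h)" and f1 [simp]: "f1 \<in> Arr P"
    and iso1 [simp]: "iso_arrow P a1" "iso_arrow P b1" "iso_arrow P c1"
    and m1: "triangle_map P (f1, u f1, v f1) (f, g, h) a1 b1 c1" using t(1) by (rule distinguishedE)
  obtain f2 a2 b2 c2 where t2: "triangle P (f', g', h')" and f2 [simp]: "f2 \<in> Arr P"
    and iso2 [simp]: "iso_arrow P a2" "iso_arrow P b2" "iso_arrow P c2"
    and m2: "triangle_map P (f2, u f2, v f2) (f', g', h') a2 b2 c2" using t(2) by (rule distinguishedE)
  have n1: "triangle_map P (f, g, h) (f1, u f1, v f1) (Inv P a1) (Inv P b1) (Inv P c1)"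
    by (rule P.triangle_map_Inv[OF m1]) (simp_all add: t1)
  have n2: "triangle_map P (f', g', h') (f2, u f2, v f2) (Inv P a2) (Inv P b2) (Inv P c2)"
    by (rule P.triangle_map_Inv[OF m2]) (simp_all add: t2)
  note m1' = P.triangle_mapD[OF m1] and m2' = P.triangle_mapD[OF m2]
    and n1' = P.triangle_mapD[OF n1] and n2' = P.triangle_mapD[OF n2]
  note [simp] = m1'(1-9) m2'(1-9) P.triangleD[OF t1] P.triangleD[OF t2]
  let ?a = "Inv P a2 \<odot> a \<odot> a1" and ?b = "Inv P b2 \<odot> b \<odot> b1"
  have "?b \<odot> f1 = Inv P b2 \<odot> (b \<odot> f) \<odot> a1" using m1'(10) by (simp add: P.assoc)
  also have "\<dots> = (Inv P b2 \<odot> f') \<odot> a \<odot> a1" unfolding sq by (simp add: P.assoc)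
  also have "\<dots> = f2 \<odot> ?a" unfolding n2'(10) by (simp add: P.assoc)
  finally have arr: "(f1, f2, ?a, ?b) \<in> Arr (arrowcat P)" by simp
  obtain m where m: "m \<in> Arr Q" "Dom Q m = ob f1" "Cod Q m = ob f2" "pa m = ?a" "pb m = ?b"
    by (rule lift_exists[OF arr])
  have l: "triangle_map P (f1, u f1, v f1) (f2, u f2, v f2) ?a ?b (lm m)"
    using lm_triangle_map[of m f1 f2] m by simp
  have "triangle_map P (f, g, h) (f', g', h') (a2 \<odot> ?a \<odot> Inv P a1) (b2 \<odot> ?b \<odot> Inv P b1) (c2 \<odot> lm m \<odot> Inv P c1)"
    by (rule P.triangle_map_comp[OF P.triangle_map_comp[OF n1 l] m2]) (simp_all add: t1 t2)
  moreover have "a2 \<odot> ?a \<odot> Inv P a1 = a" "b2 \<odot> ?b \<odot> Inv P b1 = b" by (simp_all add: P.assoc)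
  ultimately show ?thesis by metis
qed

lemma triangulated: "triangulated_category P distinguished"
proof
  show "tau_category P" by (rule base_tau)
  show "triangle P t" if "t \<in> distinguished" for t using that by (auto simp: distinguished_def)
  show "\<exists>g h. (f, g, h) \<in> distinguished" if "f \<in> Arr P" for f using distinguished_uv[OF that] by blast
  show "t' \<in> distinguished" if "t \<in> distinguished" "triangle P t'" "triangle_map P t t' a b c"
    "iso_arrow P a" "iso_arrow P b" "iso_arrow P c" for t t' a b c using that by (rule distinguished_iso)
qed (auto simp: distinguished_id distinguished_rotate Hom_def intro: distinguished_map)

end

sublocale adjoint_structure \<subseteq> T: triangulated_category P distinguished
  by (rule triangulated)

section \<open>Cones and translation\<close>

context adjoint_structure
begin

abbreviation "nsh f \<equiv> Neg P (P.sh f)"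

text \<open>
  The translate of \<open>!\<^sub>Y\<close> lies over \<open>0[1] \<rightarrow> Y[1]\<close>, whose source is a zero object but not the chosen
  one; so it is not \<open>!\<^sub>Y\<^sub>[\<^sub>1\<^sub>]\<close>, and has to be compared with it.
\<close>

definition bang_shift :: "'o \<Rightarrow> 'n" where
  "bang_shift Y = lift S (nsh (bang P Y)) (bang P (P.so Y)) (Zero P (P.so (zob P)) (zob P)) (Ide P (P.so Y))"

lemma bang_shift_simps [simp]:
  assumes "Y \<in> Ob P"
  shows "bang_shift Y \<in> Arr Q" "Dom Q (bang_shift Y) = ob (nsh (bang P Y))"
    "Cod Q (bang_shift Y) = bo (P.so Y)" "pb (bang_shift Y) = Ide P (P.so Y)"
  using lift_props_from[of "nsh (bang P Y)" "bang P (P.so Y)" "Ide P (P.so Y)" "Zero P (P.so (zob P)) (zob P)"]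
    P.zero_object_so[OF P.zob] assms by (simp_all add: bang_shift_def)

lemma bang_shift_natural:
  assumes [simp]: "g \<in> Arr P"
  shows "bang_shift (Cod P g) \<star> Q.sh (bm g) = bm (P.sh g) \<star> bang_shift (Dom P g)"
  by (rule eq_from_zero[of _ _ "nsh (bang P (Dom P g))"]) (simp_all add: P.zero_object_so[OF P.zob])

text \<open>The comparison from the cone of \<open>-f[1]\<close> to the translate of the cone of
  \<open>f\<close>, obtained by factoring the translated unit through the unit at
  \<open>-f[1]\<close>.\<close>

definition kappa :: "'m \<Rightarrow> 'm" where
  "kappa f = (SOME h. h \<in> Arr P \<and> Dom P h = cone (nsh f) \<and> Cod P h = P.so (cone f) \<and>
     bang_shift (cone f) \<star> Q.sh (w (ob f)) = bm h \<star> w (ob (nsh f)))"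

lemma kappa_props:
  assumes f [simp]: "f \<in> Arr P"
  shows "kappa f \<in> Arr P \<and> Dom P (kappa f) = cone (nsh f) \<and> Cod P (kappa f) = P.so (cone f) \<and>
     bang_shift (cone f) \<star> Q.sh (w (ob f)) = bm (kappa f) \<star> w (ob (nsh f))"
proof -
  obtain h where "h \<in> Arr P" "Dom P h = FO L (Dom Q (bang_shift (cone f) \<star> Q.sh (w (ob f))))" "Cod P h = P.so (cone f)"
    "bang_shift (cone f) \<star> Q.sh (w (ob f)) = bm h \<star> w (Dom Q (bang_shift (cone f) \<star> Q.sh (w (ob f))))"
    by (rule universal[of "bang_shift (cone f) \<star> Q.sh (w (ob f))" "P.so (cone f)"]) simp_all
  then have "\<exists>h. h \<in> Arr P \<and> Dom P h = cone (nsh f) \<and> Cod P h = P.so (cone f) \<and>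
     bang_shift (cone f) \<star> Q.sh (w (ob f)) = bm h \<star> w (ob (nsh f))" by (intro exI[of _ h]) simp
  then show ?thesis unfolding kappa_def by (rule someI_ex)
qed

lemma kappa_simps [simp]:
  "f \<in> Arr P \<Longrightarrow> kappa f \<in> Arr P" "f \<in> Arr P \<Longrightarrow> Dom P (kappa f) = cone (nsh f)"
  "f \<in> Arr P \<Longrightarrow> Cod P (kappa f) = P.so (cone f)"
  using kappa_props by auto

lemma bm_kappa: "f \<in> Arr P \<Longrightarrow> bm (kappa f) \<star> w (ob (nsh f)) = bang_shift (cone f) \<star> Q.sh (w (ob f))"
  using kappa_props by auto

lemma kappa_u:
  assumes f [simp]: "f \<in> Arr P" shows "kappa f \<odot> u (nsh f) = P.sh (u f)"
  using arg_cong[OF bm_kappa[OF f], of pb] by simp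

text \<open>No sign occurs: the translation of \<open>\<Delta>\<close> is
  \<open>x \<mapsto> x[1]\<close> and \<open>j_f\<close> is given by an identity, although the arrow
  \<open>f\<close> becomes \<open>-f[1]\<close>.\<close>

lemma cj_shift:
  assumes f [simp]: "f \<in> Arr P"
  shows "bang_shift (P.so (Dom P f)) \<star> Q.sh (cj f) = cj (nsh f)"
proof -
  let ?A = "P.so (Dom P f)"
  have "cj f = el f (bang P ?A) (Ide P ?A)" using bm_cj[of f "Ide P ?A"] by simp
  then have "Q.sh (cj f) = el (nsh f) (nsh (bang P ?A)) (Ide P (P.so ?A))"
    using el_sh[of f "bang P ?A" "Ide P ?A"] by simp
  then have "bang_shift ?A \<star> Q.sh (cj f) = el (nsh f) (bang P (P.so ?A)) (Ide P (P.so ?A))"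
    using comp_el[of "nsh f" "nsh (bang P ?A)" "Ide P (P.so ?A)" "bang_shift ?A"] by simp
  also have "\<dots> = cj (nsh f)" using bm_cj[of "nsh f" "Ide P (P.so ?A)"] by simp
  finally show ?thesis .
qed

lemma kappa_v:
  assumes f [simp]: "f \<in> Arr P" shows "P.sh (v f) \<odot> kappa f = v (nsh f)"
proof (rule w_cancel[of _ "ob (nsh f)"])
  have "bm (P.sh (v f) \<odot> kappa f) \<star> w (ob (nsh f)) =
      (bm (P.sh (v f)) \<star> bang_shift (cone f)) \<star> Q.sh (w (ob f))"
    by (simp add: Q.assoc bm_kappa)
  also have "bm (P.sh (v f)) \<star> bang_shift (cone f) = bang_shift (P.so (Dom P f)) \<star> Q.sh (bm (v f))"
    using bang_shift_natural[of "v f"] by simp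
  also have "(bang_shift (P.so (Dom P f)) \<star> Q.sh (bm (v f))) \<star> Q.sh (w (ob f)) =
      bang_shift (P.so (Dom P f)) \<star> Q.sh (bm (v f) \<star> w (ob f))"
    by (simp add: Q.assoc)
  also have "\<dots> = bm (v (nsh f)) \<star> w (ob (nsh f))" by (simp only: bm_v[OF f] cj_shift[OF f]) (simp add: bm_v)
  finally show "bm (P.sh (v f) \<odot> kappa f) \<star> w (ob (nsh f)) = bm (v (nsh f)) \<star> w (ob (nsh f))" .
qed simp_all

text \<open>Composed with the unit, both sides become the translate of \<open>w m\<close> followed
  by the comparison \<open>bang_shift\<close>.\<close>

lemma kappa_natural:
  assumes m [simp]: "m \<in> Arr Q" "Dom Q m = ob f" "Cod Q m = ob f'" "f \<in> Arr P" "f' \<in> Arr P"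
  shows "kappa f' \<odot> lm (Q.sh m) = P.sh (lm m) \<odot> kappa f"
proof (rule w_cancel[of _ "ob (nsh f)"])
  have "bm (kappa f' \<odot> lm (Q.sh m)) \<star> w (ob (nsh f)) = (bm (kappa f') \<star> w (ob (nsh f'))) \<star> Q.sh m"
    using w_natural[of "Q.sh m"] by (simp add: Q.assoc)
  also have "\<dots> = bang_shift (cone f') \<star> Q.sh (w (ob f') \<star> m)" by (simp add: bm_kappa Q.assoc)
  also have "w (ob f') \<star> m = bm (lm m) \<star> w (ob f)" using w_natural[of m] by simp
  also have "bang_shift (cone f') \<star> Q.sh (bm (lm m) \<star> w (ob f)) =
      (bang_shift (cone f') \<star> Q.sh (bm (lm m))) \<star> Q.sh (w (ob f))"
    by (simp add: Q.assoc)
  also have "\<dots> = (bm (P.sh (lm m)) \<star> bang_shift (cone f)) \<star> Q.sh (w (ob f))"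
    using bang_shift_natural[of "lm m"] by simp
  also have "\<dots> = bm (P.sh (lm m) \<odot> kappa f) \<star> w (ob (nsh f))"
    by (simp add: Q.assoc bm_kappa)
  finally show "bm (kappa f' \<odot> lm (Q.sh m)) \<star> w (ob (nsh f)) = bm (P.sh (lm m) \<odot> kappa f) \<star> w (ob (nsh f))" .
qed simp_all

lemma kappa_triangle_map:
  assumes f [simp]: "f \<in> Arr P"
  shows "triangle_map P (nsh f, u (nsh f), v (nsh f)) (nsh f, nsh (u f), nsh (v f))
    (Ide P (P.so (Dom P f))) (Ide P (P.so (Cod P f))) (Neg P (kappa f))"
  by (rule P.triangle_mapI) (simp_all add: P.comp_neg kappa_u kappa_v)

lemma kappa_iso:
  assumes f [simp]: "f \<in> Arr P" shows "iso_arrow P (Neg P (kappa f))"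
proof (rule T.third_component_iso)
  show "(nsh f, u (nsh f), v (nsh f)) \<in> distinguished" by (rule distinguished_uv) simp
  \<comment> \<open>Three rotations of \<open>(f, u f, v f)\<close>.\<close>
  show "(nsh f, nsh (u f), nsh (v f)) \<in> distinguished"
    by (intro distinguished_rotate distinguished_uv f)
  show "triangle_map P (nsh f, u (nsh f), v (nsh f)) (nsh f, nsh (u f), nsh (v f))
    (Ide P (Dom P (nsh f))) (Ide P (Cod P (nsh f))) (Neg P (kappa f))"
    using kappa_triangle_map[OF f] by simp
qed

text \<open>
  The sign: \<open>kappa f\<close> is compatible with \<open>u\<^sub>f[1]\<close> and \<open>v\<^sub>f[1]\<close>, while the translated triangle is
  \<open>(-f[1], -u\<^sub>f[1], -v\<^sub>f[1])\<close>.
\<close>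

definition k :: "'m \<Rightarrow> 'm" where "k f = Inv P (Neg P (kappa f))"

lemma k_iso: "f \<in> Arr P \<Longrightarrow> iso_arrow P (k f)"
  by (simp add: k_def P.iso_Inv kappa_iso)

lemma Inv_k: "f \<in> Arr P \<Longrightarrow> Inv P (k f) = Neg P (kappa f)"
  unfolding k_def by (rule P.Inv_eq[OF P.inverse_arrows_sym[OF P.iso_inverse[OF kappa_iso]]])

lemma triangle_choice_k: "triangle_choice P distinguished u v k"
  unfolding triangle_choice_def
proof (intro ballI conjI)
  fix f assume f [simp]: "f \<in> Arr P"
  show "(f, u f, v f) \<in> distinguished" by (rule distinguished_uv[OF f])
  show "iso_arrow P (k f)" by (rule k_iso[OF f])
  have i: "Inv P (Ide P X) = Ide P X" if "X \<in> Ob P" for X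
    using that by (intro P.Inv_eq P.inverse_arrowsI) simp_all
  have "triangle_map P (nsh f, nsh (u f), nsh (v f)) (nsh f, u (nsh f), v (nsh f))
    (Inv P (Ide P (P.so (Dom P f)))) (Inv P (Ide P (P.so (Cod P f)))) (Inv P (Neg P (kappa f)))"
    by (rule P.triangle_map_Inv[OF kappa_triangle_map[OF f]]) (simp_all add: triangle_def kappa_iso)
  then show "triangle_map P (nsh f, nsh (u f), nsh (v f)) (nsh f, u (nsh f), v (nsh f))
    (Ide P (P.so (Dom P f))) (Ide P (P.so (Cod P f))) (k f)"
    by (simp add: i k_def)
qed

text \<open>Naturality of \<open>kappa\<close>; the signs in \<open>k f'\<close> and in the inverse
  of \<open>k f\<close> cancel.\<close>

lemma lm_sh:
  assumes m [simp]: "m \<in> Arr Q" "Dom Q m = ob f" "Cod Q m = ob f'" "f \<in> Arr P" "f' \<in> Arr P"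
  shows "lm (Q.sh m) = k f' \<odot> P.sh (lm m) \<odot> Inv P (k f)"
proof -
  have "k f' \<odot> P.sh (lm m) \<odot> Inv P (k f) = k f' \<odot> Neg P (kappa f') \<odot> lm (Q.sh m)"
    by (simp add: Inv_k P.comp_neg kappa_natural[OF m])
  also have "\<dots> = lm (Q.sh m)" using kappa_iso[of f'] by (simp add: k_def)
  finally show ?thesis by simp
qed

section \<open>Comparison with \<open>Theta\<close> and the domination\<close>

lemma lm_null:
  assumes m: "null m" "Dom Q m = ob f" "Cod Q m = ob f'" and f [simp]: "f \<in> Arr P" "f' \<in> Arr P"
  shows "lm m \<odot> u f = Zero P (Cod P f) (cone f')" "v f' \<odot> lm m = Zero P (cone f) (P.so (Dom P f'))"
  using P.triangle_mapD(11,12)[OF lm_triangle_map[of m f f']] m by (simp_all add: null_def)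

abbreviation "Th \<equiv> Theta P u v k"

definition xi :: "'m \<Rightarrow> 'm \<Rightarrow> 'u \<Rightarrow> 'm" where
  "xi f f' x = lm (Inc S (ob f) (ob f') x)"

lemma Theta_carrier: "c \<in> carrier (BG Th f f') \<longleftrightarrow> c \<in> Arr P \<and> Dom P c = Cod P (u f) \<and> Cod P c = Cod P (u f') \<and>
    c \<odot> u f = Zero P (Cod P f) (Cod P (u f')) \<and> v f' \<odot> c = Zero P (Cod P (u f)) (P.so (Dom P f'))"
  by (auto simp: Theta_def Hom_def)

lemma xi_carrier:
  assumes f [simp]: "f \<in> Arr P" "f' \<in> Arr P" and x: "x \<in> carrier (BG (Ups S) f f')"
  shows "xi f f' x \<in> carrier (BG Th f f')"
proof -
  have i: "null (Inc S (ob f) (ob f') x)" "Dom Q (Inc S (ob f) (ob f') x) = ob f" "Cod Q (Inc S (ob f) (ob f') x) = ob f'"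
    using Inc_props(1)[of "ob f" "ob f'" x] x by auto
  then have "Inc S (ob f) (ob f') x \<in> Arr Q" by (simp add: null_def)
  then show ?thesis using lm_null[OF i f] i by (simp add: Theta_carrier xi_def)
qed

lemma xi_hom:
  assumes f [simp]: "f \<in> Arr P" "f' \<in> Arr P"
  shows "xi f f' \<in> hom (BG (Ups S) f f') (BG Th f f')"
proof (rule homI)
  show "xi f f' x \<in> carrier (BG Th f f')" if "x \<in> carrier (BG (Ups S) f f')" for x
    by (rule xi_carrier[OF f that])
  fix x y assume xy: "x \<in> carrier (BG (Ups S) f f')" "y \<in> carrier (BG (Ups S) f f')"
  have "Inc S (ob f) (ob f') (x \<otimes>\<^bsub>BG (Ups S) f f'\<^esub> y) = Add Q (Inc S (ob f) (ob f') x) (Inc S (ob f) (ob f') y)"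
    using Inc_props(2)[of "ob f" "ob f'" x y] xy by simp
  moreover have "null (Inc S (ob f) (ob f') x) \<and> Dom Q (Inc S (ob f) (ob f') x) = ob f \<and> Cod Q (Inc S (ob f) (ob f') x) = ob f'"
    "null (Inc S (ob f) (ob f') y) \<and> Dom Q (Inc S (ob f) (ob f') y) = ob f \<and> Cod Q (Inc S (ob f) (ob f') y) = ob f'"
    using Inc_props(1)[of "ob f" "ob f'" x] Inc_props(1)[of "ob f" "ob f'" y] xy by auto
  ultimately show "xi f f' (x \<otimes>\<^bsub>BG (Ups S) f f'\<^esub> y) = xi f f' x \<otimes>\<^bsub>BG Th f f'\<^esub> xi f f' y"
    by (simp add: xi_def Theta_def null_def)
qed

text \<open>The \<open>THE\<close> in the action of \<open>Theta\<close>: two lifts differ by a map killed by \<open>u\<close> and by \<open>v\<close>.\<close>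

lemma Theta_BM:
  assumes c: "c \<in> carrier (BG Th f f')"
    and a: "triangle_map P (f\<^sub>0, u f\<^sub>0, v f\<^sub>0) (f, u f, v f) a b c\<^sub>0"
    and b: "triangle_map P (f', u f', v f') (f\<^sub>1, u f\<^sub>1, v f\<^sub>1) a' b' c\<^sub>1"
    and f [simp]: "f\<^sub>0 \<in> Arr P" "f \<in> Arr P" "f' \<in> Arr P" "f\<^sub>1 \<in> Arr P"
  shows "BM Th (f\<^sub>0, f, a, b) (f', f\<^sub>1, a', b') c = c\<^sub>1 \<odot> c \<odot> c\<^sub>0"
proof -
  have c' [simp]: "c \<in> Arr P" "Dom P c = cone f" "Cod P c = cone f'"
    and cu: "c \<odot> u f = Zero P (Cod P f) (cone f')" and vc: "v f' \<odot> c = Zero P (cone f) (P.so (Dom P f'))"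
    using c by (simp_all add: Theta_carrier)
  note A = P.triangle_mapD[OF a] and B = P.triangle_mapD[OF b]
  have "d\<^sub>1 \<odot> c \<odot> d\<^sub>0 = c\<^sub>1 \<odot> c \<odot> c\<^sub>0"
    if d0: "triangle_map P (f\<^sub>0, u f\<^sub>0, v f\<^sub>0) (f, u f, v f) a b d\<^sub>0"
      and d1: "triangle_map P (f', u f', v f') (f\<^sub>1, u f\<^sub>1, v f\<^sub>1) a' b' d\<^sub>1" for d\<^sub>0 d\<^sub>1
  proof -
    note D = P.triangle_mapD[OF d0] and E = P.triangle_mapD[OF d1]
    note [simp] = A(7-9) B(7-9) D(7-9) E(7-9)
    define n where "n = Sub P d\<^sub>0 c\<^sub>0"
    have n [simp]: "n \<in> Arr P" "Dom P n = cone f\<^sub>0" "Cod P n = cone f" by (simp_all add: n_def)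
    have vn: "v f \<odot> n = Zero P (Dom P n) (Cod P (v f))" "Cod P n = Dom P (v f)"
      using A(12) D(12) by (simp_all add: n_def P.comp_sub)
    \<comment> \<open>On the source side the difference of two lifts factors through
      \<open>u f\<close>, which \<open>c\<close> kills.\<close>
    obtain s where s: "s \<in> Arr P" "Dom P s = Dom P n" "Cod P s = Dom P (u f)" "n = u f \<odot> s"
      by (rule T.lift_second[OF distinguished_uv[OF f(2)] n(1) vn(2,1)])
    have cn: "c \<odot> n = Zero P (cone f\<^sub>0) (cone f')"
      unfolding s(4) using P.comp_reduce[OF cu, of s] s(1-3) by simp
    have "c \<odot> d\<^sub>0 = c \<odot> Add P n c\<^sub>0" by (simp add: n_def)
    then have 1: "c \<odot> d\<^sub>0 = c \<odot> c\<^sub>0" by (simp add: P.comp_add cn)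
    define n' where "n' = Sub P d\<^sub>1 c\<^sub>1"
    have n' [simp]: "n' \<in> Arr P" "Dom P n' = cone f'" "Cod P n' = cone f\<^sub>1" by (simp_all add: n'_def)
    have "n' \<odot> u f' = Zero P (Cod P f') (Cod P n')"
      unfolding n'_def using B(4-6,11) E(11) by (simp add: P.comp_sub)
    \<comment> \<open>On the target side the difference factors through \<open>v f'\<close>, which
      kills \<open>c\<close>.\<close>
    then obtain t where t: "t \<in> Arr P" "Dom P t = P.so (Dom P f')" "Cod P t = Cod P n'" "n' = t \<odot> v f'"
      using factor_through_v[of f' n'] n' f by metis
    have n'c: "n' \<odot> c = Zero P (cone f) (cone f\<^sub>1)"
      unfolding t(4) using t(1-3) n'(3) by (simp add: P.assoc vc)
    have "d\<^sub>1 \<odot> c = Add P n' c\<^sub>1 \<odot> c" by (simp add: n'_def)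
    then have 2: "d\<^sub>1 \<odot> c = c\<^sub>1 \<odot> c" by (simp add: P.comp_add n'c)
    have "d\<^sub>1 \<odot> c \<odot> d\<^sub>0 = (d\<^sub>1 \<odot> c) \<odot> c\<^sub>0" by (simp add: 1 P.assoc)
    then show ?thesis by (simp add: 2 P.assoc)
  qed
  then have "(THE d. \<exists>d\<^sub>0 d\<^sub>1. triangle_map P (f\<^sub>0, u f\<^sub>0, v f\<^sub>0) (f, u f, v f) a b d\<^sub>0 \<and>
      triangle_map P (f', u f', v f') (f\<^sub>1, u f\<^sub>1, v f\<^sub>1) a' b' d\<^sub>1 \<and> d = d\<^sub>1 \<odot> c \<odot> d\<^sub>0) = c\<^sub>1 \<odot> c \<odot> c\<^sub>0"
    using a b by (intro the_equality) blast+
  then show ?thesis by (simp add: Theta_def)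
qed

text \<open>Arrows of the arrow category act on \<open>\<Upsilon>\<close> by composition with any
  lifts to \<open>Ptr\<close>, and \<open>L\<close> of these lifts are maps of triangles through
  which they act on \<open>\<Theta>\<close>.\<close>

lemma xi_natural:
  assumes g: "g \<in> Arr (arrowcat P)" and h: "h \<in> Arr (arrowcat P)"
    and x: "x \<in> carrier (BG (Ups S) (Cod (arrowcat P) g) (Dom (arrowcat P) h))"
  shows "xi (Dom (arrowcat P) g) (Cod (arrowcat P) h) (BM (Ups S) g h x) =
     BM Th g h (xi (Cod (arrowcat P) g) (Dom (arrowcat P) h) x)"
proof -
  obtain f\<^sub>0 f a b where ge: "g = (f\<^sub>0, f, a, b)" by (metis prod.exhaust)
  obtain f' f\<^sub>1 a' b' where he: "h = (f', f\<^sub>1, a', b')" by (metis prod.exhaust)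
  have f [simp]: "f\<^sub>0 \<in> Arr P" "f \<in> Arr P" "f' \<in> Arr P" "f\<^sub>1 \<in> Arr P" using g h by (simp_all add: ge he)
  have x' [simp]: "x \<in> carrier (BG (Ups S) f f')" using x by (simp add: ge he)
  obtain m where m [simp]: "m \<in> Arr Q" "Dom Q m = ob f\<^sub>0" "Cod Q m = ob f" "pa m = a" "pb m = b"
    by (rule lift_exists[OF g[unfolded ge]])
  obtain n where n [simp]: "n \<in> Arr Q" "Dom Q n = ob f'" "Cod Q n = ob f\<^sub>1" "pa n = a'" "pb n = b'"
    by (rule lift_exists[OF h[unfolded he]])
  have i: "Inc S (ob f) (ob f') x \<in> Arr Q" "Dom Q (Inc S (ob f) (ob f') x) = ob f" "Cod Q (Inc S (ob f) (ob f') x) = ob f'"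
    using Inc_props(1)[of "ob f" "ob f'" x] by (auto simp: null_def)
  have "Inc S (ob f\<^sub>0) (ob f\<^sub>1) (BM (Ups S) g h x) = n \<star> Inc S (ob f) (ob f') x \<star> m"
    using Inc_natural[of m n x] by (simp add: prj_eq ge he)
  then have "xi f\<^sub>0 f\<^sub>1 (BM (Ups S) g h x) = lm n \<odot> xi f f' x \<odot> lm m"
    using i by (simp add: xi_def)
  also have "\<dots> = BM Th g h (xi f f' x)"
    unfolding ge he using lm_triangle_map[of m f\<^sub>0 f] lm_triangle_map[of n f' f\<^sub>1]
    by (intro Theta_BM[symmetric] xi_carrier) simp_all
  finally show ?thesis by (simp add: ge he)
qed

lemma xi_tau_trans: "tau_trans (arrowcat P) (Ups S) Th xi"
  unfolding tau_trans_def bifun_trans_def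
proof (intro conjI ballI)
  fix f f' x assume "f \<in> Ob (arrowcat P)" "f' \<in> Ob (arrowcat P)" and x: "x \<in> carrier (BG (Ups S) f f')"
  then have f [simp]: "f \<in> Arr P" "f' \<in> Arr P" by simp_all
  have i: "Inc S (ob f) (ob f') x \<in> Arr Q" "Dom Q (Inc S (ob f) (ob f') x) = ob f" "Cod Q (Inc S (ob f) (ob f') x) = ob f'"
    using Inc_props(1)[of "ob f" "ob f'" x] x by (auto simp: null_def)
  have "Inc S (ob (nsh f)) (ob (nsh f')) (BT (Ups S) f f' x) = Q.sh (Inc S (ob f) (ob f') x)"
    using Inc_sh[of "ob f" "ob f'" x] x by simp
  then show "xi (ShO (arrowcat P) f) (ShO (arrowcat P) f') (BT (Ups S) f f' x) = BT Th f f' (xi f f' x)"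
    using lm_sh[OF i f] by (simp add: xi_def Theta_def)
qed (simp_all add: xi_hom xi_natural)

lemma xi_Phi:
  assumes f [simp]: "f \<in> Arr P" "f' \<in> Arr P" and x: "x \<in> Arr P" "Dom P x = P.so (Dom P f)" "Cod P x = Cod P f'"
  shows "xi f f' (Phi S f f' (toda_class P f f' x)) = u f' \<odot> x \<odot> v f"
  using lm_el[OF f x] by (simp add: xi_def el_def)

text \<open>At a split arrow each element of \<open>\<Upsilon>\<close> comes from some
  \<open>t : A[1] -> B'\<close>, on which \<open>xi\<close> is \<open>t \<mapsto> u' t v\<close>.
  Injectivity and surjectivity are then those of the map from \<open>\<Delta>\<close> to
  \<open>\<Theta>\<close>.\<close>

lemma xi_iso:
  assumes f [simp]: "f \<in> Arr P" "f' \<in> Arr P" and s: "split_arrow P f \<or> split_arrow P f'"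
  shows "xi f f' \<in> iso (BG (Ups S) f f') (BG Th f f')"
proof -
  have s': "splittable P f \<or> splittable P f'" using s P.split_imp_splittable f by blast
  note d = distinguished_uv[OF f(1)] distinguished_uv[OF f(2)]
  have el: "\<exists>t. t \<in> Arr P \<and> Dom P t = P.so (Dom P f) \<and> Cod P t = Cod P f' \<and> Inc S (ob f) (ob f') x = el f f' t"
    if x: "x \<in> carrier (BG (Ups S) f f')" for x
    by (rule null_is_el[OF f s', of "Inc S (ob f) (ob f') x"]) (use Inc_props(1)[of "ob f" "ob f'" x] x in auto)
  have "inj_on (xi f f') (carrier (BG (Ups S) f f'))"
  proof (rule inj_onI)
    fix x y assume xy: "x \<in> carrier (BG (Ups S) f f')" "y \<in> carrier (BG (Ups S) f f')" and e: "xi f f' x = xi f f' y"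
    obtain t where t [simp]: "t \<in> Arr P" "Dom P t = P.so (Dom P f)" "Cod P t = Cod P f'" and xt: "Inc S (ob f) (ob f') x = el f f' t"
      using el[OF xy(1)] by blast
    obtain t' where t' [simp]: "t' \<in> Arr P" "Dom P t' = P.so (Dom P f)" "Cod P t' = Cod P f'" and yt: "Inc S (ob f) (ob f') y = el f f' t'"
      using el[OF xy(2)] by blast
    have "u f' \<odot> t \<odot> v f = u f' \<odot> t' \<odot> v f" using e by (simp add: xi_def xt yt lm_el)
    then have "u f' \<odot> Sub P t t' \<odot> v f = Zero P (Cod P (u f)) (Cod P (u f'))"
      by (simp add: P.comp_sub)
    then have "\<exists>g h. g \<in> Arr P \<and> Dom P g = P.so (Dom P f) \<and> Cod P g = Dom P f' \<and>
      h \<in> Arr P \<and> Dom P h = P.so (Cod P f) \<and> Cod P h = Cod P f' \<and> Sub P t t' = Sub P (f' \<odot> g) (h \<odot> P.sh f)"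
      by (intro T.theta_inj[OF d s']) simp_all
    then have "Sub P t t' \<in> toda_rel P f f'" unfolding P.toda_rel_iff by blast
    then have z: "el f f' (Sub P t t') = Zero Q (ob f) (ob f')" by (intro el_eq_zeroI) simp_all
    have "el f f' t = el f f' t'"
      by (rule Q.eq_if_sub_zero[of _ _ "ob f" "ob f'"]) (use z in \<open>simp_all add: el_sub el_simps\<close>)
    then show "x = y" using Inc_props(3)[of "ob f" "ob f'" x y] xy xt yt by simp
  qed
  moreover have "xi f f' ` carrier (BG (Ups S) f f') = carrier (BG Th f f')"
  proof (rule equalityI; rule subsetI)
    fix c assume "c \<in> xi f f' ` carrier (BG (Ups S) f f')"
    then show "c \<in> carrier (BG Th f f')" using xi_carrier[OF f] by blast
  next
    fix c assume "c \<in> carrier (BG Th f f')"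
    then have "\<exists>x. x \<in> Arr P \<and> Dom P x = P.so (Dom P f) \<and> Cod P x = Cod P f' \<and> c = u f' \<odot> x \<odot> v f"
      by (intro T.theta_surj[OF d s']) (auto simp: Theta_carrier)
    then obtain x where x: "x \<in> Arr P" "Dom P x = P.so (Dom P f)" "Cod P x = Cod P f'" "c = u f' \<odot> x \<odot> v f" by blast
    then show "c \<in> xi f f' ` carrier (BG (Ups S) f f')"
      using xi_Phi[OF f x(1-3)] Phi_carrier[OF f x(1-3)] by (metis image_eqI)
  qed
  ultimately show ?thesis using xi_hom[OF f] by (simp add: iso_def bij_betw_def)
qed

abbreviation "tri \<equiv> tri_cat P u v k"

definition J :: "('p, 'n, 'm, 'm tm) ftor" where
  "J = \<lparr>FO = ar, FM = (\<lambda>m. (ar (Dom Q m), ar (Cod Q m), pa m, pb m, lm m))\<rparr>"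

lemma J_tau: "tau_ftor Q tri J"
proof -
  have arr: "FM J m \<in> Hom tri (ar X) (ar Y)" if m: "m \<in> Hom Q X Y" for m X Y
  proof -
    have m' [simp]: "m \<in> Arr Q" "Dom Q m = X" "Cod Q m = Y" "X \<in> Ob Q" "Y \<in> Ob Q"
      using m by (auto simp: Hom_def)
    show ?thesis using lm_triangle_map[of m "ar X" "ar Y"]
      by (simp add: J_def tri_cat_def Hom_def)
  qed
  have "is_ftor Q tri J" unfolding is_ftor_def
  proof (intro conjI ballI impI)
    fix X Y f assume "f \<in> Hom Q X Y" then show "FM J f \<in> Hom tri (FO J X) (FO J Y)"
      using arr by (simp add: J_def)
  qed (simp_all add: J_def tri_cat_def)
  moreover have "FM J \<in> hom (homgrp Q X Y) (homgrp tri (FO J X) (FO J Y))" if "X \<in> Ob Q" "Y \<in> Ob Q" for X Y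
  proof (rule homI)
    fix m n assume m: "m \<in> carrier (homgrp Q X Y)" "n \<in> carrier (homgrp Q X Y)"
    show "FM J m \<in> carrier (homgrp tri (FO J X) (FO J Y))" using arr[of m X Y] m by (simp add: J_def homgrp_def)
    show "FM J (m \<otimes>\<^bsub>homgrp Q X Y\<^esub> n) = FM J m \<otimes>\<^bsub>homgrp tri (FO J X) (FO J Y)\<^esub> FM J n"
      using m by (simp add: J_def homgrp_def tri_cat_def Hom_def)
  qed
  moreover have "FM J (Q.sh m) = ShM tri (FM J m)" if [simp]: "m \<in> Arr Q" for m
    \<comment> \<open>The translation of \<open>tri_cat\<close> conjugates by \<open>k\<close>, and
      \<open>L\<close> commutes with translations in just this form.\<close>
    using lm_sh[of m "ar (Dom Q m)" "ar (Cod Q m)"] by (simp add: J_def tri_cat_def)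
  ultimately show ?thesis unfolding tau_ftor_def additive_ftor_def
    by (simp add: J_def tri_cat_def)
qed

lemma domination: "dominated P (Triangles0 P u v k) S"
  unfolding dominated_def
proof (rule exI[of _ xi], rule exI[of _ J], intro conjI ballI impI)
  show "tau_trans (arrowcat P) (Ups S) (Ups (Triangles0 P u v k)) xi"
    using xi_tau_trans by (simp add: Triangles0_def)
  show "tau_ftor (Ptr S) (Ptr (Triangles0 P u v k)) J"
    using J_tau by (simp add: Triangles0_def)
  show "xi f f' \<in> iso (BG (Ups S) f f') (BG (Ups (Triangles0 P u v k)) f f')"
    if "f \<in> Arr P" "f' \<in> Arr P" "split_arrow P f \<or> split_arrow P f'" for f f'
    using xi_iso[OF that] by (simp add: Triangles0_def)
  show "Phi (Triangles0 P u v k) f f' K = xi f f' (Phi S f f' K)"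
    if f [simp]: "f \<in> Arr P" "f' \<in> Arr P" and K: "K \<in> carrier (BG (Toda P) f f')" for f f' K
  proof -
    obtain x where x: "x \<in> Hom P (P.so (Dom P f)) (Cod P f')" "K = toda_class P f f' x"
      using P.toda_class_surj[OF f K] by blast
    have "(\<lambda>x. u f' \<odot> x \<odot> v f) ` K = {u f' \<odot> x \<odot> v f}"
      unfolding x(2) by (rule P.toda_class_image[OF f x(1)]) simp_all
    then show ?thesis using xi_Phi[OF f, of x] x by (simp add: Triangles0_def Hom_def)
  qed
  show "FO (Prj (Triangles0 P u v k)) (FO J X) = ar X" for X
    by (simp add: Triangles0_def J_def)
  show "FM (Prj (Triangles0 P u v k)) (FM J m) = FM (Prj S) m" if "m \<in> Arr Q" for m
    using that by (simp add: Triangles0_def J_def prj_eq)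
  show "FM J (Inc S X Y x) = Inc (Triangles0 P u v k) (FO J X) (FO J Y) (xi (ar X) (ar Y) x)"
    if "X \<in> Ob Q" "Y \<in> Ob Q" "x \<in> carrier (BG (Ups S) (ar X) (ar Y))" for X Y x
    using Inc_props(1)[OF that(1,2,3)] that by (simp add: Triangles0_def J_def xi_def null_def)
qed

end

theorem corollary6p2p2:
  fixes P :: "('o, 'm) tcat"
    and S :: "('m, 'p, 'n, 'u) pstruct"
    and M :: "('o, 'm, 'o, 'm) ftor"
  assumes "tau_category P"
    and "inverse_translation P M"
    and "pseudo_triangulated P S"
  shows
    "(\<exists>\<D> u v k. triangulated_category P \<D> \<and> triangle_choice P \<D> u v k \<and>
        dominated P (Triangles0 P u v k) S)
     \<longleftrightarrow>
     (\<exists>L w. adjunction (Ptr S) P L (Bang P S) w \<and>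
        (\<exists>\<eta>. adjunction P (Ptr S) (Cobang P S) (comp_ftor M L) \<eta>) \<and>
        (\<forall>f\<in>Arr P.
           massey P S (adj_v P S L w f) (adj_u P S L w f) f =
           massey_class P (adj_v P S L w f) (adj_u P S L w f) f (Ide P (ShO P (Dom P f)))))"
    (is "?lhs \<longleftrightarrow> ?rhs")
proof
  assume ?lhs
  then obtain \<D> u v k where t: "triangulated_category P \<D>" "triangle_choice P \<D> u v k"
    and "dominated P (Triangles0 P u v k) S" by blast
  then obtain \<xi> j where
    d: "tau_ftor (Ptr S) (Ptr (Triangles0 P u v k)) j"
      "\<forall>f\<in>Arr P. \<forall>f'\<in>Arr P. split_arrow P f \<or> split_arrow P f' \<longrightarrow>
        \<xi> f f' \<in> iso (BG (Ups S) f f') (BG (Ups (Triangles0 P u v k)) f f')"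
      "\<forall>f\<in>Arr P. \<forall>f'\<in>Arr P. \<forall>x\<in>carrier (BG (Toda P) f f').
        Phi (Triangles0 P u v k) f f' x = \<xi> f f' (Phi S f f' x)"
      "\<forall>X\<in>Ob (Ptr S). FO (Prj (Triangles0 P u v k)) (FO j X) = FO (Prj S) X"
      "\<forall>m\<in>Arr (Ptr S). FM (Prj (Triangles0 P u v k)) (FM j m) = FM (Prj S) m"
      "\<forall>X\<in>Ob (Ptr S). \<forall>Y\<in>Ob (Ptr S).
        \<forall>x\<in>carrier (BG (Ups S) (FO (Prj S) X) (FO (Prj S) Y)).
          FM j (Inc S X Y x) =
          Inc (Triangles0 P u v k) (FO j X) (FO j Y) (\<xi> (FO (Prj S) X) (FO (Prj S) Y) x)"
    unfolding dominated_def by blast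
  interpret T: triangulated_category P \<D> by (rule t(1))
  interpret dominating_triangulation P S \<D> u v k \<xi> j
  proof unfold_locales
    show "\<xi> f f' \<in> iso (BG (Ups S) f f') (BG (Theta P u v k) f f')"
      if "f \<in> Arr P" "f' \<in> Arr P" "split_arrow P f \<or> split_arrow P f'" for f f'
      using d(2)[rule_format, OF that] by (simp add: Triangles0_def)
  qed (use assms(1,3) t(2) d(1,3-) in \<open>simp_all add: Triangles0_def\<close>)
  \<comment> \<open>The maps that the adjunction defines are the chosen \<open>u\<close> and
    \<open>v\<close>, so the Massey condition for triangles is the one required.\<close>
  show ?rhs
    using left_adjunction right_adjunction[OF assms(2)] massey_condition
    by (intro exI[of _ L] exI[of _ unit]) (simp add: adj_u_eq adj_v_eq)
next
  assume ?rhs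
  then obtain L w where "adjunction (Ptr S) P L (Bang P S) w"
    "\<forall>f\<in>Arr P. massey P S (adj_v P S L w f) (adj_u P S L w f) f =
       massey_class P (adj_v P S L w f) (adj_u P S L w f) f (Ide P (ShO P (Dom P f)))" by blast
  then interpret adjoint_structure P S L w
    by unfold_locales (use assms(1,3) in simp_all)
  show ?lhs using triangulated triangle_choice_k domination by blast
qed

end
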